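(* Let $\mathfrak g$ be a finite-dimensional Lie algebra with basis $\{e_i\}$ and dual basis $\{e^i\}$ of $\mathfrak g^*$, and let $H=U(\mathfrak g\ltimes\mathfrak g^* )$ act on $S(\mathfrak g)$ with $e_i$ acting as the derivation extending ${\rm ad}_{e_i}$ and $e^i$ acting as the derivation extending evaluation $v\mapsto e^i(v)$. Put $Q_1=e_i\otimes e^i$, $Q_2=e^i\otimes e_i$, $:\!Q_1Q_2\!:\,=e_ie^j\otimes e_je^i$, $:\!Q_1Q_2\!:^R=e^je_i\otimes e^ie_j$ (sums over repeated indices, products in $H\otimes H$), and $\kappa_{ij}=-\mathrm{tr}({\rm ad}_{e_i}{\rm ad}_{e_j})$. Let $\alpha,\beta\in\mathbb{C}$ with $\alpha-\beta=-\frac12$ and let $$F^{-1}=1\otimes1+\hbar(\alpha Q_1+\beta Q_2)+\hbar^2\Big(\tfrac{\alpha^2}{2}(Q_1+Q_2)Q_1+\tfrac{\beta^2}{2}(Q_1+Q_2)Q_2-\tfrac1{24}\big(:\!Q_1Q_2\!:+2:\!Q_1Q_2\!:^R+2\kappa_{ij}e^i\otimes e^j\big)\Big)+O(\hbar^3)$$ be any element of $(H\otimes H)[[\hbar]]$ with this expansion, and $F$ its inverse. Then: (a) for all $a,b\in S(\mathfrak g)$, $\mu(F^{-1}\triangleright(a\otimes b))=\varphi^{-1}(\varphi(a)\varphi(b))+O(\hbar^3)$, where $\mu$ is the product of $S(\mathfrak g)$ and $\varphi:S(\mathfrak g)\to U_\hbar(\mathfrak g)$ is the symmetrisation map into the algebra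 generated by $\mathfrak g$ with relations $vw-wv=\hbar[v,w]$; (b) for all $x\in\mathfrak g^*$, $\Delta_F(x)=F\,\Delta(x)\,F^{-1}$ (with $\Delta x=x\otimes1+1\otimes x$) lies in $S(\mathfrak g^* )\otimes S(\mathfrak g^* )$ up to $O(\hbar^3)$.
   Context: $\mathfrak g\ltimes\mathfrak g^*$ is the Lie algebra in which $\mathfrak g^*$ is an abelian ideal and $[x,\phi]=-\phi\circ{\rm ad}_x$ for $x\in\mathfrak g$, $\phi\in\mathfrak g^*$; $S(\mathfrak g^* )=U(\mathfrak g^* )$ is the subalgebra of $H$ generated by $\mathfrak g^*$. $H$ is a Hopf algebra with $\mathfrak g\ltimes\mathfrak g^*$ primitive, and $S(\mathfrak g)$ is an $H$-module algebra under the stated action. $\varphi(v_1\cdots v_n)=\frac1{n!}\sum_{\kappa\in S_n}v_{\kappa(1)}\cdots v_{\kappa(n)}$. *)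

theory Defs
  imports Complex_Main "HOL-Combinatorics.Permutations"
begin

section \<open>Free associative algebras over C (elements = coefficient functions on words)\<close>

type_synonym 'a fa = "'a list \<Rightarrow> complex"

definition fa_fin :: "'a fa \<Rightarrow> bool" where
  "fa_fin p \<longleftrightarrow> finite {w. p w \<noteq> 0}"

definition fa_zero :: "'a fa" where "fa_zero = (\<lambda>_. 0)"
definition fa_word :: "'a list \<Rightarrow> 'a fa" where
  "fa_word w = (\<lambda>v. if v = w then 1 else 0)"
definition fa_one :: "'a fa" where "fa_one = fa_word []"
definition fa_gen :: "'a \<Rightarrow> 'a fa" where "fa_gen x = fa_word [x]"
definition fa_add :: "'a fa \<Rightarrow> 'a fa \<Rightarrow> 'a fa" where
  "fa_add p q = (\<lambda>w. p w + q w)"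
definition fa_diff :: "'a fa \<Rightarrow> 'a fa \<Rightarrow> 'a fa" where
  "fa_diff p q = (\<lambda>w. p w - q w)"
definition fa_smult :: "complex \<Rightarrow> 'a fa \<Rightarrow> 'a fa" where
  "fa_smult c p = (\<lambda>w. c * p w)"
definition fa_sum :: "('i \<Rightarrow> 'a fa) \<Rightarrow> 'i set \<Rightarrow> 'a fa" where
  "fa_sum f A = (\<lambda>w. \<Sum>x\<in>A. f x w)"
definition fa_mul :: "'a fa \<Rightarrow> 'a fa \<Rightarrow> 'a fa" where
  "fa_mul p q = (\<lambda>w. \<Sum>i\<le>length w. p (take i w) * q (drop i w))"
definition fa_lin :: "('a list \<Rightarrow> 'b fa) \<Rightarrow> 'a fa \<Rightarrow> 'b fa" where
  "fa_lin f p = (\<lambda>w. \<Sum>v\<in>{v. p v \<noteq> 0}. p v * f v w)"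
definition fa_map :: "('a \<Rightarrow> 'b) \<Rightarrow> 'a fa \<Rightarrow> 'b fa" where
  "fa_map f p = fa_lin (\<lambda>v. fa_word (map f v)) p"

inductive_set fa_ideal :: "'a fa set \<Rightarrow> 'a fa set" for R :: "'a fa set" where
  base: "r \<in> R \<Longrightarrow> r \<in> fa_ideal R"
| zero: "fa_zero \<in> fa_ideal R"
| add: "p \<in> fa_ideal R \<Longrightarrow> q \<in> fa_ideal R \<Longrightarrow> fa_add p q \<in> fa_ideal R"
| mult: "p \<in> fa_ideal R \<Longrightarrow> fa_fin x \<Longrightarrow> fa_fin y \<Longrightarrow> fa_mul x (fa_mul p y) \<in> fa_ideal R"

definition fa_cong :: "'a fa set \<Rightarrow> 'a fa \<Rightarrow> 'a fa \<Rightarrow> bool" where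
  "fa_cong R p q \<longleftrightarrow> fa_diff p q \<in> fa_ideal R"

definition fa_comm :: "'a fa \<Rightarrow> 'a fa \<Rightarrow> 'a fa" where
  "fa_comm p q = fa_diff (fa_mul p q) (fa_mul q p)"

section \<open>The Lie algebra g: basis e_0..e_{n-1}, structure constants [e_i,e_j] = sum_k c i j k e_k\<close>

definition lie_sc :: "nat \<Rightarrow> (nat \<Rightarrow> nat \<Rightarrow> nat \<Rightarrow> complex) \<Rightarrow> bool" where
  "lie_sc n c \<longleftrightarrow>
     (\<forall>i<n. \<forall>j<n. \<forall>k<n. c i j k = - c j i k) \<and>
     (\<forall>i<n. \<forall>j<n. \<forall>k<n. \<forall>m<n.
        (\<Sum>l<n. c i j l * c l k m + c j k l * c l i m + c k i l * c l j m) = 0)"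

text \<open>kappa_ij = - tr(ad_{e_i} ad_{e_j}).\<close>
definition kappa :: "nat \<Rightarrow> (nat \<Rightarrow> nat \<Rightarrow> nat \<Rightarrow> complex) \<Rightarrow> nat \<Rightarrow> nat \<Rightarrow> complex" where
  "kappa n c i j = - (\<Sum>k<n. \<Sum>l<n. c j k l * c i l k)"

definition S_rel :: "nat \<Rightarrow> nat fa set" where
  "S_rel n = {fa_comm (fa_gen i) (fa_gen j) | i j. i < n \<and> j < n}"

definition S_elem :: "nat \<Rightarrow> nat fa \<Rightarrow> bool" where
  "S_elem n p \<longleftrightarrow> fa_fin p \<and> (\<forall>w. p w \<noteq> 0 \<longrightarrow> (\<forall>i\<in>set w. i < n))"

section \<open>U_hbar(g): generators None (= hbar, central) and Some i (= e_i), relations vw - wv = hbar[v,w]\<close>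

definition U_rel :: "nat \<Rightarrow> (nat \<Rightarrow> nat \<Rightarrow> nat \<Rightarrow> complex) \<Rightarrow> nat option fa set" where
  "U_rel n c = {fa_comm (fa_gen None) (fa_gen (Some i)) | i. i < n} \<union>
     {fa_diff (fa_comm (fa_gen (Some i)) (fa_gen (Some j)))
        (fa_mul (fa_gen None) (fa_sum (\<lambda>k. fa_smult (c i j k) (fa_gen (Some k))) {..<n}))
      | i j. i < n \<and> j < n}"

definition hpow :: "nat \<Rightarrow> nat option fa" where
  "hpow k = fa_word (replicate k None)"

definition sym_word :: "nat list \<Rightarrow> nat option fa" where
  "sym_word w = fa_smult (1 / of_nat (fact (length w)))
     (fa_sum (\<lambda>\<sigma>. fa_word (map (\<lambda>i. Some (w ! \<sigma> i)) [0..<length w]))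
             {\<sigma>. \<sigma> permutes {..<length w}})"

definition phi :: "nat fa \<Rightarrow> nat option fa" where
  "phi p = fa_lin sym_word p"

text \<open>phi extended hbar-linearly to S(g)[hbar] (coefficient sequences, zero from N on),
  and its inverse on U_hbar(g).\<close>
definition phi_hbar :: "(nat \<Rightarrow> nat fa) \<Rightarrow> nat \<Rightarrow> nat option fa" where
  "phi_hbar P N = fa_sum (\<lambda>k. fa_mul (hpow k) (phi (P k))) {..<N}"

definition phi_inv :: "nat \<Rightarrow> (nat \<Rightarrow> nat \<Rightarrow> nat \<Rightarrow> complex) \<Rightarrow> nat option fa \<Rightarrow> (nat \<Rightarrow> nat fa)" where
  "phi_inv n c u = (SOME P. (\<forall>k. S_elem n (P k)) \<and>
      (\<exists>N. (\<forall>k\<ge>N. P k = fa_zero) \<and> fa_cong (U_rel n c) (phi_hbar P N) u))"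

text \<open>E i = e_i, D i = e^i; a generator of H (x) H is a pair (side, generator),
  side False = first tensor factor, True = second.\<close>
datatype gen = E nat | D nat

fun gen_idx :: "gen \<Rightarrow> nat" where
  "gen_idx (E i) = i" | "gen_idx (D i) = i"

type_synonym hh = "(bool \<times> gen) fa"

definition hg :: "bool \<Rightarrow> gen \<Rightarrow> hh" where "hg s x = fa_gen (s, x)"

text \<open>Relations: [e_i,e_j] = sum c_ijk e_k; [e_i,e^j] = -e^j o ad_{e_i} = - sum_k c i k j e^k;
  [e^i,e^j] = 0; the two tensor factors commute.\<close>
definition HH_rel :: "nat \<Rightarrow> (nat \<Rightarrow> nat \<Rightarrow> nat \<Rightarrow> complex) \<Rightarrow> hh set" where
  "HH_rel n c =
     {fa_diff (fa_comm (hg s (E i)) (hg s (E j))) (fa_sum (\<lambda>k. fa_smult (c i j k) (hg s (E k))) {..<n})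
       | s i j. i < n \<and> j < n} \<union>
     {fa_add (fa_comm (hg s (E i)) (hg s (D j))) (fa_sum (\<lambda>k. fa_smult (c i k j) (hg s (D k))) {..<n})
       | s i j. i < n \<and> j < n} \<union>
     {fa_comm (hg s (D i)) (hg s (D j)) | s i j. i < n \<and> j < n} \<union>
     {fa_comm (hg False x) (hg True y) | x y. gen_idx x < n \<and> gen_idx y < n}"

definition HH_elem :: "nat \<Rightarrow> hh \<Rightarrow> bool" where
  "HH_elem n p \<longleftrightarrow> fa_fin p \<and> (\<forall>w. p w \<noteq> 0 \<longrightarrow> (\<forall>(s,x)\<in>set w. gen_idx x < n))"

definition SgsSgs_elem :: "nat \<Rightarrow> hh \<Rightarrow> bool" where
  "SgsSgs_elem n p \<longleftrightarrow> fa_fin p \<and>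
     (\<forall>w. p w \<noteq> 0 \<longrightarrow> (\<forall>(s,x)\<in>set w. \<exists>i<n. x = D i))"


definition Q1 :: "nat \<Rightarrow> hh" where
  "Q1 n = fa_sum (\<lambda>i. fa_mul (hg False (E i)) (hg True (D i))) {..<n}"
definition Q2 :: "nat \<Rightarrow> hh" where
  "Q2 n = fa_sum (\<lambda>i. fa_mul (hg False (D i)) (hg True (E i))) {..<n}"
definition Q1Q2N :: "nat \<Rightarrow> hh" where
  "Q1Q2N n = fa_sum (\<lambda>(i,j). fa_mul (fa_mul (hg False (E i)) (hg False (D j)))
                                    (fa_mul (hg True (E j)) (hg True (D i)))) ({..<n} \<times> {..<n})"
definition Q1Q2R :: "nat \<Rightarrow> hh" where
  "Q1Q2R n = fa_sum (\<lambda>(i,j). fa_mul (fa_mul (hg False (D j)) (hg False (E i)))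
                                    (fa_mul (hg True (D i)) (hg True (E j)))) ({..<n} \<times> {..<n})"
definition Kterm :: "nat \<Rightarrow> (nat \<Rightarrow> nat \<Rightarrow> nat \<Rightarrow> complex) \<Rightarrow> hh" where
  "Kterm n c = fa_sum (\<lambda>(i,j). fa_smult (kappa n c i j) (fa_mul (hg False (D i)) (hg True (D j))))
                 ({..<n} \<times> {..<n})"

definition Finv2 :: "nat \<Rightarrow> (nat \<Rightarrow> nat \<Rightarrow> nat \<Rightarrow> complex) \<Rightarrow> complex \<Rightarrow> complex \<Rightarrow> hh" where
  "Finv2 n c \<alpha> \<beta> =
     fa_add (fa_add (fa_smult (\<alpha>^2 / 2) (fa_mul (fa_add (Q1 n) (Q2 n)) (Q1 n)))
                    (fa_smult (\<beta>^2 / 2) (fa_mul (fa_add (Q1 n) (Q2 n)) (Q2 n))))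
            (fa_smult (- 1 / 24)
               (fa_add (fa_add (Q1Q2N n) (fa_smult 2 (Q1Q2R n))) (fa_smult 2 (Kterm n c))))"

definition ps_mul :: "(nat \<Rightarrow> 'a fa) \<Rightarrow> (nat \<Rightarrow> 'a fa) \<Rightarrow> nat \<Rightarrow> 'a fa" where
  "ps_mul F G k = fa_sum (\<lambda>i. fa_mul (F i) (G (k - i))) {..k}"

definition ps_const :: "'a fa \<Rightarrow> nat \<Rightarrow> 'a fa" where
  "ps_const x k = (if k = 0 then x else fa_zero)"

section \<open>Action of H (x) H on S(g) (x) S(g) = S(g + g) (words over (side, index))\<close>

text \<open>Value of the derivation given by a generator on a single letter:
  e_i acts by ad_{e_i}, e^i by evaluation e^i(e_j) = delta_ij, on its own tensor factor.\<close>
fun der_letter :: "nat \<Rightarrow> (nat \<Rightarrow> nat \<Rightarrow> nat \<Rightarrow> complex) \<Rightarrow> bool \<times> gen \<Rightarrow> bool \<times> nat \<Rightarrow> (bool \<times> nat) fa" where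
  "der_letter n c (s, E i) (s', j) =
     (if s = s' then fa_sum (\<lambda>k. fa_smult (c i j k) (fa_gen (s, k))) {..<n} else fa_zero)"
| "der_letter n c (s, D i) (s', j) = (if s = s' \<and> i = j then fa_one else fa_zero)"

definition der_word :: "nat \<Rightarrow> (nat \<Rightarrow> nat \<Rightarrow> nat \<Rightarrow> complex) \<Rightarrow> bool \<times> gen \<Rightarrow> (bool \<times> nat) list \<Rightarrow> (bool \<times> nat) fa" where
  "der_word n c g w = fa_sum (\<lambda>p. fa_mul (fa_word (take p w))
       (fa_mul (der_letter n c g (w ! p)) (fa_word (drop (Suc p) w)))) {..<length w}"

definition der :: "nat \<Rightarrow> (nat \<Rightarrow> nat \<Rightarrow> nat \<Rightarrow> complex) \<Rightarrow> bool \<times> gen \<Rightarrow> (bool \<times> nat) fa \<Rightarrow> (bool \<times> nat) fa" where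
  "der n c g m = fa_lin (der_word n c g) m"

definition act :: "nat \<Rightarrow> (nat \<Rightarrow> nat \<Rightarrow> nat \<Rightarrow> complex) \<Rightarrow> hh \<Rightarrow> (bool \<times> nat) fa \<Rightarrow> (bool \<times> nat) fa" where
  "act n c X m = fa_lin (\<lambda>u. foldr (der n c) u m) X"

definition tens :: "nat fa \<Rightarrow> nat fa \<Rightarrow> (bool \<times> nat) fa" where
  "tens a b = fa_mul (fa_map (Pair False) a) (fa_map (Pair True) b)"

definition mu :: "(bool \<times> nat) fa \<Rightarrow> nat fa" where
  "mu m = fa_map snd m"

end

theory Submission
  imports Defs "HOL-Library.Poly_Mapping" "HOL-Library.Multiset" "HOL-Library.Product_Plus"
begin

text \<open>
  For (a), let \<open>e\<^sub>i\<close> act on \<open>S(g)[\<hbar>]/\<hbar>\<^sup>3\<close> by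
  \<open>L\<^sub>i = e\<^sub>i + \<hbar> A\<^sub>i + \<hbar>\<^sup>2 B\<^sub>i\<close> with \<open>A\<^sub>i = ad e\<^sub>i / 2\<close> and
  \<open>B\<^sub>i = (1/12) [[e\<^sub>i, e\<^sub>k], e\<^sub>l] \<partial>\<^sup>k \<partial>\<^sup>l\<close>. The Jacobi identity gives
  \<open>[L\<^sub>i, L\<^sub>j] = \<hbar> L\<^bsub>[i,j]\<^esub>\<close>, so \<open>U\<^sub>\<hbar>(g)\<close> acts, and \<open>L\<^sub>v\<^sup>m 1 = v\<^sup>m\<close>; hence
  \<open>u \<mapsto> u \<cdot> 1\<close> inverts symmetrisation modulo \<open>\<hbar>\<^sup>3\<close>, which replaces the
  Poincare-Birkhoff-Witt theorem. By polarization it remains to compare \<open>L\<^sub>v\<^sup>m b\<close> with the action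
  of \<open>F\<^sup>-\<^sup>1\<close> on \<open>v\<^sup>m \<otimes> b\<close>; here \<open>\<mu> \<circ> (Q\<^sub>1 + Q\<^sub>2) = 0\<close> removes the terms with
  \<open>\<alpha>\<^sup>2\<close> and \<open>\<beta>\<^sup>2\<close>, and the trace produced by reordering \<open>:Q\<^sub>1Q\<^sub>2:\<^sup>R\<close> cancels the \<open>\<kappa>\<close> term.

  For (b), write \<open>F\<^sup>-\<^sup>1 = 1 + \<hbar> G\<^sub>1 + \<hbar>\<^sup>2 G\<^sub>2\<close> and \<open>X = \<Delta> x\<close>. The first two coefficients of
  \<open>F X F\<^sup>-\<^sup>1\<close> beyond \<open>X\<close> are \<open>[X, G\<^sub>1]\<close> and \<open>[X, G\<^sub>2] - G\<^sub>1 [X, G\<^sub>1]\<close>. With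
  \<open>y = [X, Q\<^sub>1] = - [X, Q\<^sub>2]\<close> in \<open>S(g*) \<otimes> S(g*)\<close>, the second is, modulo that subalgebra, a
  combination of \<open>Q\<^sub>1 y\<close> and \<open>Q\<^sub>2 y\<close> whose coefficients vanish if \<open>(\<alpha> - \<beta>)\<^sup>2 = 1/4\<close>.
\<close>

section \<open>Complex vector spaces and algebras\<close>

text \<open>\<open>phi_inv\<close> is a choice, so part (a) needs a preimage to exist as well as its
  first three coefficients to be unique. Existence is elementary: interchanging two adjacent letters
  costs hbar times shorter words, so induction on length reaches every word. Uniqueness is where one
  would use a basis of the enveloping algebra; acting on the vector 1 replaces it, because only
  three coefficients are compared. The constants 1/2 and 1/12 are the coefficients of z and z^2 in
  z/(1 - exp(-z)), the series that describes left multiplication in symmetrised coordinates. Powers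
  of a single vector v are tractable because [v, v] = 0 collapses \<open>L_v^m b\<close> to a closed
  formula. All algebras are quotients of free algebras given by coefficient functions, and elements
  are known only through representatives. Hence comparisons pass through maps into polynomials
  (\<open>rho\<close>, \<open>toR\<close>, \<open>bd\<close>), and coefficient functions are first
  exchanged for finitely supported maps, which form a ring.\<close>

class cvec = ab_group_add +
  fixes scaleC :: "complex \<Rightarrow> 'a \<Rightarrow> 'a" (infixr \<open>*\<^sub>C\<close> 75)
  assumes scaleC_add_right: "a *\<^sub>C (x + y) = a *\<^sub>C x + a *\<^sub>C y"
    and scaleC_add_left: "(a + b) *\<^sub>C x = a *\<^sub>C x + b *\<^sub>C x"
    and scaleC_scaleC [simp]: "a *\<^sub>C b *\<^sub>C x = (a * b) *\<^sub>C x"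
    and scaleC_one [simp]: "1 *\<^sub>C x = x"

class calg = cvec + ring_1 +
  assumes mult_scaleC_left [simp]: "(a *\<^sub>C x) * y = a *\<^sub>C (x * y)"
    and mult_scaleC_right [simp]: "x * (a *\<^sub>C y) = a *\<^sub>C (x * y)"

section \<open>Complex-linear maps\<close>

definition clinear :: "('a::cvec \<Rightarrow> 'b::cvec) \<Rightarrow> bool" where
  "clinear f \<longleftrightarrow> (\<forall>x y. f (x + y) = f x + f y) \<and> (\<forall>a x. f (a *\<^sub>C x) = a *\<^sub>C f x)"

named_theorems clin

lemma clinearI:
  assumes "\<And>x y. f (x + y) = f x + f y" "\<And>a x. f (a *\<^sub>C x) = a *\<^sub>C f x"
  shows "clinear f"
  using assms by (simp add: clinear_def)

lemma clinear_add: "clinear f \<Longrightarrow> f (x + y) = f x + f y"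
  by (simp add: clinear_def)

lemma clinear_scale: "clinear f \<Longrightarrow> f (a *\<^sub>C x) = a *\<^sub>C f x"
  by (simp add: clinear_def)

lemma clinear_0: "clinear f \<Longrightarrow> f 0 = 0"
  using clinear_add [of f 0 0] by simp

lemma clinear_minus: "clinear f \<Longrightarrow> f (- x) = - f x"
  using clinear_add [of f x "- x"] by (simp add: clinear_0 eq_neg_iff_add_eq_0 add.commute)

lemma clinear_diff: "clinear f \<Longrightarrow> f (x - y) = f x - f y"
  using clinear_add [of f x "- y"] by (simp add: clinear_minus)

lemma clinear_sum: "clinear f \<Longrightarrow> f (sum g A) = (\<Sum>i\<in>A. f (g i))"
  by (induction A rule: infinite_finite_induct) (auto simp: clinear_0 clinear_add)

lemmas clinear_simps = clinear_add clinear_scale clinear_0 clinear_minus clinear_diff clinear_sum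

lemma clinear_ident [clin]: "clinear (\<lambda>x. x)"
  by (simp add: clinear_def)

lemma clinear_const_0 [clin]: "clinear (\<lambda>x. 0 :: 'a::cvec)"
  by (rule clinearI) (use scaleC_add_right [of _ 0 0] in auto)

lemma clinear_plus [clin]: "clinear f \<Longrightarrow> clinear g \<Longrightarrow> clinear (\<lambda>x. f x + g x)"
  by (simp add: clinear_def scaleC_add_right)

lemma clinear_scaleC [clin]: "clinear f \<Longrightarrow> clinear (\<lambda>x. a *\<^sub>C f x)"
  by (simp add: clinear_def scaleC_add_right mult.commute)

lemma scaleC_0_right [simp]: "a *\<^sub>C (0 :: 'a::cvec) = 0"
  using scaleC_add_right [of a 0 0] by simp

lemma scaleC_0_left [simp]: "0 *\<^sub>C (x :: 'a::cvec) = 0"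
  using scaleC_add_left [of 0 0 x] by simp

lemma scaleC_minus_right [simp]: "a *\<^sub>C (- x :: 'a::cvec) = - (a *\<^sub>C x)"
  using clinear_minus [OF clinear_scaleC [OF clinear_ident]] by metis

lemma scaleC_minus_left [simp]: "(- a) *\<^sub>C (x :: 'a::cvec) = - (a *\<^sub>C x)"
  using scaleC_add_left [of a "- a" x] by (simp add: eq_neg_iff_add_eq_0 add.commute)

lemma scaleC_diff_right: "a *\<^sub>C (x - y :: 'a::cvec) = a *\<^sub>C x - a *\<^sub>C y"
  using scaleC_add_right [of a x "- y"] by simp

lemma scaleC_diff_left: "(a - b) *\<^sub>C (x :: 'a::cvec) = a *\<^sub>C x - b *\<^sub>C x"
  using scaleC_add_left [of a "- b" x] by simp

lemma scaleC_sum_right: "a *\<^sub>C sum f A = (\<Sum>i\<in>A. a *\<^sub>C (f i :: 'a::cvec))"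
  by (induction A rule: infinite_finite_induct) (auto simp: scaleC_add_right)

lemma scaleC_sum_left: "sum f A *\<^sub>C (x :: 'a::cvec) = (\<Sum>i\<in>A. f i *\<^sub>C x)"
  by (induction A rule: infinite_finite_induct) (auto simp: scaleC_add_left)

lemma scaleC_of_nat: "of_nat m *\<^sub>C (x :: 'a::calg) = of_nat m * x"
  by (induction m) (auto simp: scaleC_add_left algebra_simps)

lemma scaleC_numeral: "numeral m *\<^sub>C (x :: 'a::calg) = numeral m * x"
  using scaleC_of_nat [of "numeral m" x] by simp

lemma clinear_sum_op [clin]: "(\<And>i. i \<in> A \<Longrightarrow> clinear (f i)) \<Longrightarrow> clinear (\<lambda>x. \<Sum>i\<in>A. f i x)"
  by (simp add: clinear_def scaleC_sum_right sum.distrib)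

lemma clinear_mult_left [clin]: "clinear f \<Longrightarrow> clinear (\<lambda>x. (y :: 'a::calg) * f x)"
  by (simp add: clinear_def distrib_left)

lemma clinear_mult_right [clin]: "clinear f \<Longrightarrow> clinear (\<lambda>x. f x * (y :: 'a::calg))"
  by (simp add: clinear_def distrib_right)

lemma clinear_compose: "clinear f \<Longrightarrow> clinear g \<Longrightarrow> clinear (\<lambda>x. f (g x))"
  by (simp add: clinear_def)

instantiation complex :: calg
begin
definition scaleC_complex :: "complex \<Rightarrow> complex \<Rightarrow> complex" where "scaleC_complex = (*)"
instance by standard (simp_all add: scaleC_complex_def algebra_simps)
end

instantiation prod :: (cvec, cvec) cvec
begin
definition "a *\<^sub>C (x :: 'a \<times> 'b) = (a *\<^sub>C fst x, a *\<^sub>C snd x)"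
instance
  by standard (auto simp: scaleC_prod_def scaleC_add_right scaleC_add_left)
end

instantiation poly_mapping :: (type, cvec) cvec
begin
definition scaleC_poly_mapping :: "complex \<Rightarrow> ('a \<Rightarrow>\<^sub>0 'b) \<Rightarrow> ('a \<Rightarrow>\<^sub>0 'b)" where
  "a *\<^sub>C p = Poly_Mapping.map ((*\<^sub>C) a) p"

lemma lookup_scaleC [simp]: "Poly_Mapping.lookup (a *\<^sub>C p) k = a *\<^sub>C Poly_Mapping.lookup p k"
  by (simp add: scaleC_poly_mapping_def map.rep_eq when_def)

instance
  by standard (auto intro!: poly_mapping_eqI simp: lookup_add scaleC_add_right scaleC_add_left)
end

lemma scaleC_single: "a *\<^sub>C Poly_Mapping.single k b = Poly_Mapping.single k (a *\<^sub>C b)"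
  by (rule poly_mapping_eqI) (simp add: lookup_single when_def)

text \<open>Scaling by \<open>a\<close> is left multiplication by the constant
  \<open>Poly_Mapping.single 0 (a *\<^sub>C 1)\<close>. The first law is then associativity; the
  second needs this constant to be central.\<close>

instance poly_mapping :: (monoid_add, calg) calg
proof
  fix a :: complex and x y :: "'a \<Rightarrow>\<^sub>0 'b"
  have sc: "a *\<^sub>C z = Poly_Mapping.single 0 (a *\<^sub>C 1) * z" for z :: "'a \<Rightarrow>\<^sub>0 'b"
    unfolding mult_map_scale_conv_mult [symmetric]
    by (rule poly_mapping_eqI) (simp add: map.rep_eq when_def)
  show "(a *\<^sub>C x) * y = a *\<^sub>C (x * y)"
    by (simp add: sc mult.assoc)
  have comm: "x * Poly_Mapping.single 0 (a *\<^sub>C 1) = Poly_Mapping.single 0 (a *\<^sub>C 1) * x"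
  proof (rule poly_mapping_eqI)
    fix k
    have inner: "(\<lambda>q. Poly_Mapping.lookup (Poly_Mapping.single 0 (a *\<^sub>C 1)) q when k = l + q) =
        (\<lambda>q. ((a *\<^sub>C 1 :: 'b) when k = l) when q = 0)" for l :: 'a
      by (auto simp: lookup_single when_def fun_eq_iff)
    have "Poly_Mapping.lookup (x * Poly_Mapping.single 0 (a *\<^sub>C 1)) k =
        Sum_any (\<lambda>l. Poly_Mapping.lookup x l * (a *\<^sub>C 1) when l = k)"
      unfolding lookup_mult inner Sum_any_when_equal by (simp add: mult_when eq_commute [of k])
    then show "Poly_Mapping.lookup (x * Poly_Mapping.single 0 (a *\<^sub>C 1)) k =
        Poly_Mapping.lookup (Poly_Mapping.single 0 (a *\<^sub>C 1) * x) k"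
      by (simp add: sc [symmetric])
  qed
  show "x * (a *\<^sub>C y) = a *\<^sub>C (x * y)"
    unfolding sc by (metis comm mult.assoc)
qed

section \<open>Linear extension from a basis\<close>

definition lin :: "('k \<Rightarrow> 'v::cvec) \<Rightarrow> ('k \<Rightarrow>\<^sub>0 complex) \<Rightarrow> 'v" where
  "lin f p = (\<Sum>k\<in>Poly_Mapping.keys p. Poly_Mapping.lookup p k *\<^sub>C f k)"

lemma lin_superset:
  assumes "finite K" "Poly_Mapping.keys p \<subseteq> K"
  shows "lin f p = (\<Sum>k\<in>K. Poly_Mapping.lookup p k *\<^sub>C f k)"
  unfolding lin_def by (rule sum.mono_neutral_left) (use assms in \<open>auto simp: in_keys_iff\<close>)

lemma clinear_lin [clin]: "clinear (lin f)"
proof (rule clinearI)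
  fix p q :: "'a \<Rightarrow>\<^sub>0 complex"
  let ?K = "Poly_Mapping.keys p \<union> Poly_Mapping.keys q"
  have "lin f (p + q) = (\<Sum>k\<in>?K. Poly_Mapping.lookup (p + q) k *\<^sub>C f k)"
    by (rule lin_superset) (use Poly_Mapping.keys_add [of p q] in auto)
  also have "\<dots> = lin f p + lin f q"
    by (simp add: lookup_add scaleC_add_left sum.distrib lin_superset [of ?K])
  finally show "lin f (p + q) = lin f p + lin f q" .
next
  fix a and p :: "'a \<Rightarrow>\<^sub>0 complex"
  have "lin f (a *\<^sub>C p) = (\<Sum>k\<in>Poly_Mapping.keys p. Poly_Mapping.lookup (a *\<^sub>C p) k *\<^sub>C f k)"
    by (rule lin_superset) (auto simp: in_keys_iff)
  then show "lin f (a *\<^sub>C p) = a *\<^sub>C lin f p"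
    by (simp add: lin_def scaleC_sum_right scaleC_complex_def)
qed

lemma lin_single [simp]: "lin f (Poly_Mapping.single k a) = a *\<^sub>C f k"
  by (simp add: lin_superset [of "{k}"])

lemma poly_mapping_expand: "p = lin (\<lambda>k. Poly_Mapping.single k 1) p"
proof (rule poly_mapping_eqI)
  fix k
  have "Poly_Mapping.lookup (lin (\<lambda>k. Poly_Mapping.single k 1) p) k =
      (\<Sum>j\<in>Poly_Mapping.keys p. if j = k then Poly_Mapping.lookup p k else 0)"
    unfolding lin_def lookup_sum
    by (rule sum.cong) (auto simp: scaleC_complex_def lookup_single when_def)
  then show "Poly_Mapping.lookup p k = Poly_Mapping.lookup (lin (\<lambda>k. Poly_Mapping.single k 1) p) k"
    by (simp add: in_keys_iff)
qed

lemma clinear_eq_lin: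
  fixes f :: "('k \<Rightarrow>\<^sub>0 complex) \<Rightarrow> 'v::cvec"
  shows "clinear f \<Longrightarrow> f p = lin (\<lambda>k. f (Poly_Mapping.single k 1)) p"
  by (subst poly_mapping_expand) (simp add: lin_def clinear_simps del: lin_single)

text \<open>Testing only the basis elements in the support of \<open>p\<close> lets a bound on the
  letters of \<open>p\<close> be used for each word tested.\<close>

lemma clinear_eqI:
  fixes f g :: "('k \<Rightarrow>\<^sub>0 complex) \<Rightarrow> 'v::cvec"
  assumes "clinear f" "clinear g" "\<And>k. k \<in> Poly_Mapping.keys p \<Longrightarrow> f (Poly_Mapping.single k 1) = g (Poly_Mapping.single k 1)"
  shows "f p = g p"
  using assms(3) clinear_eq_lin [OF assms(1), of p] clinear_eq_lin [OF assms(2), of p] by (simp add: lin_def)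

lemma clinear_lin_fun: 
  assumes "\<And>k. clinear (f k)"
  shows "clinear (\<lambda>x. lin (\<lambda>k. f k x) p)"
  unfolding lin_def by (intro clin assms)

section \<open>The free algebra as a monoid algebra\<close>

text \<open>With concatenation written additively, the convolution product of finitely supported
  maps on lists is the product of the free algebra.\<close>

instantiation list :: (type) monoid_add
begin
definition "0 = []"
definition "xs + ys = xs @ ys"
instance by standard (simp_all add: zero_list_def plus_list_def)
end

abbreviation word :: "'a list \<Rightarrow> ('a list \<Rightarrow>\<^sub>0 complex)" where
  "word w \<equiv> Poly_Mapping.single w 1"

lemma word_append: "word (u @ v) = word u * word v"
  by (simp add: mult_single plus_list_def)

lemma word_Cons: "word (x # v) = word [x] * word v"
  by (simp add: mult_single plus_list_def)

lemma word_Nil [simp]: "word [] = 1"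
  by (simp add: zero_list_def flip: single_one)

lemma fa_fin_lookup [simp]: "fa_fin (Poly_Mapping.lookup p)"
  by (simp add: fa_fin_def)

lemma fa_fin_obtain:
  assumes "fa_fin p" obtains q where "p = Poly_Mapping.lookup q"
  using assms that [of "Abs_poly_mapping p"] by (simp add: fa_fin_def)

lemma fa_zero_lookup: "fa_zero = Poly_Mapping.lookup 0"
  by (auto simp: fa_zero_def)

lemma fa_word_lookup: "fa_word w = Poly_Mapping.lookup (word w)"
  by (auto simp: fa_word_def lookup_single when_def)

lemma fa_one_lookup: "fa_one = Poly_Mapping.lookup 1"
  by (simp add: fa_one_def fa_word_lookup)

lemma fa_gen_lookup: "fa_gen x = Poly_Mapping.lookup (word [x])"
  by (simp add: fa_gen_def fa_word_lookup)

lemma fa_add_lookup: "fa_add (Poly_Mapping.lookup p) (Poly_Mapping.lookup q) = Poly_Mapping.lookup (p + q)"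
  by (auto simp: fa_add_def lookup_add)

lemma fa_diff_lookup: "fa_diff (Poly_Mapping.lookup p) (Poly_Mapping.lookup q) = Poly_Mapping.lookup (p - q)"
  by (auto simp: fa_diff_def lookup_minus)

lemma fa_smult_lookup: "fa_smult a (Poly_Mapping.lookup p) = Poly_Mapping.lookup (a *\<^sub>C p)"
  by (auto simp: fa_smult_def scaleC_complex_def)

lemma fa_sum_lookup: "fa_sum (\<lambda>i. Poly_Mapping.lookup (f i)) A = Poly_Mapping.lookup (sum f A)"
  by (auto simp: fa_sum_def lookup_sum)

text \<open>Both sides are bilinear, so words suffice; there the only cut of \<open>w\<close> that
  can contribute is the one after \<open>length u\<close> letters.\<close>

lemma fa_mul_lookup: "fa_mul (Poly_Mapping.lookup p) (Poly_Mapping.lookup q) = Poly_Mapping.lookup (p * q)"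
proof
  fix w
  let ?m = "\<lambda>(p :: 'a list \<Rightarrow>\<^sub>0 complex) (q :: 'a list \<Rightarrow>\<^sub>0 complex). \<Sum>i\<le>length w. Poly_Mapping.lookup p (take i w) * Poly_Mapping.lookup q (drop i w)"
  have "?m p q = Poly_Mapping.lookup (p * q) w"
  proof (rule clinear_eqI [where p = p])
    show "clinear (\<lambda>p. ?m p q)" "clinear (\<lambda>p. Poly_Mapping.lookup (p * q) w)"
      by (auto intro!: clinearI simp: lookup_add sum.distrib algebra_simps scaleC_complex_def sum_distrib_left)
    fix u
    show "?m (word u) q = Poly_Mapping.lookup (word u * q) w"
    proof (rule clinear_eqI [where p = q])
      show "clinear (?m (word u))" "clinear (\<lambda>q. Poly_Mapping.lookup (word u * q) w)"
        by (auto intro!: clinearI simp: lookup_add sum.distrib algebra_simps scaleC_complex_def sum_distrib_left)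
      fix v
      have "?m (word u) (word v) = (\<Sum>i\<le>length w. if i = length u \<and> w = u @ v then 1 else 0)"
      proof (rule sum.cong)
        fix i assume i: "i \<in> {..length w}"
        then have "u = take i w \<and> v = drop i w \<longleftrightarrow> i = length u \<and> w = u @ v"
          by auto
        then show "Poly_Mapping.lookup (word u) (take i w) * Poly_Mapping.lookup (word v) (drop i w) =
            (if i = length u \<and> w = u @ v then 1 else 0)"
          using i by (auto simp: lookup_single when_def)
      qed simp
      also have "\<dots> = (if w = u @ v then 1 else 0)"
        by (cases "w = u @ v") auto
      finally show "?m (word u) (word v) = Poly_Mapping.lookup (word u * word v) w"
        by (simp add: word_append [symmetric] lookup_single when_def eq_commute)
    qed
  qed
  then show "fa_mul (Poly_Mapping.lookup p) (Poly_Mapping.lookup q) w = Poly_Mapping.lookup (p * q) w"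
    by (simp add: fa_mul_def)
qed

lemma fa_lin_lookup: "fa_lin (\<lambda>v. Poly_Mapping.lookup (f v)) (Poly_Mapping.lookup p) = Poly_Mapping.lookup (lin f p)"
  by (auto simp: fa_lin_def lin_def lookup_sum scaleC_complex_def keys.rep_eq)

lemma fa_comm_lookup: "fa_comm (Poly_Mapping.lookup p) (Poly_Mapping.lookup q) = Poly_Mapping.lookup (p * q - q * p)"
  by (simp add: fa_comm_def fa_mul_lookup fa_diff_lookup)

text \<open>Used as rewrite rules, these move \<open>lookup\<close> outwards, so that a formula for
  coefficient functions becomes one in a ring.\<close>

lemmas fa_lookup = fa_zero_lookup fa_word_lookup fa_one_lookup fa_gen_lookup fa_add_lookup
  fa_diff_lookup fa_smult_lookup fa_sum_lookup fa_mul_lookup fa_lin_lookup fa_comm_lookup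

section \<open>Two-sided ideals of the free algebra\<close>

definition fideal :: "'a fa set \<Rightarrow> ('a list \<Rightarrow>\<^sub>0 complex) set" where
  "fideal R = {p. Poly_Mapping.lookup p \<in> fa_ideal R}"

lemma fa_cong_lookup: "fa_cong R (Poly_Mapping.lookup p) (Poly_Mapping.lookup q) \<longleftrightarrow> p - q \<in> fideal R"
  by (simp add: fa_cong_def fideal_def fa_diff_lookup)

lemma fideal_base: "Poly_Mapping.lookup r \<in> R \<Longrightarrow> r \<in> fideal R"
  by (simp add: fideal_def fa_ideal.base)

lemma fideal_0 [simp]: "0 \<in> fideal R"
  using fa_ideal.zero [of R] by (simp add: fideal_def fa_zero_lookup)

lemma fideal_add: "p \<in> fideal R \<Longrightarrow> q \<in> fideal R \<Longrightarrow> p + q \<in> fideal R"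
  using fa_ideal.add [of "Poly_Mapping.lookup p" R "Poly_Mapping.lookup q"] by (simp add: fideal_def fa_add_lookup)

lemma fideal_mult: "p \<in> fideal R \<Longrightarrow> x * p * y \<in> fideal R"
  using fa_ideal.mult [of "Poly_Mapping.lookup p" R "Poly_Mapping.lookup x" "Poly_Mapping.lookup y"]
  by (simp add: fideal_def fa_mul_lookup mult.assoc)

lemma fideal_mult_left: "p \<in> fideal R \<Longrightarrow> x * p \<in> fideal R"
  using fideal_mult [of p R x 1] by simp

lemma fideal_mult_right: "p \<in> fideal R \<Longrightarrow> p * x \<in> fideal R"
  using fideal_mult [of p R 1 x] by simp

lemma fideal_scale: "p \<in> fideal R \<Longrightarrow> a *\<^sub>C p \<in> fideal R"
  using fideal_mult_left [of p R "a *\<^sub>C 1"] by simp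

lemma fideal_uminus: "p \<in> fideal R \<Longrightarrow> - p \<in> fideal R"
  using fideal_mult_left [of p R "- 1"] by simp

lemma fideal_diff: "p \<in> fideal R \<Longrightarrow> q \<in> fideal R \<Longrightarrow> p - q \<in> fideal R"
  using fideal_add [of p R "- q"] fideal_uminus [of q R] by simp

lemma fideal_sum: "(\<And>i. i \<in> A \<Longrightarrow> f i \<in> fideal R) \<Longrightarrow> sum f A \<in> fideal R"
  by (induction A rule: infinite_finite_induct) (auto intro: fideal_add)

lemmas fideal_closed = fideal_add fideal_diff fideal_mult_left fideal_mult_right fideal_scale fideal_uminus fideal_sum

text \<open>\<open>fa_ideal\<close> is generated among coefficient functions; finiteness of the
  relations keeps every stage of its induction in the image of \<open>lookup\<close>.\<close>

lemma fideal_induct [consumes 1, case_names fin base zero add mult]: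
  assumes "p \<in> fideal R"
    and fin: "\<And>r. r \<in> R \<Longrightarrow> fa_fin r"
    and base: "\<And>r. Poly_Mapping.lookup r \<in> R \<Longrightarrow> P r"
    and zero: "P 0"
    and add: "\<And>p q. P p \<Longrightarrow> P q \<Longrightarrow> P (p + q)"
    and mult: "\<And>p x y. P p \<Longrightarrow> P (x * (p * y))"
  shows "P p"
proof -
  have "\<exists>q. p = Poly_Mapping.lookup q \<and> P q" if "p \<in> fa_ideal R" for p
    using that
  proof induction
    case (base r)
    then show ?case using fin [of r] assms(3) by (metis fa_fin_obtain)
  next
    case zero
    show ?case using assms(4) fa_zero_lookup by blast
  next
    case (add p q)
    then show ?case using assms(5) by (metis fa_add_lookup)
  next
    case (mult p x y)
    then obtain p' x' y' where "p = Poly_Mapping.lookup p'" "P p'" "x = Poly_Mapping.lookup x'" "y = Poly_Mapping.lookup y'"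
      by (metis fa_fin_obtain)
    then show ?case using assms(6) [of p' x' y'] by (auto simp: fa_mul_lookup)
  qed
  then show ?thesis
    using assms(1) by (metis fideal_def mem_Collect_eq poly_mapping_eq_iff)
qed

text \<open>Adjacent swaps generate all rearrangements: \<open>move\<close> carries the wanted
  letter to the front, and induction treats the rest. The prefix \<open>ps\<close> is carried along
  because \<open>r\<close> is not assumed compatible with prepending letters. The result serves both
  U_hbar(g) and S(g).\<close>

lemma perm_closed_under_swaps:
  assumes refl: "\<And>xs. r xs xs" and sym: "\<And>xs ys. r xs ys \<Longrightarrow> r ys xs"
    and trans: "\<And>xs ys zs. r xs ys \<Longrightarrow> r ys zs \<Longrightarrow> r xs zs"
    and swap: "\<And>us i j vs. set (us @ i # j # vs) \<subseteq> A \<Longrightarrow> r (us @ i # j # vs) (us @ j # i # vs)"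
    and "mset xs = mset ys" "set xs \<subseteq> A"
  shows "r xs ys"
proof -
  have move: "r (ps @ us @ a # vs) (ps @ a # us @ vs)" if "set (ps @ us @ a # vs) \<subseteq> A" for ps us vs a
    using that
  proof (induction us arbitrary: ps)
    case Nil
    then show ?case by (simp add: refl)
  next
    case (Cons b us)
    have r1: "r ((ps @ [b]) @ us @ a # vs) ((ps @ [b]) @ a # us @ vs)"
      using Cons.prems by (intro Cons.IH) auto
    have "r (ps @ b # a # (us @ vs)) (ps @ a # b # (us @ vs))"
      using Cons.prems by (intro swap) auto
    then have r2: "r ((ps @ [b]) @ a # us @ vs) (ps @ a # (b # us) @ vs)"
      by simp
    show ?case using trans [OF r1 r2] by simp
  qed
  have "r (ps @ xs) (ps @ ys)" if "mset xs = mset ys" "set (ps @ xs) \<subseteq> A" for ps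
    using that
  proof (induction xs arbitrary: ps ys)
    case Nil
    then show ?case by (simp add: refl)
  next
    case (Cons a xs)
    have "a \<in> set ys"
      using Cons.prems(1) by (metis list.set_intros(1) set_mset_mset)
    then obtain us vs where ys: "ys = us @ a # vs"
      by (meson split_list)
    have "mset xs = mset (us @ vs)"
      using Cons.prems(1) by (simp add: ys)
    then have r1: "r ((ps @ [a]) @ xs) ((ps @ [a]) @ us @ vs)"
      using Cons.prems(2) by (intro Cons.IH) auto
    have "set (a # xs) = set ys"
      using Cons.prems(1) by (metis set_mset_mset)
    then have "r (ps @ us @ a # vs) (ps @ a # us @ vs)"
      using Cons.prems(2) ys by (intro move) auto
    then have r2: "r ((ps @ [a]) @ us @ vs) (ps @ ys)"
      by (simp add: ys sym)
    show ?case using trans [OF r1 r2] by simp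
  qed
  from this [of "[]"] assms(5,6) show ?thesis by auto
qed

section \<open>Derivations of the symmetric algebra\<close>

type_synonym cpoly = "nat multiset \<Rightarrow>\<^sub>0 complex"

definition X :: "nat \<Rightarrow> cpoly" where
  "X i = Poly_Mapping.single {#i#} 1"

text \<open>If \<open>i\<close> does not occur in \<open>M\<close>, the subtraction leaves
  \<open>M\<close> as it is, but then the coefficient \<open>count M i\<close> is 0.\<close>

definition pd :: "nat \<Rightarrow> cpoly \<Rightarrow> cpoly" where
  "pd i = lin (\<lambda>M. Poly_Mapping.single (M - {#i#}) (of_nat (count M i)))"

lemma clinear_pd [clin]: "clinear (pd i)"
  unfolding pd_def by (rule clinear_lin)

lemma pd_single: "pd i (Poly_Mapping.single M 1) = Poly_Mapping.single (M - {#i#}) (of_nat (count M i))"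
  by (simp add: pd_def)

lemma pd_X: "pd i (X j) = (if i = j then 1 else 0)"
  by (simp add: X_def pd_single)

lemma pd_1 [simp]: "pd i 1 = 0"
  using pd_single [of i "{#}"] by simp

lemma pd_mult: "pd i (p * q) = pd i p * q + p * pd i q"
proof (rule clinear_eqI [where p = p])
  show "clinear (\<lambda>p. pd i (p * q))" "clinear (\<lambda>p. pd i p * q + p * pd i q)"
    by (intro clin clinear_compose [OF clinear_pd])+
  fix M
  show "pd i (Poly_Mapping.single M 1 * q) = pd i (Poly_Mapping.single M 1) * q + Poly_Mapping.single M 1 * pd i q"
  proof (rule clinear_eqI [where p = q])
    show "clinear (\<lambda>q. pd i (Poly_Mapping.single M 1 * q))"
      "clinear (\<lambda>q. pd i (Poly_Mapping.single M 1) * q + Poly_Mapping.single M 1 * pd i q)"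
      by (intro clin clinear_compose [OF clinear_pd])+
    fix N
    \<comment> \<open>Multiset subtraction moves into the factor \<open>M\<close> only when
      \<open>i\<close> occurs there; otherwise both coefficients are 0.\<close>
    have 1: "Poly_Mapping.single (M + N - {#i#}) (of_nat (count M i) :: complex) =
        Poly_Mapping.single (M - {#i#} + N) (of_nat (count M i))"
      by (cases "i \<in># M") (auto simp: not_in_iff)
    have 2: "Poly_Mapping.single (M + N - {#i#}) (of_nat (count N i) :: complex) =
        Poly_Mapping.single (M + (N - {#i#})) (of_nat (count N i))"
      by (cases "i \<in># N") (auto simp: not_in_iff)
    show "pd i (Poly_Mapping.single M 1 * Poly_Mapping.single N 1) =
        pd i (Poly_Mapping.single M 1) * Poly_Mapping.single N 1 + Poly_Mapping.single M 1 * pd i (Poly_Mapping.single N 1)"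
      by (simp add: mult_single pd_single single_add 1 2 del: union_mset_add_mset_right union_mset_add_mset_left)
  qed
qed

lemma pd_commute: "pd i (pd j p) = pd j (pd i p)"
proof (rule clinear_eqI [where p = p])
  show "clinear (\<lambda>p. pd i (pd j p))" "clinear (\<lambda>p. pd j (pd i p))"
    by (intro clinear_compose [OF clinear_pd] clinear_pd)+
  fix M
  have pds: "pd i (Poly_Mapping.single M a) = Poly_Mapping.single (M - {#i#}) (a * of_nat (count M i))" for i M a
    by (simp add: pd_def scaleC_single scaleC_complex_def)
  show "pd i (pd j (Poly_Mapping.single M 1)) = pd j (pd i (Poly_Mapping.single M 1))"
    by (cases "i = j") (simp_all add: pds diff_diff_add add.commute mult.commute)
qed

text \<open>The Leibniz rule forces \<open>d 1 = 0\<close>, which starts the induction; at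
  \<open>m = 0\<close> the truncated exponent is harmless because of the factor
  \<open>of_nat m\<close>.\<close>

lemma derivation_power:
  fixes v :: "'a::comm_ring_1"
  assumes leib: "\<And>f g. d (f * g) = d f * g + f * d g"
  shows "d (v ^ m) = of_nat m * v ^ (m - 1) * d v"
proof (induction m)
  case 0
  have "d 1 = 0" using leib [of 1 1] by simp
  then show ?case by simp
next
  case (Suc m)
  have "of_nat m * v ^ (m - 1) * d v * v = of_nat m * v ^ m * d v"
    by (cases m) (simp_all add: algebra_simps)
  with Suc show ?case
    by (simp add: leib algebra_simps)
qed

section \<open>The adjoint action on S(g) by derivations\<close>

locale lie =
  fixes n :: nat and c :: "nat \<Rightarrow> nat \<Rightarrow> nat \<Rightarrow> complex"
  assumes lie: "lie_sc n c"
begin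

lemma c_antisym: "i < n \<Longrightarrow> j < n \<Longrightarrow> k < n \<Longrightarrow> c i j k = - c j i k"
  using lie unfolding lie_sc_def by blast

lemma c_jacobi: "i < n \<Longrightarrow> j < n \<Longrightarrow> k < n \<Longrightarrow> m < n \<Longrightarrow>
    (\<Sum>l<n. c i j l * c l k m + c j k l * c l i m + c k i l * c l j m) = 0"
  using lie unfolding lie_sc_def by blast

definition br :: "nat \<Rightarrow> nat \<Rightarrow> cpoly" where
  "br i j = (\<Sum>k<n. c i j k *\<^sub>C X k)"

definition ad :: "nat \<Rightarrow> cpoly \<Rightarrow> cpoly" where
  "ad i f = (\<Sum>j<n. br i j * pd j f)"

lemma clinear_ad [clin]: "clinear (ad i)"
  unfolding ad_def by (intro clin)

lemma ad_mult: "ad i (f * g) = ad i f * g + f * ad i g"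
  by (simp add: ad_def pd_mult algebra_simps sum.distrib sum_distrib_left sum_distrib_right)

lemma ad_X: "j < n \<Longrightarrow> ad i (X j) = br i j"
  by (simp add: ad_def pd_X if_distrib [of "\<lambda>x. _ * x"] cong: if_cong)

lemma pd_br: "l < n \<Longrightarrow> pd l (br i j) = c i j l *\<^sub>C 1"
  by (simp add: br_def clinear_simps [OF clinear_pd] pd_X if_distrib [of "\<lambda>x. _ *\<^sub>C x"] cong: if_cong)

lemma br_antisym: "i < n \<Longrightarrow> j < n \<Longrightarrow> br i j = - br j i"
  by (simp add: br_def sum_negf [symmetric] c_antisym [of i j])

lemma ad_br: "ad i (br j k) = (\<Sum>l<n. c j k l *\<^sub>C br i l)"
  unfolding br_def [of j k] by (simp add: clinear_simps [OF clinear_ad] ad_X)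

text \<open>\<open>lie_sc\<close> nests brackets on the left, \<open>ad\<close> on the right; one
  use of antisymmetry per term turns one form into the negative of the other.\<close>

lemma br_jacobi:
  assumes "i < n" "j < n" "k < n"
  shows "ad i (br j k) + ad j (br k i) + ad k (br i j) = 0"
proof -
  have *: "ad i (br j k) = (\<Sum>m<n. (\<Sum>l<n. - (c j k l * c l i m)) *\<^sub>C X m)" if "i < n" for i j k
  proof -
    have "ad i (br j k) = (\<Sum>l<n. \<Sum>m<n. (c j k l * c i l m) *\<^sub>C X m)"
      by (simp add: ad_br br_def [of i] scaleC_sum_right)
    also have "\<dots> = (\<Sum>m<n. \<Sum>l<n. (c j k l * c i l m) *\<^sub>C X m)"
      by (rule sum.swap)
    also have "\<dots> = (\<Sum>m<n. (\<Sum>l<n. - (c j k l * c l i m)) *\<^sub>C X m)"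
      unfolding scaleC_sum_left by (intro sum.cong refl) (use that in \<open>simp add: c_antisym [of i]\<close>)
    finally show ?thesis .
  qed
  have "(\<Sum>l<n. - (c j k l * c l i m)) + (\<Sum>l<n. - (c k i l * c l j m)) + (\<Sum>l<n. - (c i j l * c l k m)) = 0" if "m < n" for m
    using c_jacobi [OF assms that] by (simp add: sum.distrib sum_negf) algebra
  then show ?thesis
    unfolding * [OF assms(1)] * [OF assms(2)] * [OF assms(3)]
    by (simp flip: sum.distrib scaleC_add_left)
qed

text \<open>The relation for [e_i, e^j] in H, realised on polynomials. In part (a) it is also the
  source of the trace that \<open>kappa\<close> cancels.\<close>

lemma pd_ad:
  assumes "j < n"
  shows "pd j (ad i f) = ad i (pd j f) + (\<Sum>k<n. c i k j *\<^sub>C pd k f)"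
  using assms by (simp add: ad_def clinear_simps [OF clinear_pd] pd_mult pd_br sum.distrib pd_commute [of j] add.commute)

text \<open>The second derivatives of \<open>f\<close> enter symmetrically in \<open>i\<close> and
  \<open>j\<close> and cancel; what remains in the first derivatives is the Jacobi identity.\<close>

lemma ad_commutator:
  assumes "i < n" "j < n"
  shows "ad i (ad j f) - ad j (ad i f) = (\<Sum>l<n. c i j l *\<^sub>C ad l f)"
proof -
  have exp: "ad i (ad j f) = (\<Sum>k<n. ad i (br j k) * pd k f) + (\<Sum>k<n. \<Sum>l<n. br j k * br i l * pd l (pd k f))" for i j
    by (simp add: ad_def [of j f] clinear_simps [OF clinear_ad] ad_mult sum.distrib)
      (simp add: ad_def [of i] sum_distrib_left mult.assoc)
  have "(\<Sum>k<n. \<Sum>l<n. br j k * br i l * pd l (pd k f)) = (\<Sum>k<n. \<Sum>l<n. br i k * br j l * pd l (pd k f))"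
    by (subst sum.swap) (simp add: pd_commute mult.commute [of "br j _"])
  then have "ad i (ad j f) - ad j (ad i f) = (\<Sum>k<n. (ad i (br j k) - ad j (br i k)) * pd k f)"
    by (simp add: exp sum_subtractf left_diff_distrib)
  also have "\<dots> = (\<Sum>k<n. (\<Sum>l<n. c i j l *\<^sub>C br l k) * pd k f)"
  proof (rule sum.cong)
    fix k assume "k \<in> {..<n}"
    then have k: "k < n" by simp
    have swap: "ad j (br k i) = - ad j (br i k)"
      using br_antisym [OF k assms(1)] by (simp add: clinear_simps [OF clinear_ad])
    have "ad i (br j k) - ad j (br i k) = - ad k (br i j)"
      unfolding eq_neg_iff_add_eq_0 using br_jacobi [OF assms k] unfolding swap by simp
    also have "\<dots> = (\<Sum>l<n. c i j l *\<^sub>C br l k)"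
      unfolding ad_br sum_negf [symmetric]
      by (intro sum.cong refl) (use k in \<open>simp add: br_antisym [of k]\<close>)
    finally show "(ad i (br j k) - ad j (br i k)) * pd k f = (\<Sum>l<n. c i j l *\<^sub>C br l k) * pd k f"
      by simp
  qed simp
  also have "\<dots> = (\<Sum>k<n. \<Sum>l<n. c i j l *\<^sub>C (br l k * pd k f))"
    by (simp add: sum_distrib_right)
  also have "\<dots> = (\<Sum>l<n. c i j l *\<^sub>C ad l f)"
    unfolding ad_def scaleC_sum_right by (rule sum.swap)
  finally show ?thesis .
qed

text \<open>Once \<open>ad\<close> is expanded, the two double sums differ by exchanging the indices
  of the antisymmetric \<open>br\<close>. This is \<mu> \<circ> (Q1 + Q2) = 0.\<close>

lemma ad_pd_cancel: "(\<Sum>i<n. ad i f * pd i g) + (\<Sum>i<n. pd i f * ad i g) = 0"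
proof -
  have "(\<Sum>i<n. ad i f * pd i g) = (\<Sum>i<n. \<Sum>j<n. br i j * pd j f * pd i g)"
    by (simp add: ad_def sum_distrib_right)
  also have "\<dots> = (\<Sum>j<n. \<Sum>i<n. br i j * pd j f * pd i g)"
    by (rule sum.swap)
  also have "\<dots> = (\<Sum>j<n. \<Sum>i<n. - (pd j f * (br j i * pd i g)))"
  proof (intro sum.cong refl)
    fix i j assume "i \<in> {..<n}" "j \<in> {..<n}"
    then have "br i j = - br j i" by (intro br_antisym) auto
    then show "br i j * pd j f * pd i g = - (pd j f * (br j i * pd i g))"
      by (simp add: mult_ac)
  qed
  also have "\<dots> = - (\<Sum>i<n. pd i f * ad i g)"
    by (simp add: ad_def sum_distrib_left sum_negf)
  finally show ?thesis by simp
qed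

definition Aop :: "nat \<Rightarrow> cpoly \<Rightarrow> cpoly" where
  "Aop i f = (1/2) *\<^sub>C ad i f"

text \<open>The sign is negative because \<open>ad l (br i k)\<close> is [e_l, [e_i, e_k]], the
  negative of [[e_i, e_k], e_l].\<close>

definition Bop :: "nat \<Rightarrow> cpoly \<Rightarrow> cpoly" where
  "Bop i f = (- 1/12) *\<^sub>C (\<Sum>k<n. \<Sum>l<n. ad l (br i k) * pd k (pd l f))"

lemma clinear_Aop [clin]: "clinear (Aop i)"
  unfolding Aop_def by (intro clin)

lemma clinear_Bop [clin]: "clinear (Bop i)"
  unfolding Bop_def by (intro clin clinear_compose [OF clinear_pd])


section \<open>The Gutt star product up to second order\<close>

text \<open>Triples \<open>(f0, f1, f2)\<close> stand for \<open>f0 + \<hbar> f1 + \<hbar>\<^sup>2 f2\<close> modulo \<open>\<hbar>\<^sup>3\<close>.\<close>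

definition hbar_op :: "cpoly \<times> cpoly \<times> cpoly \<Rightarrow> cpoly \<times> cpoly \<times> cpoly" where
  "hbar_op = (\<lambda>(f0, f1, f2). (0, f0, f1))"

definition Lop :: "nat \<Rightarrow> cpoly \<times> cpoly \<times> cpoly \<Rightarrow> cpoly \<times> cpoly \<times> cpoly" where
  "Lop i = (\<lambda>(f0, f1, f2). (X i * f0, X i * f1 + Aop i f0, X i * f2 + Aop i f1 + Bop i f0))"

lemma clinear_hbar_op [clin]: "clinear hbar_op"
  by (rule clinearI) (auto simp: hbar_op_def scaleC_prod_def)

lemma clinear_Lop [clin]: "clinear (Lop i)"
  by (rule clinearI)
    (auto simp: Lop_def scaleC_prod_def clinear_simps [OF clinear_Aop] clinear_simps [OF clinear_Bop]
      algebra_simps scaleC_add_right)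

lemma Lop_hbar_op: "Lop i (hbar_op f) = hbar_op (Lop i f)"
  by (cases f) (simp add: Lop_def hbar_op_def clinear_0 [OF clinear_Aop] clinear_0 [OF clinear_Bop])

lemma Aop_X_mult: "j < n \<Longrightarrow> Aop i (X j * f) = X j * Aop i f + (1/2) *\<^sub>C (br i j * f)"
  by (simp add: Aop_def ad_mult ad_X scaleC_add_right add.commute)

text \<open>A second-order operator has two cross terms with the linear factor \<open>X j\<close>,
  one for each derivative that falls on it.\<close>

lemma Bop_X_mult:
  assumes "j < n"
  shows "Bop i (X j * f) = X j * Bop i f - (1/12) *\<^sub>C ((\<Sum>k<n. ad j (br i k) * pd k f) + (\<Sum>k<n. ad k (br i j) * pd k f))"
proof -
  have "ad l (br i k) * pd k (pd l (X j * f)) = X j * (ad l (br i k) * pd k (pd l f)) +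
     (if k = j then ad l (br i k) * pd l f else 0) + (if l = j then ad l (br i k) * pd k f else 0)" for k l
    by (auto simp: pd_mult pd_X clinear_simps [OF clinear_pd] algebra_simps)
  then have "(\<Sum>k<n. \<Sum>l<n. ad l (br i k) * pd k (pd l (X j * f))) =
     X j * (\<Sum>k<n. \<Sum>l<n. ad l (br i k) * pd k (pd l f)) +
     (\<Sum>k<n. \<Sum>l<n. if k = j then ad l (br i k) * pd l f else 0) +
     (\<Sum>k<n. \<Sum>l<n. if l = j then ad l (br i k) * pd k f else 0)"
    by (simp add: sum.distrib sum_distrib_left)
  also have "(\<Sum>k<n. \<Sum>l<n. if k = j then ad l (br i k) * pd l f else 0) = (\<Sum>k<n. ad k (br i j) * pd k f)"
    by (subst sum.swap) (simp add: assms)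
  also have "(\<Sum>k<n. \<Sum>l<n. if l = j then ad l (br i k) * pd k f else 0) = (\<Sum>k<n. ad j (br i k) * pd k f)"
    by (simp add: assms)
  finally show ?thesis
    by (simp add: Bop_def scaleC_add_right algebra_simps)
qed

text \<open>The bracket relation of U_hbar(g) is checked coefficientwise: order 0 is commutativity
  of S(g), order 1 is \<open>c1\<close> on \<open>f0\<close>, and order 2 combines \<open>c1\<close>
  on \<open>f1\<close> with \<open>c2\<close> on \<open>f0\<close>.\<close>

lemma Lop_commutator:
  assumes "i < n" "j < n"
  shows "Lop i (Lop j f) - Lop j (Lop i f) = hbar_op (\<Sum>k<n. c i j k *\<^sub>C Lop k f)"
proof -
  obtain f0 f1 f2 where f: "f = (f0, f1, f2)" by (cases f) auto
  have fst_sum: "fst (sum g A) = (\<Sum>k\<in>A. fst (g k))" and snd_sum: "snd (sum g A) = (\<Sum>k\<in>A. snd (g k))"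
    for g :: "nat \<Rightarrow> cpoly \<times> cpoly \<times> cpoly" and A
    by (induction A rule: infinite_finite_induct) auto
  have fst_sum2: "fst (sum g A) = (\<Sum>k\<in>A. fst (g k))" for g :: "nat \<Rightarrow> cpoly \<times> cpoly" and A
    by (induction A rule: infinite_finite_induct) auto
  have br: "br j i = - br i j" using assms(2,1) by (rule br_antisym)
  have c1: "X i * Aop j g + Aop i (X j * g) - (X j * Aop i g + Aop j (X i * g)) = br i j * g" for g
  proof -
    have "(1/2) *\<^sub>C (br i j * g) + (1/2) *\<^sub>C (br i j * g) = br i j * g"
      by (simp flip: scaleC_add_left)
    then show ?thesis
      unfolding Aop_X_mult [OF assms(1)] Aop_X_mult [OF assms(2)] br by (simp add: algebra_simps)
  qed
  have c2: "X i * Bop j g + Aop i (Aop j g) + Bop i (X j * g) - (X j * Bop i g + Aop j (Aop i g) + Bop j (X i * g)) =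
     (\<Sum>k<n. c i j k *\<^sub>C Aop k g)" for g
  proof -
    define S where "S = (\<Sum>k<n. c i j k *\<^sub>C ad k g)"
    have S': "S = - (\<Sum>k<n. ad k (br i j) * pd k g)"
    proof -
      have "(\<Sum>k<n. ad k (br i j) * pd k g) = (\<Sum>k<n. \<Sum>l<n. c i j l *\<^sub>C (br k l * pd k g))"
        by (simp add: ad_br sum_distrib_right)
      also have "\<dots> = (\<Sum>k<n. \<Sum>l<n. - (c i j l *\<^sub>C (br l k * pd k g)))"
      proof (intro sum.cong refl)
        fix k l assume "k \<in> {..<n}" "l \<in> {..<n}"
        then have "br k l = - br l k" by (intro br_antisym) auto
        then show "c i j l *\<^sub>C (br k l * pd k g) = - (c i j l *\<^sub>C (br l k * pd k g))" by simp
      qed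
      also have "\<dots> = - (\<Sum>l<n. \<Sum>k<n. c i j l *\<^sub>C (br l k * pd k g))"
        by (subst sum.swap) (simp add: sum_negf)
      finally show ?thesis by (simp add: S_def ad_def scaleC_sum_right)
    qed
    have jac: "(\<Sum>k<n. ad j (br i k) * pd k g) - (\<Sum>k<n. ad i (br j k) * pd k g) = (\<Sum>k<n. ad k (br i j) * pd k g)"
      unfolding sum_subtractf [symmetric]
    proof (intro sum.cong refl)
      fix k assume "k \<in> {..<n}"
      then have k: "k < n" by simp
      have swap: "ad j (br k i) = - ad j (br i k)"
        using br_antisym [OF k assms(1)] by (simp add: clinear_simps [OF clinear_ad])
      have "ad k (br i j) = ad j (br i k) - ad i (br j k)"
        using br_jacobi [OF assms k] unfolding swap by (simp add: algebra_simps)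
      then show "ad j (br i k) * pd k g - ad i (br j k) * pd k g = ad k (br i j) * pd k g"
        by (simp only: left_diff_distrib)
    qed
    \<comment> \<open>[A_i, A_j] supplies half of the required (1/2) \<open>S\<close>, which leaves
      1/4 for the cross terms of X and B.\<close>
    have a4: "Aop i (Aop j g) - Aop j (Aop i g) = (1/4) *\<^sub>C S"
      using ad_commutator [OF assms, of g]
      by (simp add: Aop_def clinear_simps [OF clinear_ad] S_def flip: scaleC_diff_right)
    \<comment> \<open>The Jacobi identity gives one copy of -\<open>S\<close> and antisymmetry of
      \<open>br\<close> two more; 3/12 = 1/4 is what fixes the constant in
      \<open>Bop\<close>.\<close>
    have b4: "Bop i (X j * g) - X j * Bop i g - (Bop j (X i * g) - X i * Bop j g) = (1/4) *\<^sub>C S"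
    proof -
      have neg: "(\<Sum>k<n. ad k (br j i) * pd k g) = - (\<Sum>k<n. ad k (br i j) * pd k g)"
        by (simp add: br clinear_simps [OF clinear_ad] sum_negf)
      have "Bop i (X j * g) - X j * Bop i g - (Bop j (X i * g) - X i * Bop j g) =
         - (1/12) *\<^sub>C (((\<Sum>k<n. ad j (br i k) * pd k g) - (\<Sum>k<n. ad i (br j k) * pd k g)) +
           ((\<Sum>k<n. ad k (br i j) * pd k g) - (\<Sum>k<n. ad k (br j i) * pd k g)))"
        unfolding Bop_X_mult [OF assms(1)] Bop_X_mult [OF assms(2)]
        by (simp add: scaleC_add_right scaleC_diff_right)
      also have "\<dots> = (1/12) *\<^sub>C (3 *\<^sub>C S)"
        unfolding jac neg S' by (simp add: scaleC_numeral algebra_simps)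
      finally show ?thesis by simp
    qed
    have "X i * Bop j g + Aop i (Aop j g) + Bop i (X j * g) - (X j * Bop i g + Aop j (Aop i g) + Bop j (X i * g)) =
      (Aop i (Aop j g) - Aop j (Aop i g)) + (Bop i (X j * g) - X j * Bop i g - (Bop j (X i * g) - X i * Bop j g))"
      by (simp add: algebra_simps)
    also have "\<dots> = (1/4) *\<^sub>C S + (1/4) *\<^sub>C S"
      unfolding a4 b4 ..
    also have "\<dots> = (1/2) *\<^sub>C S" by (simp flip: scaleC_add_left)
    finally show ?thesis by (simp add: S_def Aop_def scaleC_sum_right)
  qed
  have "hbar_op (\<Sum>k<n. c i j k *\<^sub>C Lop k f) =
     (0, br i j * f0, br i j * f1 + (\<Sum>k<n. c i j k *\<^sub>C Aop k f0))"
    by (simp add: hbar_op_def case_prod_unfold fst_sum snd_sum fst_sum2 scaleC_prod_def f Lop_def br_def sum_distrib_right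
        scaleC_add_right sum.distrib)
  moreover have "Lop i (Lop j f) - Lop j (Lop i f) = (0, br i j * f0, br i j * f1 + (\<Sum>k<n. c i j k *\<^sub>C Aop k f0))"
    using c1 [of f0] c1 [of f1] c2 [of f0]
    by (simp add: Lop_def f clinear_add [OF clinear_Aop] algebra_simps)
  ultimately show ?thesis by simp
qed

section \<open>The action of a single vector v and of its powers\<close>

definition vX :: "(nat \<Rightarrow> complex) \<Rightarrow> cpoly" where
  "vX t = (\<Sum>i<n. t i *\<^sub>C X i)"

definition adv :: "(nat \<Rightarrow> complex) \<Rightarrow> cpoly \<Rightarrow> cpoly" where
  "adv t f = (\<Sum>i<n. t i *\<^sub>C ad i f)"

text \<open>The derivation extending ad_v^2 on g, for v = \<open>vX t\<close>. It differs from
  \<open>adv t\<close> applied twice, which is an operator of second order.\<close>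

definition Wop :: "(nat \<Rightarrow> complex) \<Rightarrow> cpoly \<Rightarrow> cpoly" where
  "Wop t f = (\<Sum>k<n. adv t (adv t (X k)) * pd k f)"

text \<open>For v = \<open>vX t\<close>, the hbar^2 part of the action of v is -1/12 times this
  operator.\<close>

definition BBop :: "(nat \<Rightarrow> complex) \<Rightarrow> cpoly \<Rightarrow> cpoly" where
  "BBop t f = (\<Sum>k<n. \<Sum>l<n. ad l (adv t (X k)) * pd k (pd l f))"

lemma clinear_adv [clin]: "clinear (adv t)"
  unfolding adv_def by (intro clin)

lemma adv_mult: "adv t (f * g) = adv t f * g + f * adv t g"
  by (simp add: adv_def ad_mult scaleC_add_right sum.distrib sum_distrib_left sum_distrib_right)

lemma pd_vX: "k < n \<Longrightarrow> pd k (vX t) = t k *\<^sub>C 1"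
  by (simp add: vX_def clinear_simps [OF clinear_pd] pd_X if_distrib [of "\<lambda>x. _ *\<^sub>C x"] cong: if_cong)

lemma ad_vX: "i < n \<Longrightarrow> ad i (vX t) = - adv t (X i)"
proof -
  assume i: "i < n"
  have "t j *\<^sub>C br i j = - (t j *\<^sub>C br j i)" if "j < n" for j
    using br_antisym [OF i that] by simp
  then show ?thesis
    using i by (simp add: vX_def adv_def clinear_simps [OF clinear_ad] ad_X sum_negf)
qed

lemma adv_expand: "adv t f = (\<Sum>k<n. adv t (X k) * pd k f)"
proof -
  have "adv t f = (\<Sum>i<n. \<Sum>k<n. t i *\<^sub>C (br i k * pd k f))"
    by (simp add: adv_def ad_def scaleC_sum_right)
  also have "\<dots> = (\<Sum>k<n. \<Sum>i<n. t i *\<^sub>C (br i k * pd k f))"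
    by (rule sum.swap)
  also have "\<dots> = (\<Sum>k<n. adv t (X k) * pd k f)"
    by (simp add: adv_def ad_X sum_distrib_right)
  finally show ?thesis .
qed

text \<open>This is [v, v] = 0, obtained as an expression equal to its own negative. It makes
  \<open>adv t\<close> and \<open>Wop t\<close> commute with multiplication by v.\<close>

lemma adv_vX: "adv t (vX t) = 0"
proof -
  have "adv t (vX t) = (\<Sum>i<n. \<Sum>j<n. (t i * t j) *\<^sub>C br i j)"
    by (simp add: adv_def vX_def clinear_simps [OF clinear_ad] ad_X scaleC_sum_right)
  also have "\<dots> = (\<Sum>i<n. \<Sum>j<n. (t i * t j) *\<^sub>C br j i)"
    by (subst sum.swap) (simp add: mult.commute)
  also have "\<dots> = (\<Sum>i<n. \<Sum>j<n. - ((t i * t j) *\<^sub>C br i j))"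
  proof (intro sum.cong refl)
    fix i j assume "i \<in> {..<n}" "j \<in> {..<n}"
    then have "br j i = - br i j" by (intro br_antisym) auto
    then show "(t i * t j) *\<^sub>C br j i = - ((t i * t j) *\<^sub>C br i j)" by simp
  qed
  also have "\<dots> = - adv t (vX t)"
    by (simp add: adv_def vX_def clinear_simps [OF clinear_ad] ad_X scaleC_sum_right sum_negf)
  finally have "adv t (vX t) + adv t (vX t) = 0"
    by (simp only: eq_neg_iff_add_eq_0)
  moreover have "adv t (vX t) = (1/2) *\<^sub>C (adv t (vX t) + adv t (vX t))"
    by (simp only: scaleC_add_right scaleC_add_left [symmetric]) simp
  ultimately show ?thesis by simp
qed

lemma adv_vX_mult: "adv t (vX t * f) = vX t * adv t f"
  by (simp add: adv_mult adv_vX)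

lemma Wop_vX_mult: "Wop t (vX t * f) = vX t * Wop t f"
proof -
  have "(\<Sum>k<n. t k *\<^sub>C (adv t (adv t (X k)) * f)) = adv t (adv t (vX t)) * f"
    unfolding vX_def by (simp add: clinear_simps [OF clinear_adv] sum_distrib_right)
  then have "(\<Sum>k<n. t k *\<^sub>C (adv t (adv t (X k)) * f)) = 0"
    by (simp add: adv_vX clinear_0 [OF clinear_adv])
  then show ?thesis
    by (simp add: Wop_def pd_mult pd_vX algebra_simps sum.distrib sum_distrib_left)
qed

text \<open>If the derivative with index \<open>k\<close> falls on v, the sum rebuilds [v, v] = 0;
  if the one with index \<open>l\<close> does, it rebuilds ad_v^2 and hence
  \<open>Wop t\<close>.\<close>

lemma BBop_vX_mult: "BBop t (vX t * f) = vX t * BBop t f + Wop t f"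
proof -
  have "(\<Sum>k<n. t k *\<^sub>C (ad l (adv t (X k)) * pd l f)) = ad l (adv t (vX t)) * pd l f" for l
    unfolding vX_def by (simp add: clinear_simps [OF clinear_adv] clinear_simps [OF clinear_ad] sum_distrib_right)
  then have z: "(\<Sum>k<n. \<Sum>l<n. t k *\<^sub>C (ad l (adv t (X k)) * pd l f)) = 0"
    by (subst sum.swap) (simp add: adv_vX clinear_0 [OF clinear_ad])
  have w: "(\<Sum>k<n. \<Sum>l<n. t l *\<^sub>C (ad l (adv t (X k)) * pd k f)) = Wop t f"
    by (simp add: Wop_def adv_def [of t "adv t _"] sum_distrib_right)
  have "ad l (adv t (X k)) * pd k (pd l (vX t * f)) = vX t * (ad l (adv t (X k)) * pd k (pd l f)) +
     t k *\<^sub>C (ad l (adv t (X k)) * pd l f) + t l *\<^sub>C (ad l (adv t (X k)) * pd k f)" if "k < n" "l < n" for k l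
    using that by (simp add: pd_mult pd_vX clinear_simps [OF clinear_pd] algebra_simps scaleC_add_right)
  then have "BBop t (vX t * f) = (\<Sum>k<n. \<Sum>l<n. vX t * (ad l (adv t (X k)) * pd k (pd l f)) +
     t k *\<^sub>C (ad l (adv t (X k)) * pd l f) + t l *\<^sub>C (ad l (adv t (X k)) * pd k f))"
    by (simp add: BBop_def)
  also have "\<dots> = vX t * BBop t f + 0 + Wop t f"
    unfolding sum.distrib z w by (simp add: BBop_def sum_distrib_left)
  finally show ?thesis by simp
qed

definition Lv :: "(nat \<Rightarrow> complex) \<Rightarrow> cpoly \<times> cpoly \<times> cpoly \<Rightarrow> cpoly \<times> cpoly \<times> cpoly" where
  "Lv t f = (\<Sum>i<n. t i *\<^sub>C Lop i f)"

lemma Lv_components: "Lv t (f0, f1, f2) =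
   (vX t * f0, vX t * f1 + (1/2) *\<^sub>C adv t f0, vX t * f2 + (1/2) *\<^sub>C adv t f1 - (1/12) *\<^sub>C BBop t f0)"
proof -
  have split_sum: "sum g A = ((\<Sum>k\<in>A. fst (g k)), (\<Sum>k\<in>A. fst (snd (g k))), (\<Sum>k\<in>A. snd (snd (g k))))"
    for g :: "nat \<Rightarrow> cpoly \<times> cpoly \<times> cpoly" and A
    by (induction A rule: infinite_finite_induct) (auto simp: zero_prod_def plus_prod_def)
  have "(\<Sum>i<n. t i *\<^sub>C Bop i f0) = (- 1/12) *\<^sub>C (\<Sum>i<n. \<Sum>k<n. \<Sum>l<n. t i *\<^sub>C (ad l (br i k) * pd k (pd l f0)))"
    by (simp add: Bop_def scaleC_sum_right sum_negf mult.commute)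
  also have "(\<Sum>i<n. \<Sum>k<n. \<Sum>l<n. t i *\<^sub>C (ad l (br i k) * pd k (pd l f0))) = (\<Sum>k<n. \<Sum>l<n. \<Sum>i<n. t i *\<^sub>C (ad l (br i k) * pd k (pd l f0)))"
    by (subst sum.swap) (intro sum.cong refl sum.swap)
  also have "\<dots> = BBop t f0"
    by (simp add: BBop_def adv_def ad_X clinear_simps [OF clinear_ad] sum_distrib_right)
  finally have B: "(\<Sum>i<n. t i *\<^sub>C Bop i f0) = - ((1/12) *\<^sub>C BBop t f0)" by simp
  have A: "(\<Sum>i<n. t i *\<^sub>C Aop i f) = (1/2) *\<^sub>C adv t f" for f
    by (simp add: Aop_def adv_def scaleC_sum_right mult.commute)
  show ?thesis
    unfolding Lv_def split_sum
    by (simp add: Lop_def scaleC_prod_def scaleC_add_right sum.distrib A B) (simp add: vX_def sum_distrib_right)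
qed

text \<open>At order hbar the A-part is used once among m factors. At order hbar^2 it is used twice,
  in \<open>m choose 2\<close> ways, or the B-part is used once; moving the latter past k powers of
  v leaves k copies of \<open>Wop t\<close>, and these add up to \<open>m choose 2\<close>.\<close>

lemma Lv_power:
  "(Lv t ^^ m) (b, 0, 0) = (vX t ^ m * b, of_nat m * vX t ^ (m - 1) * ((1/2) *\<^sub>C adv t b),
     of_nat (m choose 2) * vX t ^ (m - 2) * ((1/4) *\<^sub>C adv t (adv t b) - (1/12) *\<^sub>C Wop t b) -
     of_nat m * vX t ^ (m - 1) * ((1/12) *\<^sub>C BBop t b))"
proof (induction m)
  case 0
  show ?case by (simp add: numeral_2_eq_2)
next
  case (Suc m)
  have adv_pow: "adv t (vX t ^ k * f) = vX t ^ k * adv t f" for k f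
    by (induction k) (simp_all add: adv_vX_mult mult.assoc)
  have W_pow: "Wop t (vX t ^ k * f) = vX t ^ k * Wop t f" for k f
    by (induction k) (simp_all add: Wop_vX_mult mult.assoc)
  have v1: "vX t * (of_nat k * vX t ^ (k - 1) * g) = of_nat k * vX t ^ k * g" for k g
    by (cases k) (simp_all add: mult_ac)
  \<comment> \<open>For \<open>k < 2\<close> the truncated exponents do no harm, since
    \<open>k choose 2\<close> is 0.\<close>
  have v2: "vX t * (of_nat (k choose 2) * vX t ^ (k - 2) * g) = of_nat (k choose 2) * vX t ^ (k - 1) * g" for k g
  proof (cases "k < 2")
    case False
    then obtain k' where "k = Suc (Suc k')" by (metis add_2_eq_Suc le_Suc_ex not_less)
    then show ?thesis by (simp add: mult_ac del: binomial_Suc_Suc)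
  qed (simp add: binomial_eq_0)
  have B_pow: "BBop t (vX t ^ k * f) = vX t ^ k * BBop t f + of_nat k * vX t ^ (k - 1) * Wop t f" for k f
  proof (induction k)
    case (Suc k)
    have "BBop t (vX t ^ Suc k * f) = vX t * BBop t (vX t ^ k * f) + vX t ^ k * Wop t f"
      by (simp add: BBop_vX_mult W_pow mult.assoc)
    then show ?case unfolding Suc distrib_left v1 by (simp add: algebra_simps)
  qed simp
  have adv2: "adv t (of_nat m * vX t ^ (m - 1) * ((1/2) *\<^sub>C adv t b)) = of_nat m * vX t ^ (m - 1) * ((1/2) *\<^sub>C adv t (adv t b))"
    by (simp add: clinear_scale [OF clinear_adv] adv_pow mult.assoc flip: scaleC_of_nat)
  have ch: "of_nat (Suc m choose 2) = of_nat m + of_nat (m choose 2)"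
    by (simp add: numeral_2_eq_2)
  have third: "vX t * (of_nat (m choose 2) * vX t ^ (m - 2) * ((1/4) *\<^sub>C adv t (adv t b) - (1/12) *\<^sub>C Wop t b) -
     of_nat m * vX t ^ (m - 1) * ((1/12) *\<^sub>C BBop t b)) +
     (1/2) *\<^sub>C adv t (of_nat m * vX t ^ (m - 1) * ((1/2) *\<^sub>C adv t b)) - (1/12) *\<^sub>C BBop t (vX t ^ m * b) =
     of_nat (Suc m choose 2) * vX t ^ (m - 1) * ((1/4) *\<^sub>C adv t (adv t b) - (1/12) *\<^sub>C Wop t b) -
     of_nat (Suc m) * vX t ^ m * ((1/12) *\<^sub>C BBop t b)"
    unfolding right_diff_distrib v1 v2 adv2 B_pow ch
    by (simp add: algebra_simps scaleC_add_right)
  have second: "vX t * (of_nat m * vX t ^ (m - 1) * ((1/2) *\<^sub>C adv t b)) + (1/2) *\<^sub>C adv t (vX t ^ m * b) =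
     of_nat (Suc m) * vX t ^ m * ((1/2) *\<^sub>C adv t b)"
    unfolding v1 adv_pow by (simp add: algebra_simps)
  show ?case
    by (simp add: Suc Lv_components third second mult.assoc del: of_nat_Suc binomial_Suc_Suc)
      (use third second in \<open>simp add: numeral_2_eq_2 mult.assoc\<close>)
qed


text \<open>
  \<open>M1\<close> and \<open>M2\<close> are the \<open>\<hbar>\<close> and \<open>\<hbar>\<^sup>2\<close> coefficients of \<open>\<mu> \<circ> F\<^sup>-\<^sup>1\<close>; those terms of the
  latter that \<open>ad_pd_cancel\<close> annihilates are left out.
\<close>

definition M1 :: "complex \<Rightarrow> complex \<Rightarrow> cpoly \<Rightarrow> cpoly \<Rightarrow> cpoly" where
  "M1 \<alpha> \<beta> a b = \<alpha> *\<^sub>C (\<Sum>i<n. ad i a * pd i b) + \<beta> *\<^sub>C (\<Sum>i<n. pd i a * ad i b)"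

definition M2 :: "cpoly \<Rightarrow> cpoly \<Rightarrow> cpoly" where
  "M2 a b = (- 1/24) *\<^sub>C ((\<Sum>i<n. \<Sum>j<n. ad i (pd j a) * ad j (pd i b)) +
     2 *\<^sub>C (\<Sum>i<n. \<Sum>j<n. pd j (ad i a) * pd i (ad j b)) +
     2 *\<^sub>C (\<Sum>i<n. \<Sum>j<n. kappa n c i j *\<^sub>C (pd i a * pd j b)))"

lemma clinear_M1 [clin]: "clinear (\<lambda>a. M1 \<alpha> \<beta> a b)"
  unfolding M1_def by (intro clin)

lemma clinear_M2 [clin]: "clinear (\<lambda>a. M2 a b)"
  unfolding M2_def by (intro clin clinear_compose [OF clinear_pd] clinear_compose [OF clinear_ad])

section \<open>The first two coefficients of \<mu> \<circ> F^{-1} on v^m \<otimes> b\<close>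

lemma pd_vX_power: "k < n \<Longrightarrow> pd k (vX t ^ m) = t k *\<^sub>C (of_nat m * vX t ^ (m - 1))"
  by (simp add: derivation_power [of "pd k", OF pd_mult] pd_vX)

text \<open>By \<open>ad_pd_cancel\<close> the two sums in \<open>M1\<close> are opposite, so only
  the difference of the parameters survives, and it supplies the 1/2 of \<open>Aop\<close>.\<close>

lemma M1_power:
  assumes "\<alpha> - \<beta> = - 1/2"
  shows "M1 \<alpha> \<beta> (vX t ^ m) b = of_nat m * vX t ^ (m - 1) * ((1/2) *\<^sub>C adv t b)"
proof -
  have "(\<Sum>i<n. ad i (vX t ^ m) * pd i b) = - (\<Sum>i<n. pd i (vX t ^ m) * ad i b)"
    using ad_pd_cancel [of "vX t ^ m" b] by (simp add: eq_neg_iff_add_eq_0)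
  then have "M1 \<alpha> \<beta> (vX t ^ m) b = (\<beta> - \<alpha>) *\<^sub>C (\<Sum>i<n. pd i (vX t ^ m) * ad i b)"
    by (simp add: M1_def scaleC_diff_left)
  also have "(\<Sum>i<n. pd i (vX t ^ m) * ad i b) = of_nat m * vX t ^ (m - 1) * adv t b"
    by (simp add: pd_vX_power adv_def sum_distrib_left)
  also have "\<beta> - \<alpha> = 1/2" using minus_diff_eq [of \<alpha> \<beta>] by (simp add: assms)
  finally show ?thesis by simp
qed

text \<open>The left side is the trace of ad_{e_k} ad_v up to the sign from reversing one bracket,
  and \<open>kappa\<close> carries that same sign.\<close>

lemma kappa_contract:
  assumes "k < n"
  shows "(\<Sum>i<n. \<Sum>j<n. (\<Sum>s<n. t s * c s i j) * c j k i) = (\<Sum>s<n. t s * kappa n c s k)"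
proof -
  have "(\<Sum>i<n. \<Sum>j<n. (\<Sum>s<n. t s * c s i j) * c j k i) = (\<Sum>i<n. \<Sum>j<n. \<Sum>s<n. - (t s * (c s i j * c k j i)))"
    unfolding sum_distrib_right by (intro sum.cong refl) (use assms c_antisym [of _ k] in simp)
  also have "\<dots> = (\<Sum>i<n. \<Sum>s<n. \<Sum>j<n. - (t s * (c s i j * c k j i)))"
    by (intro sum.cong refl sum.swap)
  also have "\<dots> = (\<Sum>s<n. \<Sum>i<n. \<Sum>j<n. - (t s * (c s i j * c k j i)))"
    by (rule sum.swap)
  also have "\<dots> = (\<Sum>s<n. \<Sum>j<n. \<Sum>i<n. - (t s * (c s i j * c k j i)))"
    by (intro sum.cong refl sum.swap)
  also have "\<dots> = (\<Sum>s<n. t s * kappa n c s k)"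
    by (simp add: kappa_def sum_distrib_left sum_negf mult.commute [of "c k _ _"])
  finally show ?thesis .
qed

text \<open>\<open>NS\<close>, \<open>RS\<close> and \<open>KS\<close> evaluate the three sums of
  \<open>M2\<close> on v^m. In NS + 2 RS + 2 KS the terms \<tau> cancel; there remain -6
  \<open>p2\<close> ad_v^2, 2 \<open>p2\<close> \<open>Wop\<close> and 2 \<open>p1\<close>
  \<open>BBop\<close>, which the factor -1/24 turns into the coefficients of
  \<open>Lv_power\<close>.\<close>

lemma M2_power:
  "M2 (vX t ^ m) b =
     of_nat (m choose 2) * vX t ^ (m - 2) * ((1/4) *\<^sub>C adv t (adv t b) - (1/12) *\<^sub>C Wop t b) -
     of_nat m * vX t ^ (m - 1) * ((1/12) *\<^sub>C BBop t b)"
proof -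
  define a where "a = vX t ^ m"
  define p1 where "p1 = of_nat m * vX t ^ (m - 1)"
  \<comment> \<open>\<open>2 * p2\<close> is m(m-1) v^(m-2), the common factor of the second
    derivatives of v^m; halving it matches the binomial coefficient in
    \<open>Lv_power\<close>.\<close>
  define p2 where "p2 = of_nat (m choose 2) * vX t ^ (m - 2)"
  define l where "l i = adv t (X i)" for i
  \<comment> \<open>The matrix of ad_v in the given basis; it appears when a derivative of v^m is
    moved past \<open>ad i\<close>.\<close>
  define M where "M i j = (\<Sum>s<n. t s * c s i j)" for i j
  define \<tau> where "\<tau> = (\<Sum>k<n. (\<Sum>s<n. t s * kappa n c s k) *\<^sub>C pd k b)"
  have ch: "m * (m - 1) = 2 * (m choose 2)"
    by (induction m) (simp_all add: numeral_2_eq_2 algebra_simps, case_tac m, simp_all)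
  have pd_a: "pd j a = t j *\<^sub>C p1" if "j < n" for j
    using that by (simp add: a_def pd_vX_power p1_def)
  have adpd_a: "ad i (pd j a) = - (t j *\<^sub>C (2 * p2 * l i))" if "i < n" "j < n" for i j
  proof -
    have "ad i p1 = of_nat m * ad i (vX t ^ (m - 1))"
      by (simp add: p1_def clinear_simps [OF clinear_ad] flip: scaleC_of_nat)
    also have "\<dots> = of_nat m * (of_nat (m - 1) * vX t ^ (m - 1 - 1) * ad i (vX t))"
      by (simp only: derivation_power [of "ad i", OF ad_mult])
    also have "\<dots> = - (of_nat (m * (m - 1)) * vX t ^ (m - 2) * l i)"
      using that by (simp add: ad_vX l_def diff_diff_left numeral_2_eq_2 mult.assoc)
    also have "\<dots> = - (2 * p2 * l i)"
      unfolding ch by (simp add: p2_def mult_ac)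
    finally show ?thesis
      using that by (simp add: pd_a clinear_simps [OF clinear_ad])
  qed
  have pdad_a: "pd j (ad i a) = - (t j *\<^sub>C (2 * p2 * l i)) - M i j *\<^sub>C p1" if "i < n" "j < n" for i j
  proof -
    have "(\<Sum>k<n. c i k j *\<^sub>C pd k a) = (\<Sum>k<n. - (t k * c k i j) *\<^sub>C p1)"
      by (intro sum.cong refl) (use that in \<open>simp add: pd_a c_antisym [of i] mult.commute\<close>)
    then show ?thesis
      using that by (simp add: pd_ad adpd_a M_def scaleC_sum_left sum_negf)
  qed
  have l_expand: "l i = (\<Sum>j<n. M i j *\<^sub>C X j)" if "i < n" for i
  proof -
    have "l i = (\<Sum>s<n. \<Sum>j<n. (t s * c s i j) *\<^sub>C X j)"
      using that by (simp add: l_def adv_def ad_X br_def scaleC_sum_right)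
    also have "\<dots> = (\<Sum>j<n. \<Sum>s<n. (t s * c s i j) *\<^sub>C X j)"
      by (rule sum.swap)
    finally show ?thesis by (simp add: M_def scaleC_sum_left)
  qed
  have NS: "(\<Sum>i<n. \<Sum>j<n. ad i (pd j a) * ad j (pd i b)) = - (2 * p2 * (adv t (adv t b) - Wop t b))"
  proof -
    have "(\<Sum>i<n. \<Sum>j<n. ad i (pd j a) * ad j (pd i b)) = - (\<Sum>i<n. 2 * p2 * (l i * adv t (pd i b)))"
      by (simp add: adpd_a adv_def sum_distrib_left sum_negf mult.assoc)
    also have "adv t (adv t b) = Wop t b + (\<Sum>i<n. l i * adv t (pd i b))"
      by (subst adv_expand [of t b]) (simp add: clinear_simps [OF clinear_adv] adv_mult sum.distrib Wop_def l_def)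
    then have "(\<Sum>i<n. 2 * p2 * (l i * adv t (pd i b))) = 2 * p2 * (adv t (adv t b) - Wop t b)"
      by (simp add: sum_distrib_left)
    finally show ?thesis .
  qed
  \<comment> \<open>Moving \<open>pd i\<close> past \<open>ad j\<close> splits off a commutator with
    constant coefficients, whose contraction with \<open>M\<close> is the trace term \<tau>; the
    second-order rest is -\<open>BBop\<close>.\<close>
  have MS: "(\<Sum>i<n. \<Sum>j<n. M i j *\<^sub>C pd i (ad j b)) = \<tau> - BBop t b"
  proof -
    have e: "(\<Sum>i<n. \<Sum>j<n. M i j *\<^sub>C pd i (ad j b)) = (\<Sum>i<n. \<Sum>j<n. M i j *\<^sub>C ad j (pd i b)) +
        (\<Sum>i<n. \<Sum>j<n. \<Sum>k<n. (M i j * c j k i) *\<^sub>C pd k b)"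
      by (simp add: pd_ad scaleC_add_right sum.distrib scaleC_sum_right)
    have "(\<Sum>j<n. M i j *\<^sub>C ad j (pd i b)) = - (\<Sum>k<n. ad k (l i) * pd i (pd k b))" if i: "i < n" for i
    proof -
      have "(\<Sum>j<n. M i j *\<^sub>C ad j (pd i b)) = (\<Sum>j<n. \<Sum>k<n. M i j *\<^sub>C (br j k * pd k (pd i b)))"
        by (simp add: ad_def scaleC_sum_right)
      also have "\<dots> = (\<Sum>k<n. \<Sum>j<n. M i j *\<^sub>C (br j k * pd k (pd i b)))"
        by (rule sum.swap)
      also have "\<dots> = (\<Sum>k<n. \<Sum>j<n. - (M i j *\<^sub>C (br k j * pd i (pd k b))))"
      proof (intro sum.cong refl)
        fix k j assume "k \<in> {..<n}" "j \<in> {..<n}"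
        then have "br j k = - br k j" by (intro br_antisym) auto
        then show "M i j *\<^sub>C (br j k * pd k (pd i b)) = - (M i j *\<^sub>C (br k j * pd i (pd k b)))"
          by (simp add: pd_commute [of k])
      qed
      also have "\<dots> = - (\<Sum>k<n. ad k (l i) * pd i (pd k b))"
        using i by (simp add: l_expand clinear_simps [OF clinear_ad] ad_X sum_negf sum_distrib_right)
      finally show ?thesis .
    qed
    then have e1: "(\<Sum>i<n. \<Sum>j<n. M i j *\<^sub>C ad j (pd i b)) = - BBop t b"
      by (simp add: BBop_def l_def sum_negf)
    have "(\<Sum>i<n. \<Sum>j<n. \<Sum>k<n. (M i j * c j k i) *\<^sub>C pd k b) = (\<Sum>i<n. \<Sum>k<n. \<Sum>j<n. (M i j * c j k i) *\<^sub>C pd k b)"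
      by (intro sum.cong refl sum.swap)
    also have "\<dots> = (\<Sum>k<n. \<Sum>i<n. \<Sum>j<n. (M i j * c j k i) *\<^sub>C pd k b)"
      by (rule sum.swap)
    also have "\<dots> = \<tau>"
      unfolding \<tau>_def M_def
      by (intro sum.cong refl) (simp flip: kappa_contract scaleC_sum_left)
    finally show ?thesis using e e1 by simp
  qed
  have RS: "(\<Sum>i<n. \<Sum>j<n. pd j (ad i a) * pd i (ad j b)) = - (2 * p2 * adv t (adv t b)) - p1 * (\<tau> - BBop t b)"
  proof -
    have "(\<Sum>i<n. \<Sum>j<n. pd j (ad i a) * pd i (ad j b)) =
       (\<Sum>i<n. \<Sum>j<n. - (2 * p2 * l i * (t j *\<^sub>C pd i (ad j b))) - p1 * (M i j *\<^sub>C pd i (ad j b)))"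
      by (intro sum.cong refl) (simp add: pdad_a left_diff_distrib)
    also have "\<dots> = - (\<Sum>i<n. 2 * p2 * l i * (\<Sum>j<n. t j *\<^sub>C pd i (ad j b))) - p1 * (\<tau> - BBop t b)"
      unfolding MS [symmetric] sum_subtractf sum_negf sum_distrib_left ..
    also have "(\<Sum>i<n. 2 * p2 * l i * (\<Sum>j<n. t j *\<^sub>C pd i (ad j b))) = 2 * p2 * adv t (adv t b)"
      by (subst adv_expand) (simp add: l_def adv_def [of t b] clinear_simps [OF clinear_pd] sum_distrib_left mult.assoc)
    finally show ?thesis .
  qed
  have KS: "(\<Sum>i<n. \<Sum>j<n. kappa n c i j *\<^sub>C (pd i a * pd j b)) = p1 * \<tau>"
  proof -
    have "(\<Sum>i<n. \<Sum>j<n. kappa n c i j *\<^sub>C (pd i a * pd j b)) = (\<Sum>i<n. \<Sum>j<n. (t i * kappa n c i j) *\<^sub>C (p1 * pd j b))"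
      by (simp add: pd_a mult.commute)
    also have "\<dots> = (\<Sum>j<n. \<Sum>i<n. (t i * kappa n c i j) *\<^sub>C (p1 * pd j b))"
      by (rule sum.swap)
    finally show ?thesis
      by (simp add: \<tau>_def sum_distrib_left scaleC_sum_left)
  qed
  have "M2 a b = (1/24) *\<^sub>C (2 *\<^sub>C (p2 * (adv t (adv t b) - Wop t b)) + 4 *\<^sub>C (p2 * adv t (adv t b)) - 2 *\<^sub>C (p1 * BBop t b))"
    unfolding M2_def NS RS KS by (simp add: scaleC_numeral algebra_simps flip: scaleC_minus_right)
  also have "\<dots> = p2 * ((1/4) *\<^sub>C adv t (adv t b) - (1/12) *\<^sub>C Wop t b) - p1 * ((1/12) *\<^sub>C BBop t b)"
  proof -
    have "(1/12) *\<^sub>C x + (1/6) *\<^sub>C x = (1/4) *\<^sub>C x" for x :: cpoly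
      by (simp flip: scaleC_add_left)
    then show ?thesis
      by (simp add: scaleC_add_right scaleC_diff_right right_diff_distrib add.assoc [symmetric])
  qed
  finally show ?thesis by (simp add: a_def p1_def p2_def)
qed

definition star :: "complex \<Rightarrow> complex \<Rightarrow> cpoly \<Rightarrow> cpoly \<Rightarrow> cpoly \<times> cpoly \<times> cpoly" where
  "star \<alpha> \<beta> a b = (a * b, M1 \<alpha> \<beta> a b, M2 a b)"

lemma clinear_star: "clinear (\<lambda>a. star \<alpha> \<beta> a b)"
  by (rule clinearI)
    (simp_all add: star_def scaleC_prod_def clinear_simps [OF clinear_M1] clinear_simps [OF clinear_M2] distrib_right)

lemma Lv_power_star:
  "\<alpha> - \<beta> = - 1/2 \<Longrightarrow> (Lv t ^^ m) (b, 0, 0) = star \<alpha> \<beta> (vX t ^ m) b"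
  by (simp add: star_def Lv_power M1_power M2_power)

end

section \<open>Polarization\<close>

text \<open>Lists rather than multisets index the expansion, since the \<open>a x\<close> need not
  commute.\<close>

lemma power_sum_lists:
  fixes a :: "'i \<Rightarrow> 'a::semiring_1"
  assumes "finite T"
  shows "sum a T ^ m = (\<Sum>xs | set xs \<subseteq> T \<and> length xs = m. prod_list (map a xs))"
proof (induction m)
  case 0
  have "{xs. set xs \<subseteq> T \<and> length xs = 0} = {[]}" by auto
  then show ?case by simp
next
  case (Suc m)
  let ?L = "\<lambda>m. {xs. set xs \<subseteq> T \<and> length xs = m}"
  have "sum a T ^ Suc m = (\<Sum>x\<in>T. \<Sum>xs\<in>?L m. a x * prod_list (map a xs))"
    by (simp add: Suc sum_product)
  also have "\<dots> = (\<Sum>(x, xs)\<in>T \<times> ?L m. a x * prod_list (map a xs))"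
    by (rule sum.cartesian_product)
  also have "\<dots> = (\<Sum>xs\<in>?L (Suc m). prod_list (map a xs))"
    by (rule sum.reindex_bij_witness [where j = "\<lambda>(x, xs). x # xs" and i = "\<lambda>xs. (hd xs, tl xs)"])
      (auto simp: length_Suc_conv)
  finally show ?case .
qed

text \<open>\<open>f U\<close> collects the words of length m whose set of letters is exactly U, so
  Moebius inversion over subsets isolates U = \<open>{..<m}\<close>; a word of length m that uses
  all m letters is a permutation. It applies in the free algebra and in S(g) alike.\<close>

lemma polarization:
  fixes a :: "nat \<Rightarrow> 'a::ring_1"
  shows "(\<Sum>\<sigma> | \<sigma> permutes {..<m}. prod_list (map (\<lambda>i. a (\<sigma> i)) [0..<m])) =
    (\<Sum>T\<in>Pow {..<m}. (- 1) ^ (m - card T) * sum a T ^ m)"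
proof -
  define f where "f U = (\<Sum>xs | set xs = U \<and> length xs = m. prod_list (map a xs))" for U
  have "sum a T ^ m = sum f (Pow T)" if "finite T" for T
  proof -
    have fin: "finite {xs. set xs \<subseteq> T \<and> length xs = m}"
      using that by (rule finite_lists_length_eq)
    have "sum a T ^ m = (\<Sum>xs | set xs \<subseteq> T \<and> length xs = m. prod_list (map a xs))"
      using that by (rule power_sum_lists)
    also have "\<dots> = (\<Sum>U\<in>Pow T. \<Sum>xs | xs \<in> {xs. set xs \<subseteq> T \<and> length xs = m} \<and> set xs = U. prod_list (map a xs))"
      by (rule sum.group [symmetric]) (use fin that in auto)
    also have "\<dots> = sum f (Pow T)"
      unfolding f_def by (intro sum.cong refl) auto
    finally show ?thesis .
  qed
  from inclusion_exclusion_mobius [of "\<lambda>T. sum a T ^ m" f "{..<m}", OF this]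
  have "f {..<m} = (\<Sum>T\<in>Pow {..<m}. (- 1) ^ (m - card T) * sum a T ^ m)" by simp
  moreover have "(\<Sum>\<sigma> | \<sigma> permutes {..<m}. prod_list (map (\<lambda>i. a (\<sigma> i)) [0..<m])) = f {..<m}"
    unfolding f_def
  \<comment> \<open>Outside \<open>{..<m}\<close> the map built from a list is the identity, as
    \<open>permutes\<close> demands.\<close>
  proof (rule sum.reindex_bij_witness [where j = "\<lambda>\<sigma>. map \<sigma> [0..<m]" and i = "\<lambda>xs k. if k < m then xs ! k else k"])
    fix \<sigma> assume "\<sigma> \<in> {\<sigma>. \<sigma> permutes {..<m}}"
    then have \<sigma>: "\<sigma> permutes {..<m}" by simp
    show "(\<lambda>k. if k < m then map \<sigma> [0..<m] ! k else k) = \<sigma>"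
      using permutes_not_in [OF \<sigma>] by auto
    show "map \<sigma> [0..<m] \<in> {xs. set xs = {..<m} \<and> length xs = m}"
      using permutes_image [OF \<sigma>] by (simp add: atLeast0LessThan)
    show "prod_list (map a (map \<sigma> [0..<m])) = prod_list (map (\<lambda>i. a (\<sigma> i)) [0..<m])"
      by (simp add: comp_def)
  next
    fix xs assume "xs \<in> {xs. set xs = {..<m} \<and> length xs = m}"
    then have xs: "set xs = {..<m}" "length xs = m" by auto
    then have d: "distinct xs" by (simp add: card_distinct)
    show "map (\<lambda>k. if k < m then xs ! k else k) [0..<m] = xs"
      by (rule nth_equalityI) (simp_all add: xs)
    have "bij_betw ((!) xs) {..<m} {..<m}"
      by (rule bij_betw_nth [OF d]) (simp_all add: xs)
    then have "bij_betw (\<lambda>k. if k < m then xs ! k else k) {..<m} {..<m}"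
      by (rule bij_betw_cong [THEN iffD1, rotated]) simp
    then show "(\<lambda>k. if k < m then xs ! k else k) \<in> {\<sigma>. \<sigma> permutes {..<m}}"
      by (auto intro!: bij_imp_permutes split: if_splits)
  qed
  ultimately show ?thesis by simp
qed

section \<open>Symmetrisation and the action of the enveloping algebra\<close>

lemma word_map: "word (map g xs) = prod_list (map (\<lambda>x. word [g x]) xs)"
proof (induction xs)
  case (Cons x xs)
  then show ?case by (simp add: word_Cons [of _ "map g xs"])
qed simp

lemma minus_one_power_scaleC: "(- 1) ^ k * x = (- 1) ^ k *\<^sub>C (x :: 'a::calg)"
  by (cases "even k") auto

lemma scaleC_cancel: "a \<noteq> 0 \<Longrightarrow> a *\<^sub>C x = a *\<^sub>C y \<Longrightarrow> x = (y :: 'a::cvec)"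
proof -
  assume a: "a \<noteq> 0" and "a *\<^sub>C x = a *\<^sub>C y"
  then have "(1/a) *\<^sub>C a *\<^sub>C x = (1/a) *\<^sub>C a *\<^sub>C y" by metis
  with a show ?thesis by simp
qed

text \<open>Letters of a word may repeat, so a set of positions yields a vector whose coordinates
  are multiplicities; this brings subset sums into the form \<open>vX t\<close> and
  \<open>Lv t\<close>.\<close>

lemma sum_by_multiplicity:
  fixes g :: "nat \<Rightarrow> 'v::cvec"
  assumes "finite T" "\<And>i. i \<in> T \<Longrightarrow> w i < n"
  shows "(\<Sum>i\<in>T. g (w i)) = (\<Sum>j<n. of_nat (card {i \<in> T. w i = j}) *\<^sub>C g j)"
proof -
  have "(\<Sum>j<n. of_nat (card {i \<in> T. w i = j}) *\<^sub>C g j) = (\<Sum>j<n. \<Sum>i | i \<in> T \<and> w i = j. g (w i))"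
  proof (rule sum.cong)
    fix j
    have "of_nat (card {i \<in> T. w i = j}) *\<^sub>C g j = (\<Sum>i | i \<in> T \<and> w i = j. g j)"
      using scaleC_sum_left [of "\<lambda>_. 1" "{i \<in> T. w i = j}" "g j"] by simp
    then show "of_nat (card {i \<in> T. w i = j}) *\<^sub>C g j = (\<Sum>i | i \<in> T \<and> w i = j. g (w i))"
      by simp
  qed simp
  also have "\<dots> = (\<Sum>i\<in>T. g (w i))"
    by (rule sum.group) (use assms in auto)
  finally show ?thesis by simp
qed

text \<open>Forgets the order of the letters; \<open>S_cong\<close> shows that on letters below
  \<open>n\<close> nothing beyond the relations of S(g) is lost.\<close>

definition toR :: "(nat list \<Rightarrow>\<^sub>0 complex) \<Rightarrow> cpoly" where
  "toR = lin (\<lambda>w. Poly_Mapping.single (mset w) 1)"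

lemma clinear_toR [clin]: "clinear toR"
  unfolding toR_def by (rule clinear_lin)

lemma toR_word [simp]: "toR (word w) = Poly_Mapping.single (mset w) 1"
  by (simp add: toR_def)

lemma prod_list_X: "prod_list (map X xs) = Poly_Mapping.single (mset xs) 1"
  by (induction xs) (simp_all add: X_def mult_single)

definition psym :: "nat list \<Rightarrow> (nat option list \<Rightarrow>\<^sub>0 complex)" where
  "psym w = (1 / of_nat (fact (length w))) *\<^sub>C
     (\<Sum>\<sigma> | \<sigma> permutes {..<length w}. word (map (\<lambda>i. Some (w ! \<sigma> i)) [0..<length w]))"

lemma sym_word_lookup: "sym_word w = Poly_Mapping.lookup (psym w)"
  by (simp add: sym_word_def psym_def fa_lookup)

lemma phi_lookup: "phi (Poly_Mapping.lookup p) = Poly_Mapping.lookup (lin psym p)"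
  unfolding phi_def sym_word_lookup [abs_def] by (rule fa_lin_lookup)

lemma psym_polarization:
  "fact (length w) *\<^sub>C psym w =
     (\<Sum>T\<in>Pow {..<length w}. (- 1) ^ (length w - card T) *\<^sub>C (\<Sum>i\<in>T. word [Some (w ! i)]) ^ length w)"
proof -
  have "fact (length w) *\<^sub>C psym w =
      (\<Sum>\<sigma> | \<sigma> permutes {..<length w}. prod_list (map (\<lambda>i. word [Some (w ! \<sigma> i)]) [0..<length w]))"
    by (simp add: psym_def word_map)
  then show ?thesis
    unfolding polarization [of "\<lambda>i. word [Some (w ! i)]"] minus_one_power_scaleC .
qed

text \<open>All m! permutations give the same monomial. Signs and subsets are those of
  \<open>psym_polarization\<close>, so linear maps on the two sides can be compared power by
  power.\<close>

lemma monomial_polarization: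
  "fact (length w) *\<^sub>C Poly_Mapping.single (mset w) 1 =
     (\<Sum>T\<in>Pow {..<length w}. (- 1) ^ (length w - card T) *\<^sub>C (\<Sum>i\<in>T. X (w ! i)) ^ length w)"
proof -
  have "prod_list (map (\<lambda>i. X (w ! \<sigma> i)) [0..<length w]) = Poly_Mapping.single (mset w) 1"
    if "\<sigma> permutes {..<length w}" for \<sigma>
  proof -
    have "mset (map (\<lambda>i. w ! \<sigma> i) [0..<length w]) = mset w"
      using mset_permute_list [OF that] by (simp add: permute_list_def)
    moreover have "prod_list (map (\<lambda>i. X (w ! \<sigma> i)) [0..<length w]) = prod_list (map X (map (\<lambda>i. w ! \<sigma> i) [0..<length w]))"
      by (simp add: comp_def)
    ultimately show ?thesis
      unfolding prod_list_X by simp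
  qed
  then have "(\<Sum>\<sigma> | \<sigma> permutes {..<length w}. prod_list (map (\<lambda>i. X (w ! \<sigma> i)) [0..<length w])) =
      of_nat (card {\<sigma>. \<sigma> permutes {..<length w}}) * Poly_Mapping.single (mset w) 1"
    by simp
  also have "card {\<sigma>. \<sigma> permutes {..<length w}} = fact (length w)"
    by (simp add: card_permutations)
  finally show ?thesis
    unfolding polarization [of "\<lambda>i. X (w ! i)"] minus_one_power_scaleC
    using scaleC_of_nat [of "fact (length w)" "Poly_Mapping.single (mset w) 1 :: cpoly"] by simp
qed

context lie
begin

text \<open>Generators \<open>Some i\<close> with \<open>i \<ge> n\<close> occur in ideal elements but in no relation; they act by 0.\<close>

definition ustep :: "nat option \<Rightarrow> cpoly \<times> cpoly \<times> cpoly \<Rightarrow> cpoly \<times> cpoly \<times> cpoly" where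
  "ustep g = (case g of None \<Rightarrow> hbar_op | Some i \<Rightarrow> if i < n then Lop i else (\<lambda>_. 0))"

definition rho :: "(nat option list \<Rightarrow>\<^sub>0 complex) \<Rightarrow> cpoly \<times> cpoly \<times> cpoly \<Rightarrow> cpoly \<times> cpoly \<times> cpoly" where
  "rho p f = lin (\<lambda>w. foldr ustep w f) p"

lemma clinear_foldr_ustep: "clinear (foldr ustep w)"
proof (induction w)
  case (Cons g w)
  have "clinear (ustep g)"
    by (cases g) (auto simp: ustep_def intro!: clin)
  from clinear_compose [OF this Cons] show ?case by (simp add: comp_def)
qed (simp add: clinear_ident id_def)

lemma clinear_rho_left [clin]: "clinear (\<lambda>p. rho p f)"
  unfolding rho_def by (rule clinear_lin)

lemma clinear_rho [clin]: "clinear (rho p)"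
  unfolding rho_def using clinear_foldr_ustep by (rule clinear_lin_fun)

lemma rho_word: "rho (word w) f = foldr ustep w f"
  by (simp add: rho_def)

lemma rho_1 [simp]: "rho 1 f = f"
  using rho_word [of "[]"] by simp

lemma rho_mult: "rho (p * q) f = rho p (rho q f)"
proof (rule clinear_eqI [where p = p])
  show "clinear (\<lambda>p. rho (p * q) f)" "clinear (\<lambda>p. rho p (rho q f))"
    by (intro clin clinear_compose [OF clinear_rho_left])+
  fix u
  show "rho (word u * q) f = rho (word u) (rho q f)"
  proof (rule clinear_eqI [where p = q])
    show "clinear (\<lambda>q. rho (word u * q) f)" "clinear (\<lambda>q. rho (word u) (rho q f))"
      by (intro clin clinear_compose [OF clinear_rho_left] clinear_compose [OF clinear_rho])+
  qed (simp add: rho_word flip: word_append)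
qed

lemma rho_power: "rho (p ^ m) f = (rho p ^^ m) f"
  by (induction m) (simp_all add: rho_mult)

lemma U_rel_lookup:
  "Poly_Mapping.lookup r \<in> U_rel n c \<longleftrightarrow>
    (\<exists>i<n. r = word [None] * word [Some i] - word [Some i] * word [None]) \<or>
    (\<exists>i<n. \<exists>j<n. r = word [Some i] * word [Some j] - word [Some j] * word [Some i] -
       word [None] * (\<Sum>k<n. c i j k *\<^sub>C word [Some k]))"
  by (auto simp: U_rel_def fa_lookup simp flip: poly_mapping_eq_iff)

lemma U_rel_fin: "r \<in> U_rel n c \<Longrightarrow> fa_fin r"
  by (auto simp: U_rel_def fa_lookup)

text \<open>The relations act as 0 by \<open>Lop_hbar_op\<close> and \<open>Lop_commutator\<close>.
  The vector \<open>f\<close> is left arbitrary because in a product x p y the element p acts on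
  \<open>rho y f\<close>.\<close>

lemma rho_ideal:
  assumes "p \<in> fideal (U_rel n c)"
  shows "rho p f = 0"
  using assms
proof (induction p arbitrary: f rule: fideal_induct)
  case (fin r)
  then show ?case by (rule U_rel_fin)
next
  case (base r)
  then consider (h) i where "i < n" "r = word [None] * word [Some i] - word [Some i] * word [None]"
    | (b) i j where "i < n" "j < n" "r = word [Some i] * word [Some j] - word [Some j] * word [Some i] -
       word [None] * (\<Sum>k<n. c i j k *\<^sub>C word [Some k])"
    unfolding U_rel_lookup by blast
  then show ?case
  proof cases
    case h
    then show ?thesis
      by (simp add: clinear_simps [OF clinear_rho_left] rho_mult rho_word ustep_def Lop_hbar_op)
  next
    case b
    then show ?thesis
      using Lop_commutator [OF b(1,2), of f]
      by (simp add: clinear_simps [OF clinear_rho_left] rho_mult rho_word ustep_def)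
  qed
qed (simp_all add: clinear_simps [OF clinear_rho_left] rho_mult clinear_0 [OF clinear_rho])

text \<open>Both sides are the same signed combination over m-th powers of vectors v, and for each v
  the claim is \<open>Lv_power_star\<close>.\<close>

lemma rho_psym:
  assumes "set w \<subseteq> {..<n}" and ab: "\<alpha> - \<beta> = - 1/2"
  shows "rho (psym w) (b, 0, 0) = star \<alpha> \<beta> (Poly_Mapping.single (mset w) 1) b"
proof -
  let ?m = "length w"
  have T: "rho ((\<Sum>i\<in>T. word [Some (w ! i)]) ^ ?m) (b, 0, 0) = star \<alpha> \<beta> ((\<Sum>i\<in>T. X (w ! i)) ^ ?m) b"
    if "T \<in> Pow {..<?m}" for T
  proof -
    define t where "t j = (of_nat (card {i \<in> T. w ! i = j}) :: complex)" for j
    have fin: "finite T" using that by (auto intro: finite_subset)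
    have lt: "w ! i < n" if "i \<in> T" for i
    proof -
      have "i < ?m" using that \<open>T \<in> Pow {..<?m}\<close> by auto
      then have "w ! i \<in> set w" by simp
      then show ?thesis using assms(1) by blast
    qed
    have "(\<Sum>i\<in>T. X (w ! i)) = vX t"
      using sum_by_multiplicity [OF fin lt, where g = X] by (simp add: vX_def t_def)
    moreover have "rho (\<Sum>i\<in>T. word [Some (w ! i)]) = Lv t"
    proof
      fix f
      have "rho (\<Sum>i\<in>T. word [Some (w ! i)]) f = (\<Sum>i\<in>T. Lop (w ! i) f)"
        by (simp add: clinear_sum [OF clinear_rho_left] rho_word ustep_def lt)
      also have "\<dots> = Lv t f"
        using sum_by_multiplicity [OF fin lt, where g = "\<lambda>j. Lop j f"] by (simp add: Lv_def t_def)
      finally show "rho (\<Sum>i\<in>T. word [Some (w ! i)]) f = Lv t f" .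
    qed
    ultimately show ?thesis
      by (simp add: rho_power Lv_power_star [OF ab])
  qed
  have "fact ?m *\<^sub>C rho (psym w) (b, 0, 0) = rho (fact ?m *\<^sub>C psym w) (b, 0, 0)"
    by (simp add: clinear_simps [OF clinear_rho_left])
  also have "\<dots> = (\<Sum>T\<in>Pow {..<?m}. (- 1) ^ (?m - card T) *\<^sub>C star \<alpha> \<beta> ((\<Sum>i\<in>T. X (w ! i)) ^ ?m) b)"
    unfolding psym_polarization by (simp add: clinear_sum [OF clinear_rho_left] clinear_scale [OF clinear_rho_left] T)
  also have "\<dots> = star \<alpha> \<beta> (fact ?m *\<^sub>C Poly_Mapping.single (mset w) 1) b"
    unfolding monomial_polarization by (simp add: clinear_sum [OF clinear_star] clinear_scale [OF clinear_star])
  also have "\<dots> = fact ?m *\<^sub>C star \<alpha> \<beta> (Poly_Mapping.single (mset w) 1) b"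
    by (simp add: clinear_scale [OF clinear_star])
  finally show ?thesis by (rule scaleC_cancel [rotated]) simp
qed

lemma rho_phi:
  assumes "Poly_Mapping.keys p \<subseteq> lists {..<n}" and ab: "\<alpha> - \<beta> = - 1/2"
  shows "rho (lin psym p) (b, 0, 0) = star \<alpha> \<beta> (toR p) b"
proof (rule clinear_eqI [where p = p])
  show "clinear (\<lambda>p. rho (lin psym p) (b, 0, 0))" "clinear (\<lambda>p. star \<alpha> \<beta> (toR p) b)"
    by (intro clinear_compose [OF clinear_rho_left] clinear_compose [OF clinear_star] clin)+
  fix w assume "w \<in> Poly_Mapping.keys p"
  then have "set w \<subseteq> {..<n}" using assms(1) by auto
  from rho_psym [OF this ab]
  show "rho (lin psym (word w)) (b, 0, 0) = star \<alpha> \<beta> (toR (word w)) b" by simp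
qed

lemma star_1: "star \<alpha> \<beta> a 1 = (a, 0, 0)"
proof -
  have "ad i 1 = 0" for i by (simp add: ad_def)
  then show ?thesis
    by (simp add: star_def M1_def M2_def clinear_0 [OF clinear_ad] clinear_0 [OF clinear_pd])
qed

section \<open>Recovering coefficients from the action on 1\<close>

definition phiH :: "(nat \<Rightarrow> (nat list \<Rightarrow>\<^sub>0 complex)) \<Rightarrow> nat \<Rightarrow> (nat option list \<Rightarrow>\<^sub>0 complex)" where
  "phiH P N = (\<Sum>k<N. word [None] ^ k * lin psym (P k))"

lemma phi_hbar_lookup: "phi_hbar (\<lambda>k. Poly_Mapping.lookup (P k)) N = Poly_Mapping.lookup (phiH P N)"
proof -
  have "word (replicate k (None :: nat option)) = word [None] ^ k" for k
  proof (induction k)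
    case (Suc k)
    then show ?case by (simp add: word_Cons [of _ "replicate k None"])
  qed simp
  then show ?thesis
    by (simp add: phi_hbar_def phiH_def hpow_def phi_lookup fa_lookup)
qed

text \<open>Every index from 2 on reads the last component, so the value is a coefficient of the
  series only for \<open>k < 3\<close>.\<close>

fun comp3 :: "nat \<Rightarrow> cpoly \<times> cpoly \<times> cpoly \<Rightarrow> cpoly" where
  "comp3 k (f0, f1, f2) = (if k = 0 then f0 else if k = 1 then f1 else f2)"

lemma clinear_comp3: "clinear (comp3 k)"
  by (rule clinearI) (auto simp: scaleC_prod_def)

lemma comp3_hbar_power: "k < 3 \<Longrightarrow> comp3 k ((hbar_op ^^ j) (a, 0, 0)) = (if k = j then a else 0)"
proof -
  assume k: "k < 3"
  have "(hbar_op ^^ j) (a, 0, 0) = (if j = 0 then (a, 0, 0) else if j = 1 then (0, a, 0)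
      else if j = 2 then (0, 0, a) else (0, 0, 0))"
    by (induction j) (auto simp: hbar_op_def)
  with k show ?thesis by auto
qed

text \<open>Each symmetrised summand sends 1 to its own polynomial, and the powers of hbar shift it
  into place. Acting on 1 thus reads off the coefficients of any preimage under
  symmetrisation.\<close>

lemma comp3_rho_phiH:
  assumes P: "\<And>k. Poly_Mapping.keys (P k) \<subseteq> lists {..<n}" "\<And>k. k \<ge> N \<Longrightarrow> P k = 0" and k: "k < 3"
  shows "comp3 k (rho (phiH P N) (1, 0, 0)) = toR (P k)"
proof -
  have h: "rho (word [None]) = hbar_op"
    by (rule ext) (simp add: rho_word ustep_def)
  \<comment> \<open>The parameters 0 and 1/2 are one admissible pair; with second factor 1,
    \<open>star_1\<close> makes the result the same for every pair.\<close>
  have "rho (lin psym (P j)) (1, 0, 0) = (toR (P j), 0, 0)" for j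
    using rho_phi [OF P(1), of 0 "1/2" j 1] by (simp add: star_1)
  then have "comp3 k (rho (phiH P N) (1, 0, 0)) = (\<Sum>j<N. if k = j then toR (P j) else 0)"
    using k by (simp add: phiH_def clinear_sum [OF clinear_rho_left] clinear_sum [OF clinear_comp3]
        rho_mult rho_power h comp3_hbar_power)
  also have "\<dots> = toR (P k)"
    using P(2) [of k] by (simp add: clinear_0 [OF clinear_toR] not_less)
  finally show ?thesis .
qed

subsection \<open>Surjectivity of the symmetrisation map\<close>

text \<open>The elements for which the choice in \<open>phi_inv\<close> has a witness.\<close>

definition symmetrised :: "(nat option list \<Rightarrow>\<^sub>0 complex) set" where
  "symmetrised = {u. \<exists>P N. (\<forall>k. Poly_Mapping.keys (P k) \<subseteq> lists {..<n}) \<and> (\<forall>k\<ge>N. P k = 0) \<and>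
      phiH P N - u \<in> fideal (U_rel n c)}"

lemma phiH_extend:
  assumes "\<And>k. k \<ge> N \<Longrightarrow> P k = 0" "N \<le> N'"
  shows "phiH P N' = phiH P N"
  unfolding phiH_def
  by (rule sum.mono_neutral_right) (use assms in \<open>auto simp: clinear_0 [OF clinear_lin]\<close>)

lemma symmetrised_cong:
  assumes "u \<in> symmetrised" "u - v \<in> fideal (U_rel n c)"
  shows "v \<in> symmetrised"
proof -
  have "phiH P N - u + (u - v) = phiH P N - v" for P N by simp
  then show ?thesis
    using assms unfolding symmetrised_def by (smt (verit) fideal_add mem_Collect_eq)
qed

lemma symmetrised_add:
  assumes "u \<in> symmetrised" "v \<in> symmetrised"
  shows "u + v \<in> symmetrised"
proof -
  from assms obtain P N P' N' where
    P: "\<And>k. Poly_Mapping.keys (P k) \<subseteq> lists {..<n}" "\<And>k. k \<ge> N \<Longrightarrow> P k = 0" "phiH P N - u \<in> fideal (U_rel n c)" and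
    P': "\<And>k. Poly_Mapping.keys (P' k) \<subseteq> lists {..<n}" "\<And>k. k \<ge> N' \<Longrightarrow> P' k = 0" "phiH P' N' - v \<in> fideal (U_rel n c)"
    unfolding symmetrised_def by blast
  let ?N = "max N N'"
  have "phiH (\<lambda>k. P k + P' k) ?N = phiH P ?N + phiH P' ?N"
    by (simp add: phiH_def clinear_add [OF clinear_lin] distrib_left sum.distrib)
  also have "\<dots> = phiH P N + phiH P' N'"
    using phiH_extend [of N P ?N] phiH_extend [of N' P' ?N] P(2) P'(2) by simp
  finally have "phiH (\<lambda>k. P k + P' k) ?N - (u + v) = (phiH P N - u) + (phiH P' N' - v)"
    by simp
  then have "phiH (\<lambda>k. P k + P' k) ?N - (u + v) \<in> fideal (U_rel n c)"
    using fideal_add [OF P(3) P'(3)] by (simp only:)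
  moreover have "Poly_Mapping.keys (P k + P' k) \<subseteq> lists {..<n}" for k
    using P(1) [of k] P'(1) [of k] Poly_Mapping.keys_add [of "P k" "P' k"] by blast
  ultimately show ?thesis
    unfolding symmetrised_def using P(2) P'(2)
    by (intro CollectI exI [of _ "\<lambda>k. P k + P' k"] exI [of _ ?N]) auto
qed

lemma symmetrised_scale:
  assumes "u \<in> symmetrised"
  shows "a *\<^sub>C u \<in> symmetrised"
proof -
  from assms obtain P N where
    P: "\<And>k. Poly_Mapping.keys (P k) \<subseteq> lists {..<n}" "\<And>k. k \<ge> N \<Longrightarrow> P k = 0" "phiH P N - u \<in> fideal (U_rel n c)"
    unfolding symmetrised_def by blast
  have "phiH (\<lambda>k. a *\<^sub>C P k) N - a *\<^sub>C u = a *\<^sub>C (phiH P N - u)"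
    by (simp add: phiH_def clinear_scale [OF clinear_lin] scaleC_diff_right scaleC_sum_right)
  then have "phiH (\<lambda>k. a *\<^sub>C P k) N - a *\<^sub>C u \<in> fideal (U_rel n c)"
    using fideal_scale [OF P(3)] by simp
  moreover have "Poly_Mapping.keys (a *\<^sub>C P k) \<subseteq> lists {..<n}" for k
  proof -
    have "Poly_Mapping.keys (a *\<^sub>C P k) \<subseteq> Poly_Mapping.keys (P k)"
      by (auto simp: in_keys_iff)
    then show ?thesis using P(1) [of k] by blast
  qed
  ultimately show ?thesis
    unfolding symmetrised_def using P(2)
    by (intro CollectI exI [of _ "\<lambda>k. a *\<^sub>C P k"] exI [of _ N]) auto
qed

lemma symmetrised_hbar:
  assumes "u \<in> symmetrised"
  shows "word [None] * u \<in> symmetrised"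
proof -
  from assms obtain P N where
    P: "\<And>k. Poly_Mapping.keys (P k) \<subseteq> lists {..<n}" "\<And>k. k \<ge> N \<Longrightarrow> P k = 0" "phiH P N - u \<in> fideal (U_rel n c)"
    unfolding symmetrised_def by blast
  define P' where "P' k = (case k of 0 \<Rightarrow> 0 | Suc k \<Rightarrow> P k)" for k
  have "phiH P' (Suc N) = word [None] * phiH P N"
    unfolding phiH_def sum.lessThan_Suc_shift
    by (simp add: P'_def clinear_0 [OF clinear_lin] sum_distrib_left mult.assoc)
  then have "phiH P' (Suc N) - word [None] * u \<in> fideal (U_rel n c)"
    using fideal_mult_left [OF P(3)] by (simp add: right_diff_distrib)
  moreover have "Poly_Mapping.keys (P' k) \<subseteq> lists {..<n}" for k
    using P(1) by (auto simp: P'_def split: nat.split)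
  moreover have "P' k = 0" if "k \<ge> Suc N" for k
    using that P(2) by (auto simp: P'_def split: nat.split)
  ultimately show ?thesis
    unfolding symmetrised_def by (intro CollectI exI [of _ P'] exI [of _ "Suc N"]) auto
qed

lemma symmetrised_psym:
  assumes "set w \<subseteq> {..<n}"
  shows "psym w \<in> symmetrised"
  unfolding symmetrised_def
  by (intro CollectI exI [of _ "\<lambda>k. if k = 0 then word w else 0"] exI [of _ 1])
    (use assms in \<open>auto simp: phiH_def\<close>)

lemma symmetrised_sum: "(\<And>i. i \<in> A \<Longrightarrow> f i \<in> symmetrised) \<Longrightarrow> sum f A \<in> symmetrised"
proof (induction A rule: infinite_finite_induct)
  case (insert x A)
  then show ?case by (simp add: symmetrised_add)
qed (use symmetrised_scale [OF symmetrised_psym [of "[]"], of 0] in auto)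

text \<open>Rewriting inside a word leaves hbar in the middle, while \<open>phiH\<close> has its
  powers in front. In \<open>U_rel\<close> only letters below \<open>n\<close> commute with hbar,
  hence the bound.\<close>

lemma hbar_central:
  "set us \<subseteq> {..<n} \<Longrightarrow> word (map Some us) * word [None] - word [None] * word (map Some us) \<in> fideal (U_rel n c)"
proof (induction us)
  case (Cons i us)
  have "word [None] * word [Some i] - word [Some i] * word [None] \<in> fideal (U_rel n c)"
    using Cons.prems by (intro fideal_base) (auto simp: U_rel_lookup)
  moreover have "word (map Some us) * word [None] - word [None] * word (map Some us) \<in> fideal (U_rel n c)"
    using Cons by simp
  ultimately have "word [Some i] * (word (map Some us) * word [None] - word [None] * word (map Some us)) -
      (word [None] * word [Some i] - word [Some i] * word [None]) * word (map Some us) \<in> fideal (U_rel n c)"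
    by (blast intro: fideal_closed)
  then show ?case
    by (simp add: word_Cons [of _ "map Some us"] algebra_simps)
qed simp

text \<open>Swapping neighbours changes a word by hbar times words with one letter fewer, which
  induction covers. So all rearrangements of \<open>w\<close> agree modulo
  \<open>symmetrised\<close>, and their average is \<open>psym w\<close>.\<close>

lemma word_symmetrised: "set w \<subseteq> {..<n} \<Longrightarrow> word (map Some w) \<in> symmetrised"
proof (induction w rule: length_induct)
  case (1 w)
  \<comment> \<open>The guard on the length restricts the relation to words as long as
    \<open>w\<close>, for whose bracket terms the induction hypothesis is available.\<close>
  define r where "r u v \<longleftrightarrow> length u = length v \<and>
    (length u = length w \<longrightarrow> word (map Some u) - word (map Some v) \<in> symmetrised)" for u v :: "nat list"
  have "r w v" if "mset w = mset v" for v
  proof (rule perm_closed_under_swaps [where A = "{..<n}" and r = r])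
    show "r xs xs" for xs
      using symmetrised_sum [of "{}"] by (simp add: r_def)
    show "r ys xs" if "r xs ys" for xs ys
      using that symmetrised_scale [of "word (map Some xs) - word (map Some ys)" "- 1"] by (auto simp: r_def)
    show "r xs zs" if "r xs ys" "r ys zs" for xs ys zs
      using that symmetrised_add [of "word (map Some xs) - word (map Some ys)" "word (map Some ys) - word (map Some zs)"]
      by (auto simp: r_def)
    show "r (us @ i # j # vs) (us @ j # i # vs)" if le: "set (us @ i # j # vs) \<subseteq> {..<n}" for us i j vs
    proof -
      let ?U = "word (map Some us)" and ?V = "word (map Some vs)"
      let ?S = "\<Sum>k<n. c i j k *\<^sub>C word [Some k]"
      have "word [None] * (?U * ?S * ?V) \<in> symmetrised" if len: "length (us @ i # j # vs) = length w"
      proof -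
        have "?U * ?S * ?V = (\<Sum>k<n. c i j k *\<^sub>C word (map Some (us @ k # vs)))"
          by (simp add: sum_distrib_left sum_distrib_right word_append word_Cons [of _ "map Some vs"] mult.assoc)
        also have "\<dots> \<in> symmetrised"
        proof (intro symmetrised_sum symmetrised_scale)
          fix k assume "k \<in> {..<n}"
          with le len show "word (map Some (us @ k # vs)) \<in> symmetrised"
            by (intro 1(1) [rule_format]) auto
        qed
        finally show ?thesis by (rule symmetrised_hbar)
      qed
      moreover have "word [None] * (?U * ?S * ?V) - (word (map Some (us @ i # j # vs)) - word (map Some (us @ j # i # vs)))
          \<in> fideal (U_rel n c)"
      proof -
        have "word [Some i] * word [Some j] - word [Some j] * word [Some i] - word [None] * ?S \<in> fideal (U_rel n c)"
          using le by (intro fideal_base) (auto simp: U_rel_lookup)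
        moreover have "?U * word [None] - word [None] * ?U \<in> fideal (U_rel n c)"
          using le by (intro hbar_central) auto
        \<comment> \<open>The first term replaces the commutator by hbar times the bracket in place;
          the second carries hbar to the front.\<close>
        ultimately have "- (?U * (word [Some i] * word [Some j] - word [Some j] * word [Some i] - word [None] * ?S) * ?V) -
           (?U * word [None] - word [None] * ?U) * (?S * ?V) \<in> fideal (U_rel n c)"
          by (blast intro: fideal_closed)
        moreover have "- (?U * (word [Some i] * word [Some j] - word [Some j] * word [Some i] - word [None] * ?S) * ?V) -
           (?U * word [None] - word [None] * ?U) * (?S * ?V) =
           word [None] * (?U * ?S * ?V) - (word (map Some (us @ i # j # vs)) - word (map Some (us @ j # i # vs)))"
        proof -
          have w: "word (map Some (us @ i # j # vs)) = ?U * (word [Some i] * (word [Some j] * ?V))" for i j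
            by (simp add: word_append word_Cons [of _ "Some j # map Some vs"] word_Cons [of _ "map Some vs"])
          show ?thesis unfolding w by (simp only: algebra_simps minus_diff_eq)
        qed
        ultimately show ?thesis by simp
      qed
      ultimately show ?thesis
        unfolding r_def using symmetrised_cong by auto
    qed
  qed (use that 1(2) in auto)
  then have diff: "word (map Some w) - word (map Some v) \<in> symmetrised" if "mset w = mset v" for v
    using that by (simp add: r_def)
  let ?p = "{\<sigma>. \<sigma> permutes {..<length w}}"
  have card: "card ?p = fact (length w)"
    by (simp add: card_permutations)
  have "(\<Sum>\<sigma>\<in>?p. word (map Some w) - word (map (\<lambda>i. Some (w ! \<sigma> i)) [0..<length w])) \<in> symmetrised"
  proof (rule symmetrised_sum)
    fix \<sigma> assume "\<sigma> \<in> ?p"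
    then have "mset w = mset (map (\<lambda>i. w ! \<sigma> i) [0..<length w])"
      using mset_permute_list [of \<sigma> w] by (simp add: permute_list_def)
    from diff [OF this] show "word (map Some w) - word (map (\<lambda>i. Some (w ! \<sigma> i)) [0..<length w]) \<in> symmetrised"
      by (simp add: comp_def)
  qed
  \<comment> \<open>\<open>word (map Some w)\<close> is \<open>psym w\<close> plus the average of
    its differences from all rearrangements.\<close>
  then have "psym w + (1 / of_nat (fact (length w))) *\<^sub>C
      (\<Sum>\<sigma>\<in>?p. word (map Some w) - word (map (\<lambda>i. Some (w ! \<sigma> i)) [0..<length w])) \<in> symmetrised"
    using 1(2) by (intro symmetrised_add symmetrised_scale symmetrised_psym)
  moreover have "(\<Sum>\<sigma>\<in>?p. word (map Some w)) = of_nat (fact (length w)) *\<^sub>C word (map Some w)"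
    by (simp only: sum_constant card scaleC_of_nat)
  ultimately show ?case
    by (simp add: psym_def sum_subtractf scaleC_diff_right)
qed

lemma phi_product_symmetrised:
  assumes "Poly_Mapping.keys a \<subseteq> lists {..<n}" "Poly_Mapping.keys b \<subseteq> lists {..<n}"
  shows "lin psym a * lin psym b \<in> symmetrised"
proof -
  have prod: "psym v * psym w \<in> symmetrised" if "set v \<subseteq> {..<n}" "set w \<subseteq> {..<n}" for v w
  proof -
    have mem: "set (map (\<lambda>i. w ! \<sigma> i) [0..<length w]) \<subseteq> {..<n}"
      if "\<sigma> permutes {..<length w}" "set w \<subseteq> {..<n}" for \<sigma> w
      using that mset_permute_list [of \<sigma> w] unfolding permute_list_def by (metis set_mset_mset)
    have "word (map (\<lambda>i. Some (v ! \<sigma> i)) [0..<length v]) * word (map (\<lambda>i. Some (w ! \<tau> i)) [0..<length w]) \<in> symmetrised"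
      if "\<sigma> permutes {..<length v}" "\<tau> permutes {..<length w}" for \<sigma> \<tau>
      using word_symmetrised [of "map (\<lambda>i. v ! \<sigma> i) [0..<length v] @ map (\<lambda>i. w ! \<tau> i) [0..<length w]"]
        mem [OF that(1)] mem [OF that(2)] \<open>set v \<subseteq> _\<close> \<open>set w \<subseteq> _\<close>
      by (simp add: comp_def flip: word_append)
    then show ?thesis
      unfolding psym_def mult_scaleC_left mult_scaleC_right sum_product
      by (intro symmetrised_scale symmetrised_sum) auto
  qed
  have "psym v * psym w \<in> symmetrised" if "v \<in> Poly_Mapping.keys a" "w \<in> Poly_Mapping.keys b" for v w
  proof (rule prod)
    show "set v \<subseteq> {..<n}" using that(1) assms(1) by auto
    show "set w \<subseteq> {..<n}" using that(2) assms(2) by auto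
  qed
  then show ?thesis
    unfolding lin_def sum_product mult_scaleC_left mult_scaleC_right
    by (intro symmetrised_sum symmetrised_scale) auto
qed

section \<open>The inverse of symmetrisation and congruence in S(g)\<close>

lemma S_elem_lookup: "S_elem n (Poly_Mapping.lookup p) \<longleftrightarrow> Poly_Mapping.keys p \<subseteq> lists {..<n}"
  by (auto simp: S_elem_def in_keys_iff lists_eq_set)

text \<open>Surjectivity shows that the choice meets its specification. Letting both sides of the
  resulting congruence act on 1 yields the coefficients on one side and, on the other,
  \<open>phi a\<close> acting on \<open>b\<close>, which is \<open>star\<close>.\<close>

lemma phi_inv_star:
  assumes "Poly_Mapping.keys a \<subseteq> lists {..<n}" "Poly_Mapping.keys b \<subseteq> lists {..<n}"
    and ab: "\<alpha> - \<beta> = - 1/2" and "k < 3"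
  obtains q where "phi_inv n c (fa_mul (phi (Poly_Mapping.lookup a)) (phi (Poly_Mapping.lookup b))) k = Poly_Mapping.lookup q"
    "Poly_Mapping.keys q \<subseteq> lists {..<n}" "toR q = comp3 k (star \<alpha> \<beta> (toR a) (toR b))"
proof -
  let ?u = "lin psym a * lin psym b"
  have u: "fa_mul (phi (Poly_Mapping.lookup a)) (phi (Poly_Mapping.lookup b)) = Poly_Mapping.lookup ?u"
    by (simp add: phi_lookup fa_mul_lookup)
  define good where "good P \<longleftrightarrow> (\<forall>k. S_elem n (P k)) \<and>
      (\<exists>N. (\<forall>k\<ge>N. P k = fa_zero) \<and> fa_cong (U_rel n c) (phi_hbar P N) (Poly_Mapping.lookup ?u))" for P
  from phi_product_symmetrised [OF assms(1,2)] obtain P N where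
    P: "\<And>k. Poly_Mapping.keys (P k) \<subseteq> lists {..<n}" "\<And>k. k \<ge> N \<Longrightarrow> P k = 0" "phiH P N - ?u \<in> fideal (U_rel n c)"
    unfolding symmetrised_def by blast
  have "good (\<lambda>k. Poly_Mapping.lookup (P k))"
    unfolding good_def phi_hbar_lookup fa_cong_lookup
    by (intro conjI exI [of _ N]) (use P in \<open>auto simp: S_elem_lookup fa_zero_def\<close>)
  then have "good (phi_inv n c (Poly_Mapping.lookup ?u))"
    unfolding phi_inv_def good_def [abs_def, symmetric] by (rule someI [of good])
  then obtain N' where S: "S_elem n (phi_inv n c (Poly_Mapping.lookup ?u) k)"
    and Z: "\<And>k. k \<ge> N' \<Longrightarrow> phi_inv n c (Poly_Mapping.lookup ?u) k = fa_zero"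
    and C: "fa_cong (U_rel n c) (phi_hbar (phi_inv n c (Poly_Mapping.lookup ?u)) N') (Poly_Mapping.lookup ?u)" for k
    unfolding good_def by blast
  have "\<exists>Q. \<forall>k. phi_inv n c (Poly_Mapping.lookup ?u) k = Poly_Mapping.lookup (Q k)"
    by (intro choice allI) (use S in \<open>metis S_elem_def fa_fin_obtain\<close>)
  then obtain Q where Q: "phi_inv n c (Poly_Mapping.lookup ?u) = (\<lambda>k. Poly_Mapping.lookup (Q k))"
    by blast
  have keys: "Poly_Mapping.keys (Q k) \<subseteq> lists {..<n}" for k
    using S [of k] by (simp add: Q S_elem_lookup)
  have "Q k = 0" if "k \<ge> N'" for k
    using fun_cong [OF Q, of k] Z [OF that] unfolding fa_zero_lookup poly_mapping_eq_iff by metis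
  then have "toR (Q k) = comp3 k (rho (phiH Q N') (1, 0, 0))"
    using comp3_rho_phiH [OF keys _ \<open>k < 3\<close>, of N'] by simp
  also have "rho (phiH Q N' - ?u) (1, 0, 0) = 0"
    using C by (intro rho_ideal) (simp add: Q phi_hbar_lookup fa_cong_lookup)
  then have "rho (phiH Q N') (1, 0, 0) = rho ?u (1, 0, 0)"
    by (simp add: clinear_diff [OF clinear_rho_left])
  also have "rho ?u (1, 0, 0) = star \<alpha> \<beta> (toR a) (toR b)"
    by (simp add: rho_mult rho_phi [OF assms(1) ab] rho_phi [OF assms(2) ab] star_1)
  finally show thesis
    using that [of "Q k"] keys by (simp add: u Q)
qed

text \<open>Each word is congruent to its sorted version, which depends only on the multiset of
  letters and so factors through \<open>toR\<close>.\<close>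

lemma S_cong:
  assumes "Poly_Mapping.keys p \<subseteq> lists {..<n}" "Poly_Mapping.keys q \<subseteq> lists {..<n}" "toR p = toR q"
  shows "fa_cong (S_rel n) (Poly_Mapping.lookup p) (Poly_Mapping.lookup q)"
proof -
  let ?I = "fideal (S_rel n)"
  let ?s = "\<lambda>w :: nat list. sorted_list_of_multiset (mset w)"
  have "word us - word vs \<in> ?I" if "mset us = mset vs" "set us \<subseteq> {..<n}" for us vs
  proof (rule perm_closed_under_swaps [where A = "{..<n}" and r = "\<lambda>us vs. word us - word vs \<in> ?I"])
    show "word ys - word xs \<in> ?I" if "word xs - word ys \<in> ?I" for xs ys
      using fideal_uminus [OF that] by simp
    show "word xs - word zs \<in> ?I" if "word xs - word ys \<in> ?I" "word ys - word zs \<in> ?I" for xs ys zs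
      using fideal_add [OF that] by simp
    show "word (us @ i # j # vs) - word (us @ j # i # vs) \<in> ?I" if "set (us @ i # j # vs) \<subseteq> {..<n}" for us i j vs
    proof -
      have "word [i] * word [j] - word [j] * word [i] \<in> ?I"
        using that by (intro fideal_base) (auto simp: S_rel_def fa_lookup)
      then have "word us * (word [i] * word [j] - word [j] * word [i]) * word vs \<in> ?I"
        by (rule fideal_mult)
      moreover have w: "word (us @ i # j # vs) = word us * (word [i] * (word [j] * word vs))" for i j
        by (simp add: word_append word_Cons [of _ "j # vs"] word_Cons [of _ vs])
      ultimately show ?thesis unfolding w by (simp only: algebra_simps)
    qed
  qed (use that in auto)
  then have sort: "word w - word (?s w) \<in> ?I" if "set w \<subseteq> {..<n}" for w
    using that by simp
  have "p - lin (\<lambda>w. word (?s w)) p \<in> ?I" if "Poly_Mapping.keys p \<subseteq> lists {..<n}" for p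
  proof -
    have "p - lin (\<lambda>w. word (?s w)) p = (\<Sum>w\<in>Poly_Mapping.keys p. Poly_Mapping.lookup p w *\<^sub>C (word w - word (?s w)))"
      by (subst (1) poly_mapping_expand [of p]) (simp add: lin_def scaleC_diff_right sum_subtractf)
    also have "\<dots> \<in> ?I"
      using that by (intro fideal_sum fideal_scale sort) auto
    finally show ?thesis .
  qed
  from fideal_diff [OF this [OF assms(1)] this [OF assms(2)]]
  have "(p - q) - (lin (\<lambda>w. word (?s w)) p - lin (\<lambda>w. word (?s w)) q) \<in> ?I"
    by (simp add: algebra_simps)
  moreover have "lin (\<lambda>w. word (?s w)) p = lin (\<lambda>M. word (sorted_list_of_multiset M)) (toR p)" for p
    by (rule clinear_eqI [where p = p]) (auto intro!: clin clinear_compose [OF clinear_lin])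
  ultimately show ?thesis
    by (simp add: fa_cong_lookup assms(3))
qed

end

section \<open>The action of H \<otimes> H\<close>

lemma keys_lists_sum:
  "(\<And>i. i \<in> I \<Longrightarrow> Poly_Mapping.keys (f i) \<subseteq> lists A) \<Longrightarrow> Poly_Mapping.keys (sum f I) \<subseteq> lists A"
  using Poly_Mapping.keys_sum [of f I] by blast

lemma keys_lists_scale:
  fixes p :: "'a list \<Rightarrow>\<^sub>0 complex"
  shows "Poly_Mapping.keys p \<subseteq> lists A \<Longrightarrow> Poly_Mapping.keys (a *\<^sub>C p) \<subseteq> lists A"
proof -
  have "Poly_Mapping.keys (a *\<^sub>C p) \<subseteq> Poly_Mapping.keys p"
    by (auto simp: in_keys_iff)
  then show "Poly_Mapping.keys p \<subseteq> lists A \<Longrightarrow> ?thesis" by blast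
qed

lemma keys_lists_mult:
  fixes p q :: "'a list \<Rightarrow>\<^sub>0 complex"
  assumes "Poly_Mapping.keys p \<subseteq> lists A" "Poly_Mapping.keys q \<subseteq> lists A"
  shows "Poly_Mapping.keys (p * q) \<subseteq> lists A"
proof
  fix w assume "w \<in> Poly_Mapping.keys (p * q)"
  then obtain u v where "w = u @ v" "u \<in> Poly_Mapping.keys p" "v \<in> Poly_Mapping.keys q"
    using Poly_Mapping.keys_mult [of p q] by (auto simp: plus_list_def)
  with assms show "w \<in> lists A" by auto
qed

lemma keys_lists_lin:
  fixes f :: "'k \<Rightarrow> ('a list \<Rightarrow>\<^sub>0 complex)"
  shows "(\<And>k. k \<in> Poly_Mapping.keys p \<Longrightarrow> Poly_Mapping.keys (f k) \<subseteq> lists A) \<Longrightarrow> Poly_Mapping.keys (lin f p) \<subseteq> lists A"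
  unfolding lin_def by (intro keys_lists_sum keys_lists_scale)

definition side :: "bool \<Rightarrow> (bool \<times> 'a) list \<Rightarrow> 'a list" where
  "side s w = map snd (filter (\<lambda>x. fst x = s) w)"

definition side_monomial :: "bool \<Rightarrow> (bool \<times> nat) list \<Rightarrow> cpoly" where
  "side_monomial s w = Poly_Mapping.single (mset (side s w)) 1"

lemma side_monomial_append: "side_monomial s (v @ w) = side_monomial s v * side_monomial s w"
  by (simp add: side_monomial_def side_def mult_single)

lemma side_monomial_Nil [simp]: "side_monomial s [] = 1"
  by (simp add: side_monomial_def side_def)

lemma side_monomial_Cons: "side_monomial s (x # w) = (if fst x = s then X (snd x) else 1) * side_monomial s w"
  by (simp add: side_monomial_def side_def X_def mult_single)

text \<open>
  Evaluating with operators \<open>P\<close> and \<open>Q\<close> on the two tensor factors lets an action on words be moved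
  into \<open>P\<close> and \<open>Q\<close>, so that no model of \<open>S(g) \<otimes> S(g)\<close> is needed.
\<close>

definition beta :: "(cpoly \<Rightarrow> cpoly) \<Rightarrow> (cpoly \<Rightarrow> cpoly) \<Rightarrow> ((bool \<times> nat) list \<Rightarrow>\<^sub>0 complex) \<Rightarrow> cpoly" where
  "beta P Q = lin (\<lambda>w. P (side_monomial False w) * Q (side_monomial True w))"

lemma clinear_beta [clin]: "clinear (beta P Q)"
  unfolding beta_def by (rule clinear_lin)

lemma beta_word: "beta P Q (word w) = P (side_monomial False w) * Q (side_monomial True w)"
  by (simp add: beta_def)

lemma beta_word_mult:
  "beta P Q (word v * m) = beta (\<lambda>f. P (side_monomial False v * f)) (\<lambda>f. Q (side_monomial True v * f)) m"
  by (rule clinear_eqI [where p = m])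
    (auto intro!: clin clinear_compose [OF clinear_beta] simp: beta_word side_monomial_append simp flip: word_append)

lemma beta_mult_word:
  "beta P Q (m * word v) = beta (\<lambda>f. P (f * side_monomial False v)) (\<lambda>f. Q (f * side_monomial True v)) m"
  by (rule clinear_eqI [where p = m])
    (auto intro!: clin clinear_compose [OF clinear_beta] simp: beta_word side_monomial_append simp flip: word_append)

definition pmu :: "((bool \<times> nat) list \<Rightarrow>\<^sub>0 complex) \<Rightarrow> (nat list \<Rightarrow>\<^sub>0 complex)" where
  "pmu = lin (\<lambda>v. word (map snd v))"

lemma mu_lookup: "mu (Poly_Mapping.lookup m) = Poly_Mapping.lookup (pmu m)"
  by (simp add: mu_def fa_map_def pmu_def fa_lookup)

lemma toR_pmu: "toR (pmu m) = beta (\<lambda>f. f) (\<lambda>f. f) m"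
proof (rule clinear_eqI [where p = m])
  show "clinear (\<lambda>m. toR (pmu m))" "clinear (beta (\<lambda>f. f) (\<lambda>f. f))"
    unfolding pmu_def by (intro clinear_compose [OF clinear_toR] clin)+
  fix w :: "(bool \<times> nat) list"
  have "mset (map snd w) = mset (side False w) + mset (side True w)"
    by (induction w) (auto simp: side_def)
  then show "toR (pmu (word w)) = beta (\<lambda>f. f) (\<lambda>f. f) (word w)"
    by (simp add: pmu_def beta_word side_monomial_def mult_single)
qed

definition ptens :: "(nat list \<Rightarrow>\<^sub>0 complex) \<Rightarrow> (nat list \<Rightarrow>\<^sub>0 complex) \<Rightarrow> ((bool \<times> nat) list \<Rightarrow>\<^sub>0 complex)" where
  "ptens a b = lin (\<lambda>v. word (map (Pair False) v)) a * lin (\<lambda>v. word (map (Pair True) v)) b"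

lemma tens_lookup: "tens (Poly_Mapping.lookup a) (Poly_Mapping.lookup b) = Poly_Mapping.lookup (ptens a b)"
  by (simp add: tens_def fa_map_def ptens_def fa_lookup)

lemma beta_ptens:
  assumes P: "clinear P" and Q: "clinear Q"
  shows "beta P Q (ptens a b) = P (toR a) * Q (toR b)"
proof (rule clinear_eqI [where p = a])
  show "clinear (\<lambda>a. beta P Q (ptens a b))" "clinear (\<lambda>a. P (toR a) * Q (toR b))"
    unfolding ptens_def by (intro clin clinear_compose [OF clinear_beta] clinear_compose [OF P])+
  fix v
  show "beta P Q (ptens (word v) b) = P (toR (word v)) * Q (toR b)"
  proof (rule clinear_eqI [where p = b])
    show "clinear (\<lambda>b. beta P Q (ptens (word v) b))" "clinear (\<lambda>b. P (toR (word v)) * Q (toR b))"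
      unfolding ptens_def by (intro clin clinear_compose [OF clinear_beta] clinear_compose [OF Q])+
    fix w
    have "side s (map (Pair s') v) = (if s = s' then v else [])" for s s' :: bool and v :: "nat list"
      by (induction v) (auto simp: side_def)
    then have "side_monomial s (map (Pair s') v) = (if s = s' then Poly_Mapping.single (mset v) 1 else 1)" for s s' v
      by (simp add: side_monomial_def)
    then show "beta P Q (ptens (word v) (word w)) = P (toR (word v)) * Q (toR (word w))"
      by (simp add: ptens_def beta_word side_monomial_append flip: word_append)
  qed
qed

context lie
begin

section \<open>The action of H \<otimes> H on pairs of polynomials\<close>

fun dstep :: "gen \<Rightarrow> cpoly \<Rightarrow> cpoly" where
  "dstep (E i) = ad i"
| "dstep (D i) = pd i"

definition dside :: "bool \<Rightarrow> bool \<times> gen \<Rightarrow> cpoly \<Rightarrow> cpoly" where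
  "dside s g = (if fst g = s then dstep (snd g) else (\<lambda>f. f))"

definition dact :: "bool \<Rightarrow> (bool \<times> gen) list \<Rightarrow> cpoly \<Rightarrow> cpoly" where
  "dact s u = foldr (dside s) u"

lemma clinear_dstep: "clinear (dstep g)"
  by (cases g) (auto intro: clin)

lemma dstep_mult: "dstep g (f * h) = dstep g f * h + f * dstep g h"
  by (cases g) (auto simp: ad_mult pd_mult)

lemma clinear_dside: "clinear (dside s g)"
  by (simp add: dside_def clinear_dstep clinear_ident)

lemma dact_Nil [simp]: "dact s [] f = f"
  by (simp add: dact_def)

lemma dact_Cons [simp]: "dact s (g # u) f = dside s g (dact s u f)"
  by (simp add: dact_def)

lemma dact_append: "dact s (u @ v) f = dact s u (dact s v f)"
  by (simp add: dact_def)

lemma clinear_dact: "clinear (dact s u)"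
proof (induction u)
  case (Cons g u)
  from clinear_compose [OF clinear_dside Cons] show ?case by (simp add: dact_def comp_def)
qed (simp add: dact_def id_def clinear_ident)

text \<open>This is \<mu> \<circ> (P \<otimes> Q) applied to the action of \<open>Z\<close> on a
  \<otimes> b. Left factors of \<open>Z\<close> pass into \<open>P\<close> and \<open>Q\<close>,
  right factors into \<open>a\<close> and \<open>b\<close>.\<close>

definition bd :: "(cpoly \<Rightarrow> cpoly) \<Rightarrow> (cpoly \<Rightarrow> cpoly) \<Rightarrow> ((bool \<times> gen) list \<Rightarrow>\<^sub>0 complex) \<Rightarrow> cpoly \<Rightarrow> cpoly \<Rightarrow> cpoly" where
  "bd P Q Z a b = lin (\<lambda>u. P (dact False u a) * Q (dact True u b)) Z"

lemma clinear_bd [clin]: "clinear (\<lambda>Z. bd P Q Z a b)"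
  unfolding bd_def by (rule clinear_lin)

lemma bd_word: "bd P Q (word u) a b = P (dact False u a) * Q (dact True u b)"
  by (simp add: bd_def)

lemma bd_mult_word: "bd P Q (Z * word v) a b = bd P Q Z (dact False v a) (dact True v b)"
  by (rule clinear_eqI [where p = Z])
    (auto intro!: clin clinear_compose [OF clinear_bd] simp: bd_word dact_append simp flip: word_append)

lemma bd_word_mult: "bd P Q (word u * Z) a b = bd (\<lambda>f. P (dact False u f)) (\<lambda>f. Q (dact True u f)) Z a b"
  by (rule clinear_eqI [where p = Z])
    (auto intro!: clin clinear_compose [OF clinear_bd] simp: bd_word dact_append simp flip: word_append)

lemma HH_rel_lookup:
  "Poly_Mapping.lookup r \<in> HH_rel n c \<longleftrightarrow>
    (\<exists>s. \<exists>i<n. \<exists>j<n. r = word [(s, E i)] * word [(s, E j)] - word [(s, E j)] * word [(s, E i)] -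
        (\<Sum>k<n. c i j k *\<^sub>C word [(s, E k)])) \<or>
    (\<exists>s. \<exists>i<n. \<exists>j<n. r = word [(s, E i)] * word [(s, D j)] - word [(s, D j)] * word [(s, E i)] +
        (\<Sum>k<n. c i k j *\<^sub>C word [(s, D k)])) \<or>
    (\<exists>s. \<exists>i<n. \<exists>j<n. r = word [(s, D i)] * word [(s, D j)] - word [(s, D j)] * word [(s, D i)]) \<or>
    (\<exists>x y. gen_idx x < n \<and> gen_idx y < n \<and>
        r = word [(False, x)] * word [(True, y)] - word [(True, y)] * word [(False, x)])"
  unfolding HH_rel_def hg_def fa_lookup Un_iff mem_Collect_eq poly_mapping_eq_iff [symmetric] by blast

lemma HH_rel_fin: "r \<in> HH_rel n c \<Longrightarrow> fa_fin r"
  by (auto simp: HH_rel_def hg_def fa_lookup)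

text \<open>The operators \<open>ad i\<close> and \<open>pd j\<close> satisfy the relations of
  \<open>HH_rel\<close>; \<open>P\<close>, \<open>Q\<close>, \<open>a\<close> and \<open>b\<close>
  stay arbitrary so that the outer factors of x p y can be absorbed into them.\<close>

lemma bd_ideal:
  assumes "Z \<in> fideal (HH_rel n c)" "clinear P" "clinear Q"
  shows "bd P Q Z a b = 0"
  using assms
proof (induction Z arbitrary: P Q a b rule: fideal_induct)
  case (fin r)
  then show ?case by (rule HH_rel_fin)
next
  case (base r)
  note lins = clinear_simps [OF clinear_bd] clinear_simps [OF \<open>clinear P\<close>] clinear_simps [OF \<open>clinear Q\<close>]
  have w: "word [x] * word [y] = word [x, y]" for x y :: "bool \<times> gen"
    by (simp flip: word_append)
  from base(1) consider
    (ee) s i j where "i < n" "j < n" "r = word [(s, E i)] * word [(s, E j)] - word [(s, E j)] * word [(s, E i)] -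
        (\<Sum>k<n. c i j k *\<^sub>C word [(s, E k)])"
    | (ed) s i j where "i < n" "j < n" "r = word [(s, E i)] * word [(s, D j)] - word [(s, D j)] * word [(s, E i)] +
        (\<Sum>k<n. c i k j *\<^sub>C word [(s, D k)])"
    | (dd) s i j where "r = word [(s, D i)] * word [(s, D j)] - word [(s, D j)] * word [(s, D i)]"
    | (x) x y where "r = word [(False, x)] * word [(True, y)] - word [(True, y)] * word [(False, x)]"
    unfolding HH_rel_lookup by blast
  then show ?case
  proof cases
    case ee
    have "P (ad i (ad j f)) - P (ad j (ad i f)) = (\<Sum>k<n. c i j k *\<^sub>C P (ad k f))"
      "Q (ad i (ad j f)) - Q (ad j (ad i f)) = (\<Sum>k<n. c i j k *\<^sub>C Q (ad k f))" for f
      using arg_cong [OF ad_commutator [OF ee(1,2), of f], of P] arg_cong [OF ad_commutator [OF ee(1,2), of f], of Q]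
      by (simp_all add: lins)
    then have "P (ad i (ad j f)) * g - P (ad j (ad i f)) * g = (\<Sum>k<n. c i j k *\<^sub>C (P (ad k f) * g))"
      "g * Q (ad i (ad j f)) - g * Q (ad j (ad i f)) = (\<Sum>k<n. c i j k *\<^sub>C (g * Q (ad k f)))" for f g
      by (simp_all add: sum_distrib_left sum_distrib_right flip: left_diff_distrib right_diff_distrib)
    then show ?thesis
      by (cases s) (simp_all add: ee(3) w lins bd_word dside_def)
  next
    case ed
    have "P (ad i (pd j f)) * g - P (pd j (ad i f)) * g + (\<Sum>k<n. c i k j *\<^sub>C (P (pd k f) * g)) = 0"
      "g * Q (ad i (pd j f)) - g * Q (pd j (ad i f)) + (\<Sum>k<n. c i k j *\<^sub>C (g * Q (pd k f))) = 0" for f g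
      by (simp_all add: pd_ad ed lins distrib_left distrib_right sum_distrib_left sum_distrib_right)
    then show ?thesis
      by (cases s) (simp_all add: ed(3) w lins bd_word dside_def)
  next
    case dd
    then show ?thesis
      by (cases s) (simp_all add: w lins bd_word dside_def pd_commute)
  next
    case x
    then show ?thesis
      by (simp add: w lins bd_word dside_def)
  qed
next
  case (mult p x y)
  show ?case
  proof (rule clinear_eqI [where p = x and g = "\<lambda>_. 0"])
    show "clinear (\<lambda>x. bd P Q (x * (p * y)) a b)"
      by (intro clinear_compose [OF clinear_bd] clin)
    fix u
    show "bd P Q (word u * (p * y)) a b = 0"
    proof (rule clinear_eqI [where p = y and g = "\<lambda>_. 0"])
      show "clinear (\<lambda>y. bd P Q (word u * (p * y)) a b)"
        by (intro clinear_compose [OF clinear_bd] clin)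
      fix v
      show "bd P Q (word u * (p * word v)) a b = 0"
        unfolding bd_word_mult bd_mult_word
        by (intro mult.IH clinear_compose [OF mult.prems(1)] clinear_compose [OF mult.prems(2)] clinear_dact)
    qed (rule clinear_const_0)
  qed (rule clinear_const_0)
qed (simp_all add: clinear_simps [OF clinear_bd])

section \<open>The action on words and its agreement with the action on polynomials\<close>

fun pderl :: "bool \<times> gen \<Rightarrow> bool \<times> nat \<Rightarrow> ((bool \<times> nat) list \<Rightarrow>\<^sub>0 complex)" where
  "pderl (s, E i) (s', j) = (if s = s' then (\<Sum>k<n. c i j k *\<^sub>C word [(s, k)]) else 0)"
| "pderl (s, D i) (s', j) = (if s = s' \<and> i = j then 1 else 0)"

definition pderw :: "bool \<times> gen \<Rightarrow> (bool \<times> nat) list \<Rightarrow> ((bool \<times> nat) list \<Rightarrow>\<^sub>0 complex)" where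
  "pderw g w = (\<Sum>p<length w. word (take p w) * (pderl g (w ! p) * word (drop (Suc p) w)))"

definition pact :: "((bool \<times> gen) list \<Rightarrow>\<^sub>0 complex) \<Rightarrow> ((bool \<times> nat) list \<Rightarrow>\<^sub>0 complex) \<Rightarrow> ((bool \<times> nat) list \<Rightarrow>\<^sub>0 complex)" where
  "pact Z m = lin (\<lambda>u. foldr (\<lambda>g. lin (pderw g)) u m) Z"

lemma act_lookup: "act n c (Poly_Mapping.lookup Z) (Poly_Mapping.lookup m) = Poly_Mapping.lookup (pact Z m)"
proof -
  have "der_letter n c g x = Poly_Mapping.lookup (pderl g x)" for g x
    by (induction g x rule: pderl.induct) (auto simp: fa_lookup fun_eq_iff)
  then have "der n c g (Poly_Mapping.lookup m) = Poly_Mapping.lookup (lin (pderw g) m)" for g m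
    by (simp add: der_def der_word_def [abs_def] pderw_def [abs_def] fa_lookup)
  then have "foldr (der n c) u (Poly_Mapping.lookup m) = Poly_Mapping.lookup (foldr (\<lambda>g. lin (pderw g)) u m)" for u
    by (induction u) simp_all
  then show ?thesis
    by (simp add: act_def pact_def fa_lookup)
qed

abbreviation "Letters \<equiv> UNIV \<times> {..<n}"

lemma keys_pder:
  assumes "Poly_Mapping.keys m \<subseteq> lists Letters"
  shows "Poly_Mapping.keys (lin (pderw g) m) \<subseteq> lists Letters"
proof (rule keys_lists_lin)
  have one: "Poly_Mapping.keys (1 :: (bool \<times> nat) list \<Rightarrow>\<^sub>0 complex) \<subseteq> lists Letters"
    by (simp add: zero_list_def)
  have letter: "Poly_Mapping.keys (pderl g x) \<subseteq> lists Letters" for x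
    by (induction g x rule: pderl.induct) (use one in \<open>auto intro!: keys_lists_sum keys_lists_scale\<close>)
  fix w assume "w \<in> Poly_Mapping.keys m"
  then have "w \<in> lists Letters" using assms by blast
  then have "take p w \<in> lists Letters" "drop p w \<in> lists Letters" for p
    by (auto dest: in_set_takeD in_set_dropD)
  then show "Poly_Mapping.keys (pderw g w) \<subseteq> lists Letters"
    unfolding pderw_def by (intro keys_lists_sum keys_lists_mult letter) simp_all
qed

lemma keys_foldr_pder:
  "Poly_Mapping.keys m \<subseteq> lists Letters \<Longrightarrow> Poly_Mapping.keys (foldr (\<lambda>g. lin (pderw g)) u m) \<subseteq> lists Letters"
  by (induction u) (simp_all add: keys_pder)

lemma pderw_Nil: "pderw g [] = 0"
  by (simp add: pderw_def)

lemma pderw_Cons: "pderw g (x # w) = pderl g x * word w + word [x] * pderw g w"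
proof -
  have "word (x # take p w) = word [x] * word (take p w)" for p
    by (rule word_Cons)
  then show ?thesis
    unfolding pderw_def length_Cons sum.lessThan_Suc_shift
    by (simp add: sum_distrib_left mult.assoc)
qed

text \<open>Both sides obey the Leibniz rule letter by letter, and the tensor factor not addressed
  by \<open>g\<close> is left alone. The letters lie below \<open>n\<close>, where
  \<open>ad i\<close> and \<open>pderl\<close> agree on variables.\<close>

lemma beta_pderw:
  assumes "clinear P" "clinear Q" "w \<in> lists Letters"
  shows "beta P Q (pderw g w) = P (dside False g (side_monomial False w)) * Q (dside True g (side_monomial True w))"
  using assms
proof (induction w arbitrary: P Q)
  case Nil
  have "dstep d 1 = 0" for d
    by (cases d) (simp_all add: ad_def)
  then show ?case
    by (simp add: pderw_Nil clinear_0 [OF clinear_beta] dside_def clinear_0 [OF Nil(1)] clinear_0 [OF Nil(2)])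
next
  case (Cons x w)
  obtain s d where g: "g = (s, d)" by force
  obtain s' j where x: "x = (s', j)" by force
  have j: "j < n" and w: "w \<in> lists Letters" using Cons.prems(3) by (auto simp: x)
  have letter: "beta P Q (pderl g x) = (if s \<noteq> s' then 0 else if s then P 1 * Q (dstep d (X j)) else P (dstep d (X j)) * Q 1)"
    if "clinear P" "clinear Q" for P Q
  proof (cases d)
    case (E i)
    then show ?thesis using j
      by (simp add: g x clinear_simps [OF clinear_beta] clinear_simps [OF that(1)] clinear_simps [OF that(2)]
          ad_X br_def beta_word side_monomial_Cons sum_distrib_left sum_distrib_right)
  next
    case (D i)
    have "beta P Q 1 = P 1 * Q 1"
      using beta_word [of P Q "[]"] by simp
    then show ?thesis
      by (simp add: D g x clinear_simps [OF clinear_beta] clinear_simps [OF that(1)] clinear_simps [OF that(2)] pd_X)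
  qed
  have cl: "clinear (\<lambda>f. P (f * h))" "clinear (\<lambda>f. Q (f * h))" "clinear (\<lambda>f. P (h * f))" "clinear (\<lambda>f. Q (h * f))" for h
    by (intro clinear_compose [OF Cons.prems(1)] clinear_compose [OF Cons.prems(2)] clin)+
  have "beta P Q (pderw g (x # w)) = beta (\<lambda>f. P (f * side_monomial False w)) (\<lambda>f. Q (f * side_monomial True w)) (pderl g x) +
     P (side_monomial False [x] * dside False g (side_monomial False w)) * Q (side_monomial True [x] * dside True g (side_monomial True w))"
    by (simp add: pderw_Cons clinear_add [OF clinear_beta] beta_mult_word beta_word_mult Cons.IH [OF cl(3,4) w])
  also have "\<dots> = P (dside False g (side_monomial False (x # w))) * Q (dside True g (side_monomial True (x # w)))"
    unfolding letter [OF cl(1,2)]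
    by (auto simp: g x side_monomial_Cons dside_def dstep_mult distrib_left distrib_right
        clinear_add [OF Cons.prems(1)] clinear_add [OF Cons.prems(2)])
  finally show ?case .
qed

lemma beta_pder:
  assumes "clinear P" "clinear Q" "Poly_Mapping.keys m \<subseteq> lists Letters"
  shows "beta P Q (lin (pderw g) m) = beta (\<lambda>f. P (dside False g f)) (\<lambda>f. Q (dside True g f)) m"
proof (rule clinear_eqI [where p = m])
  show "clinear (\<lambda>m. beta P Q (lin (pderw g) m))" "clinear (beta (\<lambda>f. P (dside False g f)) (\<lambda>f. Q (dside True g f)))"
    by (intro clinear_compose [OF clinear_beta] clin)+
  fix w assume "w \<in> Poly_Mapping.keys m"
  then have "w \<in> lists Letters" using assms(3) by blast
  then show "beta P Q (lin (pderw g) (word w)) = beta (\<lambda>f. P (dside False g f)) (\<lambda>f. Q (dside True g f)) (word w)"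
    by (simp add: beta_pderw [OF assms(1,2)] beta_word)
qed

lemma beta_foldr_pder:
  assumes "clinear P" "clinear Q" "Poly_Mapping.keys m \<subseteq> lists Letters"
  shows "beta P Q (foldr (\<lambda>g. lin (pderw g)) u m) = beta (\<lambda>f. P (dact False u f)) (\<lambda>f. Q (dact True u f)) m"
  using assms
proof (induction u arbitrary: P Q)
  case (Cons g u)
  have "beta P Q (foldr (\<lambda>g. lin (pderw g)) (g # u) m) =
      beta (\<lambda>f. P (dside False g f)) (\<lambda>f. Q (dside True g f)) (foldr (\<lambda>g. lin (pderw g)) u m)"
    using Cons.prems by (simp add: beta_pder keys_foldr_pder)
  also have "\<dots> = beta (\<lambda>f. P (dact False (g # u) f)) (\<lambda>f. Q (dact True (g # u) f)) m"
    by (subst Cons.IH) (use Cons.prems in \<open>auto intro!: clinear_compose [OF Cons.prems(1)] clinear_compose [OF Cons.prems(2)] clinear_dside\<close>)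
  finally show ?case .
qed simp

lemma keys_ptens:
  assumes "Poly_Mapping.keys a \<subseteq> lists {..<n}" "Poly_Mapping.keys b \<subseteq> lists {..<n}"
  shows "Poly_Mapping.keys (ptens a b) \<subseteq> lists Letters"
  unfolding ptens_def by (intro keys_lists_mult keys_lists_lin) (auto dest!: subsetD [OF assms(1)] subsetD [OF assms(2)])

lemma toR_act:
  assumes "Poly_Mapping.keys a \<subseteq> lists {..<n}" "Poly_Mapping.keys b \<subseteq> lists {..<n}"
  shows "toR (pmu (pact Z (ptens a b))) = bd (\<lambda>f. f) (\<lambda>f. f) Z (toR a) (toR b)"
  unfolding toR_pmu
proof (rule clinear_eqI [where p = Z])
  show "clinear (\<lambda>Z. beta (\<lambda>f. f) (\<lambda>f. f) (pact Z (ptens a b)))"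
    unfolding pact_def by (intro clinear_compose [OF clinear_beta] clin)
  show "clinear (\<lambda>Z. bd (\<lambda>f. f) (\<lambda>f. f) Z (toR a) (toR b))"
    by (rule clinear_bd)
  fix u
  show "beta (\<lambda>f. f) (\<lambda>f. f) (pact (word u) (ptens a b)) = bd (\<lambda>f. f) (\<lambda>f. f) (word u) (toR a) (toR b)"
    by (simp add: pact_def bd_word beta_foldr_pder [OF clinear_ident clinear_ident keys_ptens [OF assms]]
        beta_ptens clinear_dact)
qed

lemma keys_pmu_pact:
  assumes "Poly_Mapping.keys a \<subseteq> lists {..<n}" "Poly_Mapping.keys b \<subseteq> lists {..<n}"
  shows "Poly_Mapping.keys (pmu (pact Z (ptens a b))) \<subseteq> lists {..<n}"
proof -
  have "Poly_Mapping.keys (pact Z (ptens a b)) \<subseteq> lists Letters"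
    unfolding pact_def by (intro keys_lists_lin keys_foldr_pder keys_ptens assms)
  from subsetD [OF this] show ?thesis
    unfolding pmu_def by (intro keys_lists_lin) fastforce
qed

end

section \<open>The twist\<close>

abbreviation hw :: "bool \<Rightarrow> gen \<Rightarrow> ((bool \<times> gen) list \<Rightarrow>\<^sub>0 complex)" where
  "hw s x \<equiv> word [(s, x)]"

definition pQ1 where "pQ1 n = (\<Sum>i<n. hw False (E i) * hw True (D i))"
definition pQ2 where "pQ2 n = (\<Sum>i<n. hw False (D i) * hw True (E i))"
definition pQN where "pQN n = (\<Sum>i<n. \<Sum>j<n. hw False (E i) * hw False (D j) * (hw True (E j) * hw True (D i)))"
definition pQR where "pQR n = (\<Sum>i<n. \<Sum>j<n. hw False (D j) * hw False (E i) * (hw True (D i) * hw True (E j)))"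
definition pK where "pK n c = (\<Sum>i<n. \<Sum>j<n. kappa n c i j *\<^sub>C (hw False (D i) * hw True (D j)))"
definition pG1 where "pG1 n \<alpha> \<beta> = \<alpha> *\<^sub>C pQ1 n + \<beta> *\<^sub>C pQ2 n"
definition pG2 where "pG2 n c \<alpha> \<beta> = (\<alpha>\<^sup>2 / 2) *\<^sub>C ((pQ1 n + pQ2 n) * pQ1 n) + (\<beta>\<^sup>2 / 2) *\<^sub>C ((pQ1 n + pQ2 n) * pQ2 n) +
  (- 1 / 24) *\<^sub>C (pQN n + 2 *\<^sub>C pQR n + 2 *\<^sub>C pK n c)"

lemma Q1_lookup: "Q1 n = Poly_Mapping.lookup (pQ1 n)"
  by (simp add: Q1_def pQ1_def hg_def fa_lookup)

lemma Q2_lookup: "Q2 n = Poly_Mapping.lookup (pQ2 n)"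
  by (simp add: Q2_def pQ2_def hg_def fa_lookup)

lemma Q1Q2N_lookup: "Q1Q2N n = Poly_Mapping.lookup (pQN n)"
  unfolding Q1Q2N_def pQN_def sum.cartesian_product case_prod_unfold hg_def fa_lookup ..

lemma Q1Q2R_lookup: "Q1Q2R n = Poly_Mapping.lookup (pQR n)"
  unfolding Q1Q2R_def pQR_def sum.cartesian_product case_prod_unfold hg_def fa_lookup ..

lemma Kterm_lookup: "Kterm n c = Poly_Mapping.lookup (pK n c)"
  unfolding Kterm_def pK_def sum.cartesian_product case_prod_unfold hg_def fa_lookup ..

lemma Finv2_lookup: "Finv2 n c \<alpha> \<beta> = Poly_Mapping.lookup (pG2 n c \<alpha> \<beta>)"
  by (simp add: Finv2_def pG2_def Q1_lookup Q2_lookup Q1Q2N_lookup Q1Q2R_lookup Kterm_lookup fa_lookup)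

context lie
begin

lemma bd_pG1: "bd (\<lambda>f. f) (\<lambda>f. f) (pG1 n \<alpha> \<beta>) a b = M1 \<alpha> \<beta> a b"
  by (simp add: pG1_def pQ1_def pQ2_def M1_def clinear_simps [OF clinear_bd] bd_word dside_def flip: word_append)

lemma bd_pG2: "bd (\<lambda>f. f) (\<lambda>f. f) (pG2 n c \<alpha> \<beta>) a b = M2 a b"
proof -
  have 0: "bd (\<lambda>f. f) (\<lambda>f. f) (pQ1 n + pQ2 n) a b = 0" for a b
    using ad_pd_cancel [of a b]
    by (simp add: pQ1_def pQ2_def clinear_simps [OF clinear_bd] bd_word dside_def flip: word_append)
  \<comment> \<open>A right factor only changes the two arguments, so the fact \<open>0\<close>,
    proved for all arguments, applies.\<close>
  have "bd (\<lambda>f. f) (\<lambda>f. f) ((pQ1 n + pQ2 n) * Z) a b = 0" for Z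
  proof (rule clinear_eqI [where p = Z and g = "\<lambda>_. 0"])
    show "clinear (\<lambda>Z. bd (\<lambda>f. f) (\<lambda>f. f) ((pQ1 n + pQ2 n) * Z) a b)"
      by (intro clinear_compose [OF clinear_bd] clin)
  qed (simp_all only: bd_mult_word 0 clinear_const_0)
  then show ?thesis
    by (simp add: pG2_def pQN_def pQR_def pK_def M2_def clinear_simps [OF clinear_bd] bd_word dside_def flip: word_append)
qed

end

section \<open>The twisted coproduct\<close>

abbreviation cm :: "'a::ring_1 \<Rightarrow> 'a \<Rightarrow> 'a" where
  "cm a b \<equiv> a * b - b * a"

lemma cm_mult_right: "cm a (b * b') = cm a b * b' + b * cm (a :: 'a::ring_1) b'"
  by (simp add: algebra_simps)

lemma cm_sum_right: "cm (a :: 'a::ring_1) (sum f A) = (\<Sum>i\<in>A. cm a (f i))"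
  by (simp add: sum_distrib_left sum_distrib_right sum_subtractf)

lemma cm_sum_left: "cm (sum f A) (a :: 'a::ring_1) = (\<Sum>i\<in>A. cm (f i) a)"
  by (simp add: sum_distrib_left sum_distrib_right sum_subtractf)

lemma cm_scale_right: "cm (x :: 'a::calg) (a *\<^sub>C y) = a *\<^sub>C cm x y"
  by (simp add: scaleC_diff_right)

lemma cm_scale_left: "cm (a *\<^sub>C x :: 'a::calg) y = a *\<^sub>C cm x y"
  by (simp add: scaleC_diff_right)

lemma cm_add_right: "cm (x :: 'a::ring_1) (y + z) = cm x y + cm x z"
  by (simp add: algebra_simps)

lemma cm_add_left: "cm (x + y :: 'a::ring_1) z = cm x z + cm y z"
  by (simp add: algebra_simps)

context lie
begin

abbreviation I where "I \<equiv> fideal (HH_rel n c)"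

section \<open>Congruence in H \<otimes> H and the subalgebra of dual letters\<close>

definition heq :: "((bool \<times> gen) list \<Rightarrow>\<^sub>0 complex) \<Rightarrow> ((bool \<times> gen) list \<Rightarrow>\<^sub>0 complex) \<Rightarrow> bool" (infix \<open>\<approx>\<close> 50) where
  "p \<approx> q \<longleftrightarrow> p - q \<in> I"

lemma heq_refl [simp]: "p \<approx> p"
  by (simp add: heq_def)

lemma heq_sym: "p \<approx> q \<Longrightarrow> q \<approx> p"
  using fideal_uminus [of "p - q"] by (simp add: heq_def)

lemma heq_trans [trans]: "p \<approx> q \<Longrightarrow> q \<approx> r \<Longrightarrow> p \<approx> r"
  using fideal_add [of "p - q" _ "q - r"] by (simp add: heq_def)

lemma heq_add: "p \<approx> q \<Longrightarrow> p' \<approx> q' \<Longrightarrow> p + p' \<approx> q + q'"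
  using fideal_add [of "p - q" _ "p' - q'"] by (simp add: heq_def algebra_simps)

lemma heq_diff: "p \<approx> q \<Longrightarrow> p' \<approx> q' \<Longrightarrow> p - p' \<approx> q - q'"
  using fideal_diff [of "p - q" _ "p' - q'"] by (simp add: heq_def algebra_simps)

lemma heq_scale: "p \<approx> q \<Longrightarrow> a *\<^sub>C p \<approx> a *\<^sub>C q"
  using fideal_scale [of "p - q"] by (simp add: heq_def scaleC_diff_right)

lemma heq_mult:
  assumes "p \<approx> q" "p' \<approx> q'"
  shows "p * p' \<approx> q * q'"
proof -
  have "(p - q) * p' + q * (p' - q') \<in> I"
    using assms unfolding heq_def by (blast intro: fideal_closed)
  then show ?thesis by (simp add: heq_def algebra_simps)
qed

lemma heq_sum: "(\<And>i. i \<in> A \<Longrightarrow> f i \<approx> g i) \<Longrightarrow> sum f A \<approx> sum g A"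
  using fideal_sum [of A "\<lambda>i. f i - g i"] by (simp add: heq_def sum_subtractf)

abbreviation dual_letters where "dual_letters \<equiv> {(s, D i) | s i. i < n}"

text \<open>Membership is read modulo the relations, so \<open>SS\<close> is the preimage of the
  subalgebra that the dual letters generate in H \<otimes> H.\<close>

definition SS :: "((bool \<times> gen) list \<Rightarrow>\<^sub>0 complex) set" where
  "SS = {p. \<exists>q. Poly_Mapping.keys q \<subseteq> lists dual_letters \<and> p \<approx> q}"

lemma SS_cong: "p \<in> SS \<Longrightarrow> q \<approx> p \<Longrightarrow> q \<in> SS"
  unfolding SS_def using heq_trans by blast

lemma SS_I: "p \<in> I \<Longrightarrow> p \<in> SS"
  unfolding SS_def by (intro CollectI exI [of _ 0]) (simp add: heq_def)

lemma SS_add: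
  assumes "p \<in> SS" "q \<in> SS"
  shows "p + q \<in> SS"
proof -
  from assms obtain p' q' where *: "Poly_Mapping.keys p' \<subseteq> lists dual_letters" "p \<approx> p'"
      "Poly_Mapping.keys q' \<subseteq> lists dual_letters" "q \<approx> q'"
    unfolding SS_def by blast
  then have "Poly_Mapping.keys (p' + q') \<subseteq> lists dual_letters"
    using Poly_Mapping.keys_add [of p' q'] by blast
  then show ?thesis
    unfolding SS_def using heq_add [OF *(2,4)] by blast
qed

lemma SS_mult:
  assumes "p \<in> SS" "q \<in> SS"
  shows "p * q \<in> SS"
proof -
  from assms obtain p' q' where *: "Poly_Mapping.keys p' \<subseteq> lists dual_letters" "p \<approx> p'"
      "Poly_Mapping.keys q' \<subseteq> lists dual_letters" "q \<approx> q'"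
    unfolding SS_def by blast
  show ?thesis
    unfolding SS_def using keys_lists_mult [OF *(1,3)] heq_mult [OF *(2,4)] by blast
qed

lemma SS_scale:
  assumes "p \<in> SS"
  shows "a *\<^sub>C p \<in> SS"
proof -
  from assms obtain p' where *: "Poly_Mapping.keys p' \<subseteq> lists dual_letters" "p \<approx> p'"
    unfolding SS_def by blast
  show ?thesis
    unfolding SS_def using keys_lists_scale [OF *(1)] heq_scale [OF *(2)] by blast
qed

lemma SS_uminus: "p \<in> SS \<Longrightarrow> - p \<in> SS"
  using SS_scale [of p "- 1"] by simp

lemma SS_diff: "p \<in> SS \<Longrightarrow> q \<in> SS \<Longrightarrow> p - q \<in> SS"
  using SS_add [of p "- q"] SS_uminus by simp

lemma SS_sum: "(\<And>i. i \<in> A \<Longrightarrow> f i \<in> SS) \<Longrightarrow> sum f A \<in> SS"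
  by (induction A rule: infinite_finite_induct) (auto intro: SS_add SS_I)

lemma SS_hD: "i < n \<Longrightarrow> hw s (D i) \<in> SS"
  unfolding SS_def by (intro CollectI exI [of _ "hw s (D i)"]) simp

lemma cm_different_sides: "gen_idx x < n \<Longrightarrow> gen_idx y < n \<Longrightarrow> s \<noteq> s' \<Longrightarrow> cm (hw s x) (hw s' y) \<in> I"
proof -
  assume xy: "gen_idx x < n" "gen_idx y < n" "s \<noteq> s'"
  have ft: "cm (hw False x) (hw True y) \<in> I" if "gen_idx x < n" "gen_idx y < n" for x y
    using that unfolding HH_rel_lookup by (intro fideal_base) (auto simp: HH_rel_lookup)
  then show ?thesis
    using xy ft [OF xy(1,2)] fideal_uminus [OF ft [OF xy(2,1)]] by (cases s; cases s') auto
qed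

lemma cm_hD_hD: "i < n \<Longrightarrow> j < n \<Longrightarrow> cm (hw s (D i)) (hw s' (D j)) \<in> I"
proof (cases "s = s'")
  case True
  then show "i < n \<Longrightarrow> j < n \<Longrightarrow> ?thesis" by (intro fideal_base) (auto simp: HH_rel_lookup)
qed (simp add: cm_different_sides)

lemma cm_hD_hE: "i < n \<Longrightarrow> j < n \<Longrightarrow> cm (hw s (D j)) (hw s (E i)) \<approx> (\<Sum>k<n. c i k j *\<^sub>C hw s (D k))"
proof -
  assume ij: "i < n" "j < n"
  have "cm (hw s (E i)) (hw s (D j)) + (\<Sum>k<n. c i k j *\<^sub>C hw s (D k)) \<in> I"
    by (intro fideal_base) (unfold HH_rel_lookup, use ij in blast)
  then show ?thesis
    using fideal_uminus by (fastforce simp: heq_def)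
qed

text \<open>Commutation with e_i is a derivation that maps each dual letter into the span of dual
  letters, so it preserves the subalgebra they generate.\<close>

lemma cm_hE_SS:
  assumes "i < n" "p \<in> SS"
  shows "cm (hw s (E i)) p \<in> SS"
proof -
  have gen: "cm (hw s (E i)) (hw s' (D j)) \<in> SS" if "j < n" for s' j
  proof (cases "s = s'")
    case True
    have "(\<Sum>k<n. c i k j *\<^sub>C hw s (D k)) \<in> SS"
      by (intro SS_sum SS_scale SS_hD) simp
    from SS_cong [OF this cm_hD_hE [OF assms(1) that]] have "- cm (hw s (D j)) (hw s (E i)) \<in> SS"
      by (rule SS_uminus)
    then show ?thesis by (simp add: True)
  next
    case False
    then show ?thesis using assms(1) that by (intro SS_I cm_different_sides) auto
  qed
  have wd: "word w \<in> SS \<and> cm (hw s (E i)) (word w) \<in> SS" if "w \<in> lists dual_letters" for w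
    using that
  proof (induction w)
    case Nil
    have "(1 :: (bool \<times> gen) list \<Rightarrow>\<^sub>0 complex) \<in> SS"
      unfolding SS_def by (intro CollectI exI [of _ 1]) (simp add: zero_list_def)
    then show ?case by (simp add: SS_I)
  next
    case (Cons x w)
    then obtain s' j where x: "x = (s', D j)" "j < n" by auto
    have "hw s' (D j) * word w \<in> SS"
      using Cons x by (intro SS_mult SS_hD) auto
    moreover have "cm (hw s (E i)) (hw s' (D j) * word w) \<in> SS"
      unfolding cm_mult_right using Cons x by (intro SS_add SS_mult SS_hD gen) auto
    ultimately show ?case
      unfolding x(1) word_Cons [of "(s', D j)" w] by simp
  qed
  from assms(2) obtain q where q: "Poly_Mapping.keys q \<subseteq> lists dual_letters" "p \<approx> q"
    unfolding SS_def by blast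
  have "cm (hw s (E i)) q = (\<Sum>w\<in>Poly_Mapping.keys q. Poly_Mapping.lookup q w *\<^sub>C cm (hw s (E i)) (word w))"
    by (subst (1 2) poly_mapping_expand [of q]) (simp only: lin_def cm_sum_right cm_scale_right)
  also have "\<dots> \<in> SS"
    using wd q(1) by (intro SS_sum SS_scale) blast
  finally show ?thesis
    by (rule SS_cong) (intro heq_diff heq_mult q heq_refl)
qed

lemma cm_hD_SS:
  assumes "i < n" "p \<in> SS"
  shows "cm (hw s (D i)) p \<in> I"
proof -
  have wd: "cm (hw s (D i)) (word w) \<in> I" if "w \<in> lists dual_letters" for w
    using that
  proof (induction w)
    case (Cons x w)
    then obtain s' j where x: "x = (s', D j)" "j < n" by auto
    have "cm (hw s (D i)) (hw s' (D j)) \<in> I" "cm (hw s (D i)) (word w) \<in> I"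
      using cm_hD_hD assms(1) x Cons by auto
    then have "cm (hw s (D i)) (hw s' (D j) * word w) \<in> I"
      unfolding cm_mult_right by (blast intro: fideal_closed)
    then show ?case
      unfolding x(1) word_Cons [of "(s', D j)" w] .
  qed simp
  from assms(2) obtain q where q: "Poly_Mapping.keys q \<subseteq> lists dual_letters" "p \<approx> q"
    unfolding SS_def by blast
  have "cm (hw s (D i)) q = (\<Sum>w\<in>Poly_Mapping.keys q. Poly_Mapping.lookup q w *\<^sub>C cm (hw s (D i)) (word w))"
    by (subst (1 2) poly_mapping_expand [of q]) (simp only: lin_def cm_sum_right cm_scale_right)
  also have "\<dots> \<in> I"
    using wd q(1) by (intro fideal_sum fideal_scale) blast
  finally have "cm (hw s (D i)) q \<approx> 0" by (simp add: heq_def)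
  then have "cm (hw s (D i)) p \<approx> 0"
    by (rule heq_trans [rotated]) (intro heq_diff heq_mult q heq_refl)
  then show ?thesis by (simp add: heq_def)
qed

section \<open>Commutators of the coproduct of x with the terms of F^{-1}\<close>

definition dX :: "(nat \<Rightarrow> complex) \<Rightarrow> ((bool \<times> gen) list \<Rightarrow>\<^sub>0 complex)" where
  "dX x = (\<Sum>k<n. x k *\<^sub>C (hw False (D k) + hw True (D k)))"

text \<open>\<open>delta x s i\<close> is \<open>x \<circ> ad e\<^sub>i\<close>, placed in the tensor factor \<open>s\<close>.\<close>

definition delta :: "(nat \<Rightarrow> complex) \<Rightarrow> bool \<Rightarrow> nat \<Rightarrow> ((bool \<times> gen) list \<Rightarrow>\<^sub>0 complex)" where
  "delta x s i = (\<Sum>m<n. (\<Sum>k<n. x k * c i m k) *\<^sub>C hw s (D m))"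

text \<open>Modulo the relations, the commutator of \<open>dX x\<close> with Q1 and the negative of
  that with Q2.\<close>

definition yel :: "(nat \<Rightarrow> complex) \<Rightarrow> ((bool \<times> gen) list \<Rightarrow>\<^sub>0 complex)" where
  "yel x = (\<Sum>i<n. delta x False i * hw True (D i))"

lemma SS_dX: "dX x \<in> SS"
  unfolding dX_def by (intro SS_sum SS_scale SS_add SS_hD) auto

lemma SS_delta: "delta x s i \<in> SS"
  unfolding delta_def by (intro SS_sum SS_scale SS_hD) auto

lemma SS_yel: "yel x \<in> SS"
  unfolding yel_def by (intro SS_sum SS_mult SS_delta SS_hD) auto

lemma cm_dX_hD: "i < n \<Longrightarrow> cm (dX x) (hw s (D i)) \<approx> 0"
  using fideal_uminus [OF cm_hD_SS [OF _ SS_dX]] by (simp add: heq_def)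

lemma cm_dX_hE:
  assumes "i < n"
  shows "cm (dX x) (hw s (E i)) \<approx> delta x s i"
proof -
  have "cm (dX x) (hw s (E i)) = (\<Sum>k<n. x k *\<^sub>C (cm (hw s (D k)) (hw s (E i)) + cm (hw (\<not> s) (D k)) (hw s (E i))))"
    unfolding dX_def cm_sum_left cm_scale_left cm_add_left by (cases s) (simp_all add: add.commute)
  also have "\<dots> \<approx> (\<Sum>k<n. x k *\<^sub>C ((\<Sum>m<n. c i m k *\<^sub>C hw s (D m)) + 0))"
  proof (intro heq_sum heq_scale heq_add)
    fix k assume "k \<in> {..<n}"
    then show "cm (hw s (D k)) (hw s (E i)) \<approx> (\<Sum>m<n. c i m k *\<^sub>C hw s (D m))"
      using cm_hD_hE assms by simp
    show "cm (hw (\<not> s) (D k)) (hw s (E i)) \<approx> 0"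
      using \<open>k \<in> {..<n}\<close> assms cm_different_sides [of "D k" "E i" "\<not> s" s] by (simp add: heq_def)
  qed
  also have "(\<Sum>k<n. x k *\<^sub>C ((\<Sum>m<n. c i m k *\<^sub>C hw s (D m)) + 0)) = (\<Sum>k<n. \<Sum>m<n. (x k * c i m k) *\<^sub>C hw s (D m))"
    by (simp add: scaleC_sum_right)
  also have "\<dots> = delta x s i"
    unfolding delta_def scaleC_sum_left by (rule sum.swap)
  finally show ?thesis .
qed

text \<open>Antisymmetry of the structure constants lets the bracket change tensor factors at the
  cost of a sign.\<close>

lemma yel_alt: "(\<Sum>i<n. hw False (D i) * delta x True i) = - yel x"
proof -
  have "(\<Sum>i<n. hw False (D i) * delta x True i) =
      (\<Sum>i<n. \<Sum>m<n. (\<Sum>k<n. x k * c i m k) *\<^sub>C (hw False (D i) * hw True (D m)))"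
    by (simp add: delta_def sum_distrib_left)
  also have "\<dots> = (\<Sum>i<n. \<Sum>m<n. - ((\<Sum>k<n. x k * c m i k) *\<^sub>C (hw False (D i) * hw True (D m))))"
  proof (intro sum.cong refl)
    fix i m assume im: "i \<in> {..<n}" "m \<in> {..<n}"
    have "(\<Sum>k<n. x k * c i m k) = (\<Sum>k<n. - (x k * c m i k))"
      by (intro sum.cong refl) (use im c_antisym [of i m] in auto)
    then show "(\<Sum>k<n. x k * c i m k) *\<^sub>C (hw False (D i) * hw True (D m)) =
        - ((\<Sum>k<n. x k * c m i k) *\<^sub>C (hw False (D i) * hw True (D m)))"
      by (simp add: sum_negf)
  qed
  also have "\<dots> = - (\<Sum>m<n. \<Sum>i<n. (\<Sum>k<n. x k * c m i k) *\<^sub>C (hw False (D i) * hw True (D m)))"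
    by (subst sum.swap) (simp add: sum_negf)
  also have "\<dots> = - yel x"
    by (simp add: yel_def delta_def sum_distrib_right)
  finally show ?thesis .
qed

lemma cm_heq:
  assumes "cm z a \<approx> a'" "cm z b \<approx> b'"
  shows "cm z (a * b) \<approx> a' * b + a * b'"
  unfolding cm_mult_right by (intro heq_add heq_mult assms heq_refl)

lemma cm_Q1: "cm (dX x) (pQ1 n) \<approx> yel x"
proof -
  have "cm (dX x) (hw False (E i) * hw True (D i)) \<approx> delta x False i * hw True (D i)" if "i < n" for i
    using cm_heq [OF cm_dX_hE cm_dX_hD] that by fastforce
  then show ?thesis
    unfolding pQ1_def yel_def cm_sum_right by (intro heq_sum) auto
qed

lemma cm_Q2: "cm (dX x) (pQ2 n) \<approx> - yel x"
proof -
  have "cm (dX x) (hw False (D i) * hw True (E i)) \<approx> hw False (D i) * delta x True i" if "i < n" for i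
    using cm_heq [OF cm_dX_hD cm_dX_hE] that by fastforce
  then show ?thesis
    unfolding pQ2_def yel_alt [symmetric] cm_sum_right by (intro heq_sum) auto
qed

lemma cm_G1: "cm (dX x) (pG1 n \<alpha> \<beta>) \<approx> (\<alpha> - \<beta>) *\<^sub>C yel x"
proof -
  have "cm (dX x) (pG1 n \<alpha> \<beta>) = \<alpha> *\<^sub>C cm (dX x) (pQ1 n) + \<beta> *\<^sub>C cm (dX x) (pQ2 n)"
    unfolding pG1_def cm_add_right cm_scale_right ..
  also have "\<dots> \<approx> \<alpha> *\<^sub>C yel x + \<beta> *\<^sub>C (- yel x)"
    by (intro heq_add heq_scale cm_Q1 cm_Q2)
  finally show ?thesis by (simp add: scaleC_diff_left)
qed

text \<open>By \<open>yel_alt\<close>, the negative of \<open>yel x\<close> can be written with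
  \<open>delta\<close> in the second factor. In this form the summands match the two terms that the
  Leibniz rule produces from e_i and e_j in :Q1Q2: and in its reordering.\<close>

lemma Q_yel_expand:
  "pQ2 n * yel x - pQ1 n * yel x =
    (\<Sum>i<n. \<Sum>j<n. hw False (D j) * hw True (E j) * (delta x False i * hw True (D i)) +
       hw False (E i) * hw True (D i) * (hw False (D j) * delta x True j))"
proof -
  have "pQ2 n * yel x = (\<Sum>j<n. \<Sum>i<n. hw False (D j) * hw True (E j) * (delta x False i * hw True (D i)))"
    by (simp add: pQ2_def yel_def sum_product)
  moreover have "pQ1 n * (- yel x) = (\<Sum>i<n. \<Sum>j<n. hw False (E i) * hw True (D i) * (hw False (D j) * delta x True j))"
    unfolding yel_alt [symmetric] by (simp add: pQ1_def sum_product)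
  ultimately show ?thesis
    by (subst (asm) sum.swap) (simp add: sum.distrib)
qed

lemma cm_sandwich_SS:
  assumes "\<And>i j. i < n \<Longrightarrow> j < n \<Longrightarrow> cm (dX x) (f i j) \<approx> g i j"
    and "\<And>i j. i < n \<Longrightarrow> j < n \<Longrightarrow> g i j - (hw False (D j) * hw True (E j) * (delta x False i * hw True (D i)) +
       hw False (E i) * hw True (D i) * (hw False (D j) * delta x True j)) \<in> SS"
  shows "cm (dX x) (\<Sum>i<n. \<Sum>j<n. f i j) - (pQ2 n * yel x - pQ1 n * yel x) \<in> SS"
proof (rule SS_cong)
  show "(\<Sum>i<n. \<Sum>j<n. g i j - (hw False (D j) * hw True (E j) * (delta x False i * hw True (D i)) +
       hw False (E i) * hw True (D i) * (hw False (D j) * delta x True j))) \<in> SS"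
    by (intro SS_sum assms(2)) auto
  show "cm (dX x) (\<Sum>i<n. \<Sum>j<n. f i j) - (pQ2 n * yel x - pQ1 n * yel x) \<approx>
    (\<Sum>i<n. \<Sum>j<n. g i j - (hw False (D j) * hw True (E j) * (delta x False i * hw True (D i)) +
       hw False (E i) * hw True (D i) * (hw False (D j) * delta x True j)))"
  proof -
    have "cm (dX x) (\<Sum>i<n. \<Sum>j<n. f i j) \<approx> (\<Sum>i<n. \<Sum>j<n. g i j)"
      unfolding cm_sum_right by (intro heq_sum assms(1)) auto
    then show ?thesis
      unfolding sum_subtractf Q_yel_expand by (rule heq_diff [OF _ heq_refl])
  qed
qed

lemma cm_SS_hD: "j < n \<Longrightarrow> cm p (hw s (D j)) \<in> I" if "p \<in> SS"
  using fideal_uminus [OF cm_hD_SS [OF _ that]] by simp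

lemma cm_SS_hE: "j < n \<Longrightarrow> cm p (hw s (E j)) \<in> SS" if "p \<in> SS"
  using SS_uminus [OF cm_hE_SS [OF _ that]] by simp

lemma cm_QN: "cm (dX x) (pQN n) - (pQ2 n * yel x - pQ1 n * yel x) \<in> SS"
  unfolding pQN_def
proof (rule cm_sandwich_SS)
  fix i j assume ij: "i < n" "j < n"
  let ?a = "hw False (E i)" and ?b = "hw False (D j)" and ?c = "hw True (E j)" and ?d = "hw True (D i)"
  let ?a' = "delta x False i" and ?c' = "delta x True j"
  have "cm (dX x) (?a * ?b * (?c * ?d)) \<approx> (?a' * ?b + ?a * 0) * (?c * ?d) + ?a * ?b * (?c' * ?d + ?c * 0)"
    using ij by (intro cm_heq cm_dX_hE cm_dX_hD)
  then show "cm (dX x) (?a * ?b * (?c * ?d)) \<approx> ?a' * ?b * (?c * ?d) + ?a * ?b * (?c' * ?d)"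
    by simp
  have "cm ?a' ?b * (?c * ?d) \<in> SS"
    using ij by (intro SS_I fideal_mult_right cm_SS_hD SS_delta)
  moreover have "?b * cm ?a' ?c * ?d \<in> SS"
    using ij by (intro SS_mult SS_hD cm_SS_hE SS_delta)
  \<comment> \<open>\<open>?a\<close> is an e_i, so having the commutator in \<open>SS\<close> would
    not be enough; it lies in the ideal because dual letters commute.\<close>
  moreover have "?a * cm (?b * ?c') ?d \<in> SS"
    using ij by (intro SS_I fideal_mult_left cm_SS_hD SS_mult SS_delta SS_hD)
  ultimately have "cm ?a' ?b * (?c * ?d) + ?b * cm ?a' ?c * ?d + ?a * cm (?b * ?c') ?d \<in> SS"
    by (intro SS_add)
  then show "?a' * ?b * (?c * ?d) + ?a * ?b * (?c' * ?d) - (?b * ?c * (?a' * ?d) + ?a * ?d * (?b * ?c')) \<in> SS"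
    by (simp add: algebra_simps)
qed

text \<open>Each passage of an e-letter over dual letters costs a correction in \<open>SS\<close> by
  \<open>cm_hE_SS\<close>; the one correction that still carries e_i contains a commutator of dual
  letters.\<close>

lemma cm_QR: "cm (dX x) (pQR n) - (pQ2 n * yel x - pQ1 n * yel x) \<in> SS"
  unfolding pQR_def
proof (rule cm_sandwich_SS)
  fix i j assume ij: "i < n" "j < n"
  let ?a = "hw False (E i)" and ?b = "hw False (D j)" and ?c = "hw True (E j)" and ?d = "hw True (D i)"
  let ?a' = "delta x False i" and ?c' = "delta x True j"
  have "cm (dX x) (?b * ?a * (?d * ?c)) \<approx> (0 * ?a + ?b * ?a') * (?d * ?c) + ?b * ?a * (0 * ?c + ?d * ?c')"
    using ij by (intro cm_heq cm_dX_hE cm_dX_hD)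
  then show "cm (dX x) (?b * ?a * (?d * ?c)) \<approx> ?b * ?a' * (?d * ?c) + ?b * ?a * (?d * ?c')"
    by simp
  have "?b * cm (?a' * ?d) ?c \<in> SS"
    using ij by (intro SS_mult SS_hD cm_SS_hE SS_delta)
  moreover have "cm ?b ?a * (?d * ?c') \<in> SS"
    using ij by (intro SS_mult SS_hD cm_SS_hE SS_delta)
  moreover have "?a * cm ?b ?d * ?c' \<in> SS"
    using ij by (intro SS_I fideal_mult cm_SS_hD SS_hD)
  ultimately have "?b * cm (?a' * ?d) ?c + cm ?b ?a * (?d * ?c') + ?a * cm ?b ?d * ?c' \<in> SS"
    by (intro SS_add)
  then show "?b * ?a' * (?d * ?c) + ?b * ?a * (?d * ?c') - (?b * ?c * (?a' * ?d) + ?a * ?d * (?b * ?c')) \<in> SS"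
    by (simp add: algebra_simps)
qed

lemma cm_K: "cm (dX x) (pK n c) \<in> SS"
proof -
  have "pK n c \<in> SS"
    unfolding pK_def by (intro SS_sum SS_scale SS_mult SS_hD) auto
  then show ?thesis by (intro SS_diff SS_mult SS_dX)
qed

lemma twisted_second_order:
  assumes ab: "\<alpha> - \<beta> = - 1/2"
  shows "cm (dX x) (pG2 n c \<alpha> \<beta>) - pG1 n \<alpha> \<beta> * cm (dX x) (pG1 n \<alpha> \<beta>) \<in> SS"
proof -
  let ?X = "dX x" and ?y = "yel x"
  define q1 where "q1 = pQ1 n * ?y"
  define q2 where "q2 = pQ2 n * ?y"
  have "cm ?X (pQ1 n + pQ2 n) \<approx> ?y + - ?y"
    unfolding cm_add_right by (intro heq_add cm_Q1 cm_Q2)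
  then have S: "cm ?X (pQ1 n + pQ2 n) \<approx> 0" by simp
  have s1: "cm ?X ((pQ1 n + pQ2 n) * pQ1 n) \<approx> q1 + q2"
    using cm_heq [OF S cm_Q1] by (simp add: q1_def q2_def distrib_right)
  have s2: "cm ?X ((pQ1 n + pQ2 n) * pQ2 n) \<approx> - (q1 + q2)"
    using cm_heq [OF S cm_Q2] by (simp add: q1_def q2_def distrib_right)
  have g: "pG1 n \<alpha> \<beta> * cm ?X (pG1 n \<alpha> \<beta>) \<approx> pG1 n \<alpha> \<beta> * ((\<alpha> - \<beta>) *\<^sub>C ?y)"
    by (intro heq_mult heq_refl cm_G1)
  define N where "N = (cm ?X (pQN n) - (q2 - q1)) + 2 *\<^sub>C (cm ?X (pQR n) - (q2 - q1)) + 2 *\<^sub>C cm ?X (pK n c)"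
  have N: "N \<in> SS"
    unfolding N_def q1_def q2_def by (intro SS_add SS_scale cm_QN cm_QR cm_K)
  have lhs: "cm ?X (pG2 n c \<alpha> \<beta>) - pG1 n \<alpha> \<beta> * cm ?X (pG1 n \<alpha> \<beta>) =
     (\<alpha>\<^sup>2 / 2) *\<^sub>C cm ?X ((pQ1 n + pQ2 n) * pQ1 n) + (\<beta>\<^sup>2 / 2) *\<^sub>C cm ?X ((pQ1 n + pQ2 n) * pQ2 n) +
     (- 1 / 24) *\<^sub>C (cm ?X (pQN n) + 2 *\<^sub>C cm ?X (pQR n) + 2 *\<^sub>C cm ?X (pK n c)) - pG1 n \<alpha> \<beta> * cm ?X (pG1 n \<alpha> \<beta>)"
    unfolding pG2_def cm_add_right cm_scale_right ..
  have rhs: "(\<alpha>\<^sup>2 / 2) *\<^sub>C cm ?X ((pQ1 n + pQ2 n) * pQ1 n) + (\<beta>\<^sup>2 / 2) *\<^sub>C cm ?X ((pQ1 n + pQ2 n) * pQ2 n) +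
     (- 1 / 24) *\<^sub>C (cm ?X (pQN n) + 2 *\<^sub>C cm ?X (pQR n) + 2 *\<^sub>C cm ?X (pK n c)) - pG1 n \<alpha> \<beta> * cm ?X (pG1 n \<alpha> \<beta>) \<approx>
     (\<alpha>\<^sup>2 / 2) *\<^sub>C (q1 + q2) + (\<beta>\<^sup>2 / 2) *\<^sub>C (- (q1 + q2)) +
     (- 1 / 24) *\<^sub>C (cm ?X (pQN n) + 2 *\<^sub>C cm ?X (pQR n) + 2 *\<^sub>C cm ?X (pK n c)) - pG1 n \<alpha> \<beta> * ((\<alpha> - \<beta>) *\<^sub>C ?y)"
    by (intro heq_add heq_diff heq_scale s1 s2 g heq_refl)
  have sum: "(\<alpha>\<^sup>2 / 2) *\<^sub>C (q1 + q2) + (\<beta>\<^sup>2 / 2) *\<^sub>C (- (q1 + q2)) +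
     (- 1 / 24) *\<^sub>C (cm ?X (pQN n) + 2 *\<^sub>C cm ?X (pQR n) + 2 *\<^sub>C cm ?X (pK n c)) - pG1 n \<alpha> \<beta> * ((\<alpha> - \<beta>) *\<^sub>C ?y) =
     (- 1 / 24) *\<^sub>C N"
  proof -
    \<comment> \<open>One copy from :Q1Q2: and two from its reordering give 3 (q2 - q1); with the
      factor -1/24 this is the origin of the 1/8 below.\<close>
    have e1: "cm ?X (pQN n) + 2 *\<^sub>C cm ?X (pQR n) + 2 *\<^sub>C cm ?X (pK n c) = N + 3 *\<^sub>C (q2 - q1)"
      using scaleC_add_left [of 1 2 "q2 - q1"] by (simp add: N_def scaleC_diff_right)
    have e2: "pG1 n \<alpha> \<beta> * ((\<alpha> - \<beta>) *\<^sub>C ?y) = (\<alpha> * (\<alpha> - \<beta>)) *\<^sub>C q1 + (\<beta> * (\<alpha> - \<beta>)) *\<^sub>C q2"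
      by (simp add: pG1_def q1_def q2_def distrib_right scaleC_add_right mult.commute)
    have b: "\<beta> = \<alpha> + 1/2" using ab by (simp add: algebra_simps)
    \<comment> \<open>Up to sign, both coefficients are (\<alpha> - \<beta>)^2/2 - 1/8.\<close>
    have c1: "\<alpha>\<^sup>2 / 2 - \<beta>\<^sup>2 / 2 + 1/8 - \<alpha> * (\<alpha> - \<beta>) = 0"
      unfolding b by (simp add: power2_eq_square field_simps)
    have c2: "\<alpha>\<^sup>2 / 2 - \<beta>\<^sup>2 / 2 - 1/8 - \<beta> * (\<alpha> - \<beta>) = 0"
      unfolding b by (simp add: power2_eq_square field_simps)
    have "(\<alpha>\<^sup>2 / 2) *\<^sub>C (q1 + q2) + (\<beta>\<^sup>2 / 2) *\<^sub>C (- (q1 + q2)) + (- 1 / 24) *\<^sub>C (N + 3 *\<^sub>C (q2 - q1)) -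
       ((\<alpha> * (\<alpha> - \<beta>)) *\<^sub>C q1 + (\<beta> * (\<alpha> - \<beta>)) *\<^sub>C q2) =
       (- 1 / 24) *\<^sub>C N + (\<alpha>\<^sup>2 / 2 - \<beta>\<^sup>2 / 2 + 1/8 - \<alpha> * (\<alpha> - \<beta>)) *\<^sub>C q1 + (\<alpha>\<^sup>2 / 2 - \<beta>\<^sup>2 / 2 - 1/8 - \<beta> * (\<alpha> - \<beta>)) *\<^sub>C q2"
      by (simp add: scaleC_add_right scaleC_diff_right scaleC_add_left scaleC_diff_left)
    then show ?thesis unfolding e1 e2 c1 c2 by simp
  qed
  show ?thesis
    unfolding lhs by (rule SS_cong [OF SS_scale [OF N] rhs [unfolded sum]])
qed

text \<open>Solving F F^{-1} = 1 modulo the relations gives 1, -G1 and G1^2 - G2 as the first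
  coefficients of F, which are then inserted into the conjugation.\<close>

lemma twisted_coproduct:
  fixes f g :: "nat \<Rightarrow> ((bool \<times> gen) list \<Rightarrow>\<^sub>0 complex)" and k :: nat
  assumes ab: "\<alpha> - \<beta> = - 1/2"
    and g: "g 0 \<approx> 1" "g 1 \<approx> pG1 n \<alpha> \<beta>" "g 2 \<approx> pG2 n c \<alpha> \<beta>"
    and fg: "f 0 * g 0 \<approx> 1" "f 0 * g 1 + f 1 * g 0 \<approx> 0" "f 0 * g 2 + f 1 * g 1 + f 2 * g 0 \<approx> 0"
    and "k < 3"
  shows "(\<Sum>i\<le>k. f i * dX x * g (k - i)) \<in> SS"
proof -
  let ?X = "dX x" and ?G1 = "pG1 n \<alpha> \<beta>" and ?G2 = "pG2 n c \<alpha> \<beta>"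
  \<comment> \<open>Since \<open>g 0\<close> is congruent to 1, this isolates \<open>f k\<close> in
    the inverse equation of degree k.\<close>
  have one: "p \<approx> p * g 0" for p
    using heq_mult [OF heq_refl heq_sym [OF g(1)], of p] by simp
  have f0: "f 0 \<approx> 1"
    using heq_trans [OF one fg(1)] .
  have "f 0 * g 1 + f 1 * g 0 - f 0 * g 1 \<approx> 0 - 1 * ?G1"
    by (intro heq_diff fg heq_mult f0 g)
  then have f1: "f 1 \<approx> - ?G1"
    using heq_trans [OF one] by simp
  have "f 0 * g 2 + f 1 * g 1 + f 2 * g 0 - (f 0 * g 2 + f 1 * g 1) \<approx> 0 - (1 * ?G2 + - ?G1 * ?G1)"
    by (intro heq_diff fg heq_add heq_mult f0 f1 g)
  then have f2: "f 2 \<approx> ?G1 * ?G1 - ?G2"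
    using heq_trans [OF one] by (simp add: algebra_simps)
  consider "k = 0" | "k = 1" | "k = 2" using \<open>k < 3\<close> by linarith
  then show ?thesis
  proof cases
    case 1
    have "f 0 * ?X * g 0 \<approx> 1 * ?X * 1"
      by (intro heq_mult f0 g heq_refl)
    with SS_cong [OF SS_dX] show ?thesis by (simp add: 1)
  next
    case 2
    have "f 0 * ?X * g 1 + f 1 * ?X * g 0 \<approx> 1 * ?X * ?G1 + - ?G1 * ?X * 1"
      by (intro heq_add heq_mult f0 f1 g heq_refl)
    also have "1 * ?X * ?G1 + - ?G1 * ?X * 1 = cm ?X ?G1" by simp
    also have "cm ?X ?G1 \<approx> (\<alpha> - \<beta>) *\<^sub>C yel x" by (rule cm_G1)
    finally show ?thesis
      using SS_cong [OF SS_scale [OF SS_yel]] by (simp add: 2)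
  next
    case 3
    have "f 0 * ?X * g 2 + f 1 * ?X * g 1 + f 2 * ?X * g 0 \<approx>
        1 * ?X * ?G2 + - ?G1 * ?X * ?G1 + (?G1 * ?G1 - ?G2) * ?X * 1"
      by (intro heq_add heq_mult f0 f1 f2 g heq_refl)
    also have "1 * ?X * ?G2 + - ?G1 * ?X * ?G1 + (?G1 * ?G1 - ?G2) * ?X * 1 = cm ?X ?G2 - ?G1 * cm ?X ?G1"
      by (simp add: algebra_simps)
    finally show ?thesis
      using SS_cong [OF twisted_second_order [OF ab]] by (simp add: 3 numeral_2_eq_2)
  qed
qed

lemma SgsSgs_elem_lookup: "SgsSgs_elem n (Poly_Mapping.lookup y) \<longleftrightarrow> Poly_Mapping.keys y \<subseteq> lists dual_letters"
  by (fastforce simp: SgsSgs_elem_def in_keys_iff lists_eq_set subset_iff)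

end

theorem theorem5p4p1:
  fixes n :: nat and c :: "nat \<Rightarrow> nat \<Rightarrow> nat \<Rightarrow> complex"
    and \<alpha> \<beta> :: complex and Finv F :: "nat \<Rightarrow> hh"
  assumes lie: "lie_sc n c"
    and ab: "\<alpha> - \<beta> = - 1 / 2"
    and Finv_elem: "\<forall>k. HH_elem n (Finv k)"
    and F_elem: "\<forall>k. HH_elem n (F k)"
    and Finv0: "fa_cong (HH_rel n c) (Finv 0) fa_one"
    and Finv1: "fa_cong (HH_rel n c) (Finv 1) (fa_add (fa_smult \<alpha> (Q1 n)) (fa_smult \<beta> (Q2 n)))"
    and Finv2: "fa_cong (HH_rel n c) (Finv 2) (Finv2 n c \<alpha> \<beta>)"
    and inv1: "\<forall>k. fa_cong (HH_rel n c) (ps_mul F Finv k) (ps_const fa_one k)"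
    and inv2: "\<forall>k. fa_cong (HH_rel n c) (ps_mul Finv F k) (ps_const fa_one k)"
  shows "(\<forall>a b. S_elem n a \<longrightarrow> S_elem n b \<longrightarrow>
            (\<forall>k<3. fa_cong (S_rel n)
                      (mu (act n c (Finv k) (tens a b)))
                      (phi_inv n c (fa_mul (phi a) (phi b)) k)))
       \<and> (\<forall>x :: nat \<Rightarrow> complex.
            let X = fa_sum (\<lambda>i. fa_smult (x i) (fa_add (hg False (D i)) (hg True (D i)))) {..<n}
            in \<forall>k<3. \<exists>y. SgsSgs_elem n y \<and>
                 fa_cong (HH_rel n c) (ps_mul (ps_mul F (ps_const X)) Finv k) y)"
proof -
  interpret lie n c by standard (rule lie)
  have "\<exists>g. \<forall>k. Finv k = Poly_Mapping.lookup (g k)" "\<exists>f. \<forall>k. F k = Poly_Mapping.lookup (f k)"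
    by (intro choice allI, use Finv_elem F_elem in \<open>metis HH_elem_def fa_fin_obtain\<close>)+
  then obtain f g where fg: "Finv = (\<lambda>k. Poly_Mapping.lookup (g k))" "F = (\<lambda>k. Poly_Mapping.lookup (f k))"
    by blast
  have g: "g 0 \<approx> 1" "g 1 \<approx> pG1 n \<alpha> \<beta>" "g 2 \<approx> pG2 n c \<alpha> \<beta>"
    using Finv0 Finv1 Finv2
    by (simp_all add: fg heq_def pG1_def Q1_lookup Q2_lookup Finv2_lookup fa_lookup fa_cong_lookup)
  have psm: "ps_mul (\<lambda>k. Poly_Mapping.lookup (p k)) (\<lambda>k. Poly_Mapping.lookup (q k)) k =
      Poly_Mapping.lookup (\<Sum>i\<le>k. p i * q (k - i))" for p q :: "nat \<Rightarrow> (bool \<times> gen) list \<Rightarrow>\<^sub>0 complex" and k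
    by (simp add: ps_mul_def fa_lookup)
  have psc: "ps_const (Poly_Mapping.lookup p) = (\<lambda>k. Poly_Mapping.lookup (if k = 0 then p else 0))" for p :: "(bool \<times> gen) list \<Rightarrow>\<^sub>0 complex"
    by (auto simp: ps_const_def fa_lookup fun_eq_iff)
  have inv: "(\<Sum>i\<le>k. f i * g (k - i)) \<approx> (if k = 0 then 1 else 0)" for k
    using inv1 unfolding fg psm fa_one_lookup psc fa_cong_lookup heq_def by blast
  have part_a: "fa_cong (S_rel n) (mu (act n c (Finv k) (tens a b))) (phi_inv n c (fa_mul (phi a) (phi b)) k)"
    if S: "S_elem n a" "S_elem n b" and "k < 3" for a b k
  proof -
    obtain a' b' where ab': "a = Poly_Mapping.lookup a'" "b = Poly_Mapping.lookup b'"
      using S by (metis S_elem_def fa_fin_obtain)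
    have keys: "Poly_Mapping.keys a' \<subseteq> lists {..<n}" "Poly_Mapping.keys b' \<subseteq> lists {..<n}"
      using S by (simp_all add: ab' S_elem_lookup)
    let ?bd = "\<lambda>Z. bd (\<lambda>f. f) (\<lambda>f. f) Z (toR a') (toR b')"
    \<comment> \<open>The coefficients of F^{-1} are known only up to congruence, so their
      representatives have to be exchangeable.\<close>
    have bd_cong: "?bd Z = ?bd Z'" if "Z \<approx> Z'" for Z Z'
      using bd_ideal [OF that [unfolded heq_def] clinear_ident clinear_ident, of "toR a'" "toR b'"]
      by (simp add: clinear_diff [OF clinear_bd])
    obtain q where q: "phi_inv n c (fa_mul (phi a) (phi b)) k = Poly_Mapping.lookup q"
      "Poly_Mapping.keys q \<subseteq> lists {..<n}" "toR q = comp3 k (star \<alpha> \<beta> (toR a') (toR b'))"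
      using phi_inv_star [OF keys ab \<open>k < 3\<close>] unfolding ab' by blast
    have one: "?bd 1 = toR a' * toR b'"
      using bd_word [of _ _ "[]"] by simp
    consider "k = 0" | "k = 1" | "k = 2" using \<open>k < 3\<close> by linarith
    then have "?bd (g k) = comp3 k (star \<alpha> \<beta> (toR a') (toR b'))"
      by cases (simp_all add: star_def bd_cong [OF g(1)] bd_cong [OF g(2)] bd_cong [OF g(3)] one bd_pG1 bd_pG2 del: One_nat_def)
    then have "toR (pmu (pact (g k) (ptens a' b'))) = toR q"
      by (simp add: toR_act [OF keys] q(3))
    from S_cong [OF keys_pmu_pact [OF keys] q(2) this] show ?thesis
      unfolding q(1) by (simp add: fg ab' tens_lookup act_lookup mu_lookup)
  qed
  have part_b: "\<exists>y. SgsSgs_elem n y \<and> fa_cong (HH_rel n c) (ps_mul (ps_mul F (ps_const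
      (fa_sum (\<lambda>i. fa_smult (x i) (fa_add (hg False (D i)) (hg True (D i)))) {..<n}))) Finv k) y"
    if "k < 3" for x :: "nat \<Rightarrow> complex" and k
  proof -
    have X: "fa_sum (\<lambda>i. fa_smult (x i) (fa_add (hg False (D i)) (hg True (D i)))) {..<n} = Poly_Mapping.lookup (dX x)"
      by (simp add: dX_def hg_def fa_lookup)
    \<comment> \<open>The constant series contributes only in degree 0, that is for
      \<open>j = i\<close>.\<close>
    have inner: "(\<Sum>j\<le>i. f j * (if i - j = 0 then dX x else 0)) = f i * dX x" for i
    proof -
      have "(\<Sum>j\<le>i. f j * (if i - j = 0 then dX x else 0)) = (\<Sum>j\<le>i. if j = i then f i * dX x else 0)"
        by (intro sum.cong refl) auto
      then show ?thesis by simp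
    qed
    have "(\<Sum>i\<le>k. f i * dX x * g (k - i)) \<in> SS"
      by (rule twisted_coproduct [OF ab g _ _ _ that])
        (use inv [of 0] inv [of 1] inv [of 2] in \<open>simp_all add: numeral_2_eq_2\<close>)
    then obtain y where "Poly_Mapping.keys y \<subseteq> lists {(s, D i) | s i. i < n}" "(\<Sum>i\<le>k. f i * dX x * g (k - i)) \<approx> y"
      unfolding SS_def by blast
    then show ?thesis
      unfolding X fg psc psm inner
      by (intro exI [of _ "Poly_Mapping.lookup y"]) (simp add: SgsSgs_elem_lookup fa_cong_lookup heq_def)
  qed
  show ?thesis
    unfolding Let_def using part_a part_b by blast
qed

end
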